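(* Let $\mathbb K=[-1,1]$, $H(x,p)=\frac{1-x}2(e^{2p}-1)+\frac{1+x}2(e^{-2p}-1)$ and $I_0(x)=\frac{1-x}2\log(1-x)+\frac{1+x}2\log(1+x)-\frac12\alpha x^2-\theta x+C$. (a) For $\alpha\ge0$ and $\theta\in\mathbb R$ such that $I_0'(x)=0$ has a unique solution in $(-1,1)$, there is $t^*$ such that $I_t\in C^{1,\partial}[-1,1]$ for all $t\ge t^*$. (b) For every $\alpha>1$ there is $\kappa>0$ such that for every $\theta$ with $|\theta|>\kappa$ there are times $t_0<t_1\le t_2$ with: (i) $I_t\in C^{1,\partial}[-1,1]$ for $t<t_0$; (ii) $\mathcal G_t$ has an overhang for every $t\in(t_0,t_2)$, and $I_t$ is not differentiable (on $(-1,1)$) for every $t\in(t_0,t_1)$; (iii) $I_t\in C^{1,\partial}[-1,1]$ for $t>t_2$.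
   Context: $C$ is chosen such that $\inf_{[-1,1]}I_0=0$. For $H$, $\mathcal L(x,v)=\sup_p(pv-H(x,p))$; for $t>0$, $S_t(a,b)=\inf\int_0^t\mathcal L(\gamma,\dot\gamma)\,ds$ over absolutely continuous $\gamma:[0,t]\to[-1,1]$ with $\gamma(0)=a,\gamma(t)=b$, and $I_t(b)=\inf_{x\in[-1,1]}(I_0(x)+S_t(x,b))$. $C^{1,\partial}[-1,1]$: continuous $g:[-1,1]\to\mathbb R$, $C^1$ on $(-1,1)$, with $g'(x)\to+\infty$ as $x\to1$ and $g'(x)\to-\infty$ as $x\to-1$. The Hamilton flow $(X_t^{x,p},P_t^{x,p})$ solves $\dot X=\partial_pH(X,P)$, $\dot P=-\partial_xH(X,P)$ from $(x,p)$ on its maximal interval $[0,t_{x,p})$. $\mathcal G=\{(x,I_0'(x)):x\in(-1,1)\}$, $\mathcal G_t=\{(X_t^{x,p},P_t^{x,p}):(x,p)\in\mathcal G,t<t_{x,p}\}$; $\mathcal G_t$ has an overhang (at $x$) if there are $y_1\ne y_2$ with $(x,y_1),(x,y_2)\in\mathcal G_t$. *)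

theory Defs
  imports "HOL-Analysis.Analysis"
begin

definition H :: "real \<Rightarrow> real \<Rightarrow> real" where
  "H x p = (1 - x) / 2 * (exp (2 * p) - 1) + (1 + x) / 2 * (exp (- 2 * p) - 1)"

definition Hp :: "real \<Rightarrow> real \<Rightarrow> real" where
  "Hp x p = deriv (\<lambda>q. H x q) p"

definition Hx :: "real \<Rightarrow> real \<Rightarrow> real" where
  "Hx x p = deriv (\<lambda>y. H y p) x"

text \<open>Lagrangian L(x,v) = sup_p (p v - H(x,p)); it is always >= 0 (take p = 0),
  possibly +infinity, hence valued in ennreal.\<close>
definition Lag :: "real \<Rightarrow> real \<Rightarrow> ennreal" where
  "Lag x v = (SUP p. ennreal (p * v - H x p))"

text \<open>I_0 without the normalising constant, and the constant C making inf_{[-1,1]} I_0 = 0.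
  (Note 0 * ln 0 = 0, so the endpoint values use the convention 0 log 0 = 0.)\<close>
definition I0base :: "real \<Rightarrow> real \<Rightarrow> real \<Rightarrow> real" where
  "I0base \<alpha> \<theta> x = (1 - x) / 2 * ln (1 - x) + (1 + x) / 2 * ln (1 + x)
      - 1/2 * \<alpha> * x^2 - \<theta> * x"

definition Cconst :: "real \<Rightarrow> real \<Rightarrow> real" where
  "Cconst \<alpha> \<theta> = - (INF x\<in>{-1..1}. I0base \<alpha> \<theta> x)"

definition I0 :: "real \<Rightarrow> real \<Rightarrow> real \<Rightarrow> real" where
  "I0 \<alpha> \<theta> x = I0base \<alpha> \<theta> x + Cconst \<alpha> \<theta>"

definition abs_cont_on :: "real \<Rightarrow> real \<Rightarrow> (real \<Rightarrow> real) \<Rightarrow> bool" where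
  "abs_cont_on a b g \<longleftrightarrow>
    (\<forall>\<epsilon>>0. \<exists>\<delta>>0. \<forall>(n::nat) (l::nat \<Rightarrow> real) (r::nat \<Rightarrow> real).
       (\<forall>i<n. a \<le> l i \<and> l i \<le> r i \<and> r i \<le> b) \<and>
       (\<forall>i<n. \<forall>j<n. i \<noteq> j \<longrightarrow> r i \<le> l j \<or> r j \<le> l i) \<and>
       (\<Sum>i<n. r i - l i) < \<delta>
       \<longrightarrow> (\<Sum>i<n. \<bar>g (r i) - g (l i)\<bar>) < \<epsilon>)"

definition action :: "real \<Rightarrow> (real \<Rightarrow> real) \<Rightarrow> ennreal" where
  "action t \<gamma> = (\<integral>\<^sup>+ s. indicator {0..t} s * Lag (\<gamma> s) (vector_derivative \<gamma> (at s)) \<partial>lborel)"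

definition S :: "real \<Rightarrow> real \<Rightarrow> real \<Rightarrow> ennreal" where
  "S t a b = (INF \<gamma> \<in> {\<gamma>. abs_cont_on 0 t \<gamma> \<and> \<gamma> ` {0..t} \<subseteq> {-1..1} \<and> \<gamma> 0 = a \<and> \<gamma> t = b}.
               action t \<gamma>)"

text \<open>I_t(b) = inf_x (I_0(x) + S_t(x,b)).  (For t = 0 this formula gives back I_0.)\<close>
definition It :: "real \<Rightarrow> real \<Rightarrow> real \<Rightarrow> real \<Rightarrow> ennreal" where
  "It \<alpha> \<theta> t b = (INF x\<in>{-1..1}. ennreal (I0 \<alpha> \<theta> x) + S t x b)"

definition C1partial :: "(real \<Rightarrow> ennreal) \<Rightarrow> bool" where
  "C1partial g \<longleftrightarrow>
     (\<forall>x\<in>{-1..1}. g x < \<infinity>) \<and>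
     (let f = (\<lambda>x. enn2real (g x)) in
        continuous_on {-1..1} f \<and>
        (\<forall>x\<in>{-1<..<1}. f differentiable (at x)) \<and>
        continuous_on {-1<..<1} (deriv f) \<and>
        filterlim (deriv f) at_top (at_left 1) \<and>
        filterlim (deriv f) at_bot (at_right (-1)))"

definition diff_on_open :: "(real \<Rightarrow> ennreal) \<Rightarrow> bool" where
  "diff_on_open g \<longleftrightarrow>
     (\<forall>x\<in>{-1<..<1}. g x < \<infinity> \<and> (\<lambda>y. enn2real (g y)) differentiable (at x))"

text \<open>G_t: image of the graph of I_0' under the Hamilton flow at time t.  A point (x,p) has
  t < t_{x,p} iff the Hamilton ODE has a solution on [0,t] starting at (x,p) (H is smooth,
  so solutions are unique).\<close>
definition Gt :: "real \<Rightarrow> real \<Rightarrow> real \<Rightarrow> (real \<times> real) set" where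
  "Gt \<alpha> \<theta> t = {(X t, P t) | X P x. x \<in> {-1<..<1} \<and> X 0 = x \<and> P 0 = deriv (I0 \<alpha> \<theta>) x \<and>
      (\<forall>s\<in>{0..t}. (X has_real_derivative Hp (X s) (P s)) (at s within {0..t}) \<and>
                   (P has_real_derivative - Hx (X s) (P s)) (at s within {0..t}))}"

definition overhang :: "(real \<times> real) set \<Rightarrow> bool" where
  "overhang G \<longleftrightarrow> (\<exists>x y1 y2. y1 \<noteq> y2 \<and> (x, y1) \<in> G \<and> (x, y2) \<in> G)"

end

(*
  Write ent for the entropy part of I_0, m = exp (-2t), q = alpha y + theta and B = artanh (m tanh q).
  Reversibility of the spin-flip dynamics and the linearisation of the quadratic term
  (-alpha a^2/2 is the minimum over y of alpha y^2/2 - alpha y a) give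
    I_t(b) = ent b + C + min_y (alpha y^2/2 - ln cosh q + ln cosh B - b B).
  This minimum of affine functions of b is differentiable exactly where the minimiser y is unique, and the
  critical points y are the starting points of the characteristics that end in b at time t.

  The lower bound for the action is a calibration argument: as H is affine in x, a solution of p' = sinh 2p
  satisfies Lag (g, g') >= (p g - ln cosh p)' along every path g.  It needs that absolutely continuous
  functions are differentiable almost everywhere.  The explicit characteristics attain the bound.

  The characteristic from y is focused from a time rho(y) on and leaves (-1,1) at a time tau(y), and
  rho(y) < tau(y) holds precisely where I_0' is decreasing, i.e. alpha (1 - y^2) > 1.  As this is an interval,
  the times with an overhang form an interval (t0,t2).  For a strong field it is bounded because I_0' has no
  zero there, and the first fold occurs in the interior, so that just after t0 the minimisers lie on both
  sides of the fold and must jump across it.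
*)
theory Submission
  imports Defs "HOL-Real_Asymp.Real_Asymp"
begin

section \<open>Absolutely continuous functions\<close>

text \<open>The momentum equation contains no \<open>x\<close>, and it is linear in
  \<open>tanh p\<close>, which grows like \<open>exp (2 * s)\<close>. The reversed momentum
  \<open>b = artanh x - p\<close> has a \<open>tanh\<close> that decays like
  \<open>exp (- 2 * s)\<close>, so each characteristic is the explicit curve
  \<open>x = tanh (b + p)\<close>, and \<open>\<alpha> * y + \<theta>\<close> is the initial value
  of \<open>b\<close>. The obstacle is the boundary: \<open>p\<close> becomes infinite exactly when
  a characteristic reaches 1 or -1, yet the minimal cost must be known there too. The reversed
  momentum stays bounded, so costs are written with it and with the entropy, which is continuous on
  the closed interval; for the lower bound the target is approached from inside. Moreover
  \<open>flow t y\<close> remains a smooth function of \<open>y\<close> after the characteristic has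
  left, but then has no meaning for the dynamics. Monotonicity is therefore available only in the
  window \<open>|flow t y| < 1\<close>, and the arguments about crossings must tolerate excursions
  out of it.\<close>

abbreviation len :: "real set \<Rightarrow> real" where "len \<equiv> measure lborel"

text \<open>Taking the set rather than its endpoints as argument lets increments be summed over
  plain and tagged divisions, whose pieces are sets.\<close>

definition incr :: "(real \<Rightarrow> real) \<Rightarrow> real set \<Rightarrow> real" where
  "incr F K = F (Sup K) - F (Inf K)"

lemma incr_atLeastAtMost [simp]: "u \<le> v \<Longrightarrow> incr F {u..v} = F v - F u"
  by (simp add: incr_def)

lemma sum_incr_division:
  assumes "a \<le> b" "p division_of {a..b}"
  shows "sum (incr F) p = F b - F a"
proof -
  \<comment> \<open>Set to 0 on the empty set, where \<open>Sup\<close> and \<open>Inf\<close> have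
    no useful value; an operative function must vanish there.\<close>
  let ?f = "\<lambda>K::real set. if K = {} then 0 else incr F K"
  interpret operative_real plus 0 ?f
    rewrites "comm_monoid_set.F (+) 0 = sum"
    by standard[1] (auto simp add: sum_def incr_def)
  have "sum ?f p = ?f {a..b}"
    using division[of p a b] assms(2) by simp
  moreover have "sum ?f p = sum (incr F) p"
    using division_ofD(3)[OF assms(2)] by (intro sum.cong) auto
  ultimately show ?thesis using assms(1) by auto
qed

lemma abs_cont_onE:
  assumes "abs_cont_on a b F" "\<epsilon> > 0"
  obtains \<delta> where "\<delta> > 0"
    "\<And>(n::nat) (l::nat \<Rightarrow> real) (r::nat \<Rightarrow> real).
       \<lbrakk>\<And>i. i < n \<Longrightarrow> a \<le> l i \<and> l i \<le> r i \<and> r i \<le> b;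
        \<And>i j. i < n \<Longrightarrow> j < n \<Longrightarrow> i \<noteq> j \<Longrightarrow> r i \<le> l j \<or> r j \<le> l i;
        (\<Sum>i<n. r i - l i) < \<delta>\<rbrakk> \<Longrightarrow> (\<Sum>i<n. \<bar>F (r i) - F (l i)\<bar>) < \<epsilon>"
  using assms(1)[unfolded abs_cont_on_def, THEN spec, THEN mp, OF assms(2)]
  by (elim exE conjE) (rule that, assumption, blast)

lemma abs_cont_onI:
  assumes "\<And>\<epsilon>. \<epsilon> > 0 \<Longrightarrow> \<exists>\<delta>>0. \<forall>(n::nat) (l::nat \<Rightarrow> real) (r::nat \<Rightarrow> real).
        (\<forall>i<n. a \<le> l i \<and> l i \<le> r i \<and> r i \<le> b) \<longrightarrow>
        (\<forall>i<n. \<forall>j<n. i \<noteq> j \<longrightarrow> r i \<le> l j \<or> r j \<le> l i) \<longrightarrow>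
        (\<Sum>i<n. r i - l i) < \<delta> \<longrightarrow> (\<Sum>i<n. \<bar>F (r i) - F (l i)\<bar>) < \<epsilon>"
  shows "abs_cont_on a b F"
  unfolding abs_cont_on_def
proof (intro allI impI)
  fix \<epsilon> :: real assume "\<epsilon> > 0"
  from assms[OF this] show "\<exists>\<delta>>0. \<forall>(n::nat) (l::nat \<Rightarrow> real) (r::nat \<Rightarrow> real).
       (\<forall>i<n. a \<le> l i \<and> l i \<le> r i \<and> r i \<le> b) \<and>
       (\<forall>i<n. \<forall>j<n. i \<noteq> j \<longrightarrow> r i \<le> l j \<or> r j \<le> l i) \<and> (\<Sum>i<n. r i - l i) < \<delta>
       \<longrightarrow> (\<Sum>i<n. \<bar>F (r i) - F (l i)\<bar>) < \<epsilon>"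
    by (simp only: imp_conjL)
qed

lemma open_intervals_disjoint_imp:
  fixes a b c d :: real
  assumes "{a<..<b} \<inter> {c<..<d} = {}" "a < b" "c < d"
  shows "b \<le> c \<or> d \<le> a"
proof (rule ccontr)
  assume "\<not> ?thesis"
  then have "(max a c + min b d) / 2 \<in> {a<..<b} \<inter> {c<..<d}"
    using assms(2,3) by (auto simp: max_def min_def)
  with assms(1) show False by blast
qed

text \<open>Enumerating the pieces of a division gives an indexed family as in
  \<open>abs_cont_on_def\<close>. Both Austin's argument and the gauge integral speak of
  divisions.\<close>

lemma abs_cont_on_division:
  assumes F: "abs_cont_on a b F" and "\<epsilon> > 0"
  obtains \<delta> where "\<delta> > 0"
    "\<And>p. \<lbrakk>p division_of \<Union>p; \<Union>p \<subseteq> {a..b}; sum len p < \<delta>\<rbrakk> \<Longrightarrow> (\<Sum>K\<in>p. \<bar>incr F K\<bar>) < \<epsilon>"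
proof -
  obtain \<delta> where \<delta>: "\<delta> > 0" and D: "\<And>(n::nat) (l::nat \<Rightarrow> real) (r::nat \<Rightarrow> real).
       \<lbrakk>\<And>i. i < n \<Longrightarrow> a \<le> l i \<and> l i \<le> r i \<and> r i \<le> b;
        \<And>i j. i < n \<Longrightarrow> j < n \<Longrightarrow> i \<noteq> j \<Longrightarrow> r i \<le> l j \<or> r j \<le> l i;
        (\<Sum>i<n. r i - l i) < \<delta>\<rbrakk> \<Longrightarrow> (\<Sum>i<n. \<bar>F (r i) - F (l i)\<bar>) < \<epsilon>"
    by (rule abs_cont_onE[OF F \<open>\<epsilon> > 0\<close>]) (rule that; blast)
  show ?thesis
  proof (rule that[OF \<delta>])
    fix p assume p: "p division_of \<Union>p" and sub: "\<Union>p \<subseteq> {a..b}" and small: "sum len p < \<delta>"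
    \<comment> \<open>Pieces of length zero are dropped: a point inside another piece has empty
      interior, so a division allows it, but it violates
      \<open>r i \<le> l j \<or> r j \<le> l i\<close>. It carries no increment.\<close>
    define p' where "p' = {K\<in>p. len K \<noteq> 0}"
    have fin: "finite p" using p by blast
    then have fin': "finite p'" by (simp add: p'_def)
    obtain h where h: "bij_betw h {..<card p'} p'"
      using ex_bij_betw_nat_finite[OF fin'] by (auto simp: atLeast0LessThan)
    have K: "\<exists>u v. K = {u..v} \<and> u < v \<and> a \<le> u \<and> v \<le> b" if "K \<in> p'" for K
    proof -
      have Kp: "K \<in> p" and c: "len K \<noteq> 0" using that by (auto simp: p'_def)
      obtain u v where uv: "K = cbox u v" using division_ofD(4)[OF p Kp] by blast
      have uv': "u < v" using c uv by (simp add: split: if_splits)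
      have "K \<subseteq> {a..b}" using Kp sub by blast
      then show ?thesis using uv uv' by auto
    qed
    have hp: "h i \<in> p'" if "i < card p'" for i using that h by (auto simp: bij_betw_def)
    have L: "\<And>i. i < card p' \<Longrightarrow> a \<le> Inf (h i) \<and> Inf (h i) \<le> Sup (h i) \<and> Sup (h i) \<le> b
         \<and> h i = {Inf (h i)..Sup (h i)} \<and> Inf (h i) < Sup (h i)"
      using K[OF hp] by fastforce
    have disj: "Sup (h i) \<le> Inf (h j) \<or> Sup (h j) \<le> Inf (h i)" if "i < card p'" "j < card p'" "i \<noteq> j" for i j
    proof -
      have "h i \<noteq> h j" using h that by (auto simp: bij_betw_def inj_on_def)
      then have "interior (h i) \<inter> interior (h j) = {}"
        using division_ofD(5)[OF p] hp that by (auto simp: p'_def)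
      then have "{Inf (h i)<..<Sup (h i)} \<inter> {Inf (h j)<..<Sup (h j)} = {}"
        using L[OF that(1)] L[OF that(2)] interior_atLeastAtMost_real by metis
      then show ?thesis using L[OF that(1)] L[OF that(2)]
        using open_intervals_disjoint_imp[of "Inf (h i)" "Sup (h i)" "Inf (h j)" "Sup (h j)"] by blast
    qed
    have "(\<Sum>i<card p'. Sup (h i) - Inf (h i)) = (\<Sum>i<card p'. len (h i))"
    proof (intro sum.cong refl)
      fix i assume "i \<in> {..<card p'}"
      then have "h i = {Inf (h i)..Sup (h i)}" "Inf (h i) < Sup (h i)" using L by auto
      then show "Sup (h i) - Inf (h i) = len (h i)"
        by (metis measure_lborel_Icc less_imp_le)
    qed
    also have "\<dots> = sum len p'"
      using sum.reindex_bij_betw[OF h] by simp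
    also have "\<dots> = sum len p"
      by (rule sum.mono_neutral_left) (auto simp: p'_def fin)
    finally have "(\<Sum>i<card p'. \<bar>F (Sup (h i)) - F (Inf (h i))\<bar>) < \<epsilon>"
      using small L disj by (intro D) auto
    also have "(\<Sum>i<card p'. \<bar>F (Sup (h i)) - F (Inf (h i))\<bar>) = (\<Sum>K\<in>p'. \<bar>incr F K\<bar>)"
      using sum.reindex_bij_betw[OF h, of "\<lambda>K. \<bar>incr F K\<bar>"] by (simp add: incr_def)
    also have "\<dots> = (\<Sum>K\<in>p. \<bar>incr F K\<bar>)"
    proof (rule sum.mono_neutral_left)
      show "\<forall>K\<in>p - p'. \<bar>incr F K\<bar> = 0"
      proof
        fix K assume "K \<in> p - p'"
        then have Kp: "K \<in> p" and c: "len K = 0" by (auto simp: p'_def)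
        obtain u v where uv: "K = cbox u v" using division_ofD(4)[OF p Kp] by blast
        moreover have "K \<noteq> {}" using division_ofD(3)[OF p Kp] by blast
        ultimately show "\<bar>incr F K\<bar> = 0" using c by (auto simp: incr_def split: if_splits)
      qed
    qed (auto simp: p'_def fin)
    finally show "(\<Sum>K\<in>p. \<bar>incr F K\<bar>) < \<epsilon>" .
  qed
qed

lemma division_of_disjoint_intervals:
  fixes D :: "real set set"
  assumes "finite D" "pairwise disjnt D" "\<And>J. J \<in> D \<Longrightarrow> \<exists>u v. u < v \<and> J = {u..v}"
  shows "D division_of \<Union>D"
proof (rule division_ofI)
  fix J assume J: "J \<in> D"
  then show "J \<noteq> {}" "\<exists>a b. J = cbox a b" using assms(3)[OF J] by auto
  fix J' assume "J' \<in> D" "J \<noteq> J'"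
  then have "disjnt J J'" using J assms(2) by (auto simp: pairwise_def)
  then show "interior J \<inter> interior J' = {}"
    using interior_subset by (metis disjnt_def disjoint_iff subsetD)
qed (use assms in auto)

section \<open>Vitali coverings and differentiability almost everywhere\<close>

lemma lmeasurable_Un_negligible:
  assumes "T \<in> lmeasurable" "negligible N"
  shows "T \<union> N \<in> lmeasurable" "measure lebesgue (T \<union> N) = measure lebesgue T"
  using assms fmeasurable.Un[OF assms(1) negligible_imp_measurable[OF assms(2)]]
  by (auto simp: negligible_iff_null_sets fmeasurableD intro!: measure_Un_null_set)

text \<open>Vitali's theorem selects a countable disjoint subfamily that covers \<open>S\<close> up
  to a null set. Every finite part of it has total length at most \<open>B\<close>, and the union
  inherits this bound.\<close>

lemma Vitali_interval_outer_bound: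
  fixes S :: "real set" and \<J> :: "real set set"
  assumes J: "\<And>K. K \<in> \<J> \<Longrightarrow> \<exists>u v. u < v \<and> K = {u..v}"
    and cov: "\<And>x \<eta>. x \<in> S \<Longrightarrow> 0 < \<eta> \<Longrightarrow> \<exists>K\<in>\<J>. x \<in> K \<and> len K < \<eta>"
    and bound: "\<And>D. finite D \<Longrightarrow> D \<subseteq> \<J> \<Longrightarrow> pairwise disjnt D \<Longrightarrow> sum len D \<le> B"
  obtains T where "T \<in> lmeasurable" "S \<subseteq> T" "measure lebesgue T \<le> B"
proof -
  \<comment> \<open>Midpoint and half length: the covering theorem speaks of closed balls.\<close>
  define a where "a K = (Inf K + Sup K) / 2" for K :: "real set"
  define r where "r K = (Sup K - Inf K) / 2" for K :: "real set"
  have cb: "cball (a K) (r K) = K \<and> r K > 0 \<and> len K = 2 * r K" if K: "K \<in> \<J>" for K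
  proof -
    obtain u v where "u < v" "K = {u..v}" using J[OF K] by blast
    then show ?thesis by (auto simp: a_def r_def cball_eq_atLeastAtMost field_simps)
  qed
  obtain C where C: "countable C" "C \<subseteq> \<J>"
     "pairwise (\<lambda>i j. disjnt (cball (a i) (r i)) (cball (a j) (r j))) C"
     and neg: "negligible (S - (\<Union>i \<in> C. cball (a i) (r i)))"
  proof (rule Vitali_covering_theorem_cballs[of \<J> r S a])
    show "\<And>K. K \<in> \<J> \<Longrightarrow> 0 < r K" using cb by blast
    show "\<exists>K. K \<in> \<J> \<and> x \<in> cball (a K) (r K) \<and> r K < d" if "x \<in> S" "0 < d" for x d
    proof -
      obtain K where "K \<in> \<J>" "x \<in> K" "len K < d" using cov \<open>x \<in> S\<close> \<open>0 < d\<close> by blast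
      then show ?thesis using cb[of K] by (intro exI[of _ K]) auto
    qed
  qed blast
  have eq: "(\<Union>i \<in> C. cball (a i) (r i)) = \<Union>C" using cb C(2) by (auto 0 3)
  have disj: "pairwise disjnt C"
    using C(2,3) cb unfolding pairwise_def by (metis subsetD)
  have meas: "K \<in> lmeasurable" if "K \<in> C" for K
    using J[of K] C(2) that by auto
  have Bd: "measure lebesgue (\<Union>D) \<le> B" if "D \<subseteq> C" "finite D" for D
  proof -
    have "measure lebesgue (\<Union>D) \<le> (\<Sum>K\<in>D. measure lebesgue K)"
      using that meas by (intro measure_Union_le[OF that(2)]) (blast intro: fmeasurableD)
    also have "\<dots> = sum len D"
    proof (intro sum.cong refl)
      fix K assume "K \<in> D"
      then obtain u v where "K = {u..v}" using J[of K] C(2) \<open>D \<subseteq> C\<close> by blast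
      then show "measure lebesgue K = len K" by simp
    qed
    also have "\<dots> \<le> B"
      using that C(2) disj by (intro bound) (auto intro: pairwise_subset)
    finally show ?thesis .
  qed
  have "\<Union>C \<in> lmeasurable" "measure lebesgue (\<Union>C) \<le> B"
    using fmeasurable_Union_bound[OF C(1) meas Bd] measure_Union_bound[OF C(1) meas Bd] by blast+
  moreover define N where "N = S - \<Union>C"
  moreover have N: "negligible N" using neg eq N_def by simp
  ultimately show ?thesis
    using lmeasurable_Un_negligible[of "\<Union>C" N] by (intro that[of "\<Union>C \<union> N"]) auto
qed

text \<open>Austin's argument: an interval inside \<open>K\<close> over which \<open>G\<close> moves against its increment over \<open>K\<close>
  adds twice its own increment to the variation, so few such intervals fit once \<open>D0\<close> is nearly optimal.\<close>

lemma sum_abs_incr_refine_ge: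
  assumes D0: "D0 division_of {c..d}" and e: "e > 0"
    and V: "\<And>p. p division_of {c..d} \<Longrightarrow> (\<Sum>K\<in>p. \<bar>incr G K\<bar>) \<le> V"
    and D: "finite D" "pairwise disjnt D"
    and J: "\<And>J. J \<in> D \<Longrightarrow> \<exists>K\<in>D0. J \<subseteq> K \<and> (\<exists>u v. u < v \<and> J = {u..v}) \<and>
              (if incr G K \<ge> 0 then incr G J \<le> - e * len J else incr G J \<ge> e * len J)"
  shows "(\<Sum>K\<in>D0. \<bar>incr G K\<bar>) + 2 * e * sum len D \<le> V"
proof -
  have fin0: "finite D0" using D0 by blast
  obtain \<kappa> where \<kappa>: "\<And>J. J \<in> D \<Longrightarrow> \<kappa> J \<in> D0" "\<And>J. J \<in> D \<Longrightarrow> J \<subseteq> \<kappa> J"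
     "\<And>J. J \<in> D \<Longrightarrow> (\<exists>u v. u < v \<and> J = {u..v})"
     "\<And>J. J \<in> D \<Longrightarrow> (if incr G (\<kappa> J) \<ge> 0 then incr G J \<le> - e * len J else incr G J \<ge> e * len J)"
    using J by metis
  define DD where "DD K = {J\<in>D. \<kappa> J = K}" for K
  have K0: "\<exists>u v. u \<le> v \<and> K = {u..v}" if "K \<in> D0" for K
    using division_ofD(3,4)[OF D0 that] by (metis atLeastatMost_empty_iff2 box_real(2) linorder_le_cases)
  have ex: "\<exists>q. DD K \<subseteq> q \<and> q division_of K" if K: "K \<in> D0" for K
  proof -
    obtain u v where uv: "u \<le> v" "K = {u..v}" using K0[OF K] by blast
    have "DD K division_of \<Union>(DD K)"
      using D \<kappa>(3) by (intro division_of_disjoint_intervals) (auto simp: DD_def intro: pairwise_subset)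
    moreover have "\<Union>(DD K) \<subseteq> cbox u v" using \<kappa>(2) uv by (fastforce simp: DD_def)
    ultimately obtain q where "DD K \<subseteq> q" "q division_of cbox u v"
      by (rule partial_division_extend_interval)
    then show ?thesis unfolding uv(2) by (intro exI[of _ q]) simp
  qed
  then obtain q where q: "\<And>K. K \<in> D0 \<Longrightarrow> DD K \<subseteq> q K" "\<And>K. K \<in> D0 \<Longrightarrow> q K division_of K"
    by metis
  have step: "\<bar>incr G K\<bar> + 2 * e * sum len (DD K) \<le> (\<Sum>J\<in>q K. \<bar>incr G J\<bar>)" if K: "K \<in> D0" for K
  proof -
    obtain u v where uv: "u \<le> v" "K = {u..v}" using K0[OF K] by blast
    \<comment> \<open>With this sign the increments over \<open>q K\<close> add up to the absolute
      increment over \<open>K\<close>. Every term \<open>|incr G J| - \<sigma> * incr G J\<close> is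
      nonnegative, and it is at least \<open>2 * e * len J\<close> when \<open>J\<close> opposes
      \<open>K\<close>.\<close>
    define \<sigma> :: real where "\<sigma> = (if incr G K \<ge> 0 then 1 else -1)"
    have "sum (incr G) (q K) = incr G K"
      using sum_incr_division[OF uv(1), of "q K" G] q(2)[OF K] uv by simp
    then have tot: "\<sigma> * sum (incr G) (q K) = \<bar>incr G K\<bar>" by (simp add: \<sigma>_def)
    have fq: "finite (q K)" using q(2)[OF K] by blast
    have "2 * e * sum len (DD K) = (\<Sum>J\<in>DD K. 2 * e * len J)" by (simp add: sum_distrib_left)
    also have "\<dots> \<le> (\<Sum>J\<in>DD K. \<bar>incr G J\<bar> - \<sigma> * incr G J)"
    proof (rule sum_mono)
      fix J assume "J \<in> DD K"
      then have "J \<in> D" "\<kappa> J = K" by (auto simp: DD_def)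
      then have "\<sigma> * incr G J \<le> - e * len J" using \<kappa>(4)[of J] by (auto simp: \<sigma>_def split: if_splits)
      moreover have "\<bar>incr G J\<bar> \<ge> - \<sigma> * incr G J" by (auto simp: \<sigma>_def)
      ultimately show "2 * e * len J \<le> \<bar>incr G J\<bar> - \<sigma> * incr G J" by simp
    qed
    also have "\<dots> \<le> (\<Sum>J\<in>q K. \<bar>incr G J\<bar> - \<sigma> * incr G J)"
      using q(1)[OF K] fq by (intro sum_mono2) (auto simp: \<sigma>_def)
    also have "\<dots> = (\<Sum>J\<in>q K. \<bar>incr G J\<bar>) - \<bar>incr G K\<bar>"
      by (simp add: sum_subtractf sum_distrib_left[symmetric] tot)
    finally show ?thesis by simp
  qed
  have qJ: "J \<subseteq> K" "J \<noteq> {}" "\<exists>a b. J = cbox a b" if "J \<in> q K" "K \<in> D0" for J K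
    using division_ofD[OF q(2)[OF that(2)]] that by blast+
  have inter: "interior J \<inter> interior J' = {}" if "J \<in> q K" "J' \<in> q K'" "K \<in> D0" "K' \<in> D0" "K \<noteq> K'" for J J' K K'
    using division_ofD(5)[OF D0 that(3,4,5)] interior_mono[OF qJ(1)[OF that(1,3)]] interior_mono[OF qJ(1)[OF that(2,4)]]
    by blast
  have injq: "inj_on q D0"
    by (rule inj_onI) (metis q(2) division_ofD(6))
  have "(\<Union>(q ` D0)) division_of \<Union>(\<Union>(q ` D0))"
  proof (rule division_of_Union)
    show "p division_of \<Union>p" if "p \<in> q ` D0" for p using that q(2) by (metis division_ofD(6) imageE)
    show "interior k1 \<inter> interior k2 = {}" if k: "k1 \<in> \<Union>(q ` D0)" "k2 \<in> \<Union>(q ` D0)" "k1 \<noteq> k2" for k1 k2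
    proof -
      obtain K1 K2 where "k1 \<in> q K1" "k2 \<in> q K2" "K1 \<in> D0" "K2 \<in> D0" using k by blast
      then show ?thesis using inter[of k1 K1 k2 K2] division_ofD(5)[OF q(2), of K1 k1 k2] k(3) by blast
    qed
  qed (use fin0 in simp)
  moreover have "\<Union>(\<Union>(q ` D0)) = {c..d}"
    unfolding division_ofD(6)[OF D0, symmetric] using division_ofD(6)[OF q(2)] by blast
  ultimately have "(\<Sum>J\<in>\<Union>(q ` D0). \<bar>incr G J\<bar>) \<le> V" using V by metis
  moreover have "(\<Sum>J\<in>\<Union>(q ` D0). \<bar>incr G J\<bar>) = (sum \<circ> sum) (\<lambda>J. \<bar>incr G J\<bar>) (q ` D0)"
  proof (rule sum.Union_comp)
    show "\<forall>A\<in>q ` D0. finite A" using q(2) by blast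
    fix A1 A2 x assume AA: "A1 \<in> q ` D0" "A2 \<in> q ` D0" "A1 \<noteq> A2" "x \<in> A1" "x \<in> A2"
    then obtain K1 K2 where K: "K1 \<in> D0" "K2 \<in> D0" "x \<in> q K1" "x \<in> q K2" "K1 \<noteq> K2" by blast
    then have "interior x = {}" using inter[of x K1 x K2] by blast
    moreover obtain a b where "x = cbox a b" "x \<noteq> {}" using qJ[OF K(3,1)] by blast
    ultimately show "\<bar>incr G x\<bar> = 0" by (auto simp: incr_def)
  qed
  moreover have "(sum \<circ> sum) (\<lambda>J. \<bar>incr G J\<bar>) (q ` D0) = (\<Sum>K\<in>D0. \<Sum>J\<in>q K. \<bar>incr G J\<bar>)"
    using injq by (simp add: sum.reindex)
  moreover have "(\<Sum>K\<in>D0. \<bar>incr G K\<bar> + 2 * e * sum len (DD K)) \<le> (\<Sum>K\<in>D0. \<Sum>J\<in>q K. \<bar>incr G J\<bar>)"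
    by (rule sum_mono) (rule step)
  moreover have "(\<Sum>K\<in>D0. sum len (DD K)) = sum len D"
    unfolding DD_def using \<kappa>(1) by (intro sum.group) (auto simp: D fin0)
  ultimately show ?thesis by (simp add: sum.distrib sum_distrib_left[symmetric])
qed

definition bounded_incr :: "real \<Rightarrow> real \<Rightarrow> (real \<Rightarrow> real) \<Rightarrow> bool" where
  "bounded_incr c d F \<longleftrightarrow> (\<exists>V. \<forall>p. p division_of {c..d} \<longrightarrow> (\<Sum>K\<in>p. \<bar>incr F K\<bar>) \<le> V)"

text \<open>Near each point of \<open>A\<close> there are rising and falling intervals of steepness
  \<open>e\<close> at every scale, so one kind opposes the increment over whichever piece of a
  nearly optimal division contains the point. Such intervals would push the variation beyond its
  supremum unless their total length is small.\<close>

lemma negligible_oscillating_slopes: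
  assumes BV: "bounded_incr c d G" and e: "e > 0" and A: "A \<subseteq> {c..d}"
    and neg: "\<And>x \<eta>. x \<in> A \<Longrightarrow> \<eta> > 0 \<Longrightarrow> \<exists>u v. c \<le> u \<and> u < v \<and> v \<le> d \<and> x \<in> {u..v} \<and> v - u < \<eta> \<and> G v - G u \<le> - e * (v - u)"
    and pos: "\<And>x \<eta>. x \<in> A \<Longrightarrow> \<eta> > 0 \<Longrightarrow> \<exists>u v. c \<le> u \<and> u < v \<and> v \<le> d \<and> x \<in> {u..v} \<and> v - u < \<eta> \<and> G v - G u \<ge> e * (v - u)"
  shows "negligible A"
  unfolding negligible_outer_le
proof (intro allI impI)
  fix \<epsilon> :: real assume "\<epsilon> > 0"
  define VV where "VV = {(\<Sum>K\<in>p. \<bar>incr G K\<bar>) |p. p division_of {c..d}}"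
  have bdd: "bdd_above VV" using BV unfolding bounded_incr_def VV_def bdd_above_def by blast
  have ne: "VV \<noteq> {}" using elementary_interval[of c d] by (auto simp: VV_def)
  define V where "V = Sup VV"
  have V: "\<And>p. p division_of {c..d} \<Longrightarrow> (\<Sum>K\<in>p. \<bar>incr G K\<bar>) \<le> V"
    unfolding V_def using bdd by (intro cSup_upper) (auto simp: VV_def)
  \<comment> \<open>A division that misses the supremum by less than
    \<open>2 * e * \<epsilon>\<close> leaves room for opposing intervals of total length at most
    \<open>\<epsilon>\<close>.\<close>
  have "V - 2 * e * \<epsilon> < Sup VV" using e \<open>\<epsilon> > 0\<close> by (simp add: V_def)
  then obtain D0 where D0: "D0 division_of {c..d}" and big: "V - 2 * e * \<epsilon> < (\<Sum>K\<in>D0. \<bar>incr G K\<bar>)"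
    using less_cSup_iff[OF ne bdd] by (auto simp: VV_def)
  \<comment> \<open>The finitely many endpoints are set aside, so that each remaining point is
    interior to its piece and small intervals around it stay in that piece.\<close>
  define E where "E = Inf ` D0 \<union> Sup ` D0"
  have finE: "finite E" using D0 by (auto simp: E_def)
  define JJ where "JJ = {J. \<exists>K\<in>D0. J \<subseteq> K \<and> (\<exists>u v. u < v \<and> J = {u..v}) \<and>
              (if incr G K \<ge> 0 then incr G J \<le> - e * len J else incr G J \<ge> e * len J)}"
  obtain T where T: "T \<in> lmeasurable" "A - E \<subseteq> T" "measure lebesgue T \<le> \<epsilon>"
  proof (rule Vitali_interval_outer_bound[of JJ "A - E" \<epsilon>])
    show "\<exists>u v. u < v \<and> K = {u..v}" if "K \<in> JJ" for K using that by (auto simp: JJ_def)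
    show "sum len D \<le> \<epsilon>" if "finite D" "D \<subseteq> JJ" "pairwise disjnt D" for D
    proof -
      have "(\<Sum>K\<in>D0. \<bar>incr G K\<bar>) + 2 * e * sum len D \<le> V"
        using that(2) unfolding JJ_def by (intro sum_abs_incr_refine_ge[OF D0 e V that(1,3)]) blast+
      then have "2 * e * sum len D \<le> 2 * e * \<epsilon>" using big by linarith
      then show ?thesis using e by simp
    qed
    fix x \<eta> :: real assume x: "x \<in> A - E" and "\<eta> > 0"
    then have "x \<in> \<Union>D0" using A division_ofD(6)[OF D0] by blast
    then obtain K where K: "K \<in> D0" "x \<in> K" by blast
    obtain a b where ab: "K = {a..b}" using division_ofD(4)[OF D0 K(1)] by auto
    have "a \<in> E" "b \<in> E" using K ab by (auto simp: E_def intro!: image_eqI[of _ _ K])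
    then have x': "a < x" "x < b" using K ab x by (auto simp: less_le)
    define \<eta>' where "\<eta>' = min \<eta> (min (x - a) (b - x))"
    have "\<eta>' > 0" using x' \<open>\<eta> > 0\<close> by (simp add: \<eta>'_def)
    have "\<exists>u v. u < v \<and> x \<in> {u..v} \<and> v - u < \<eta>' \<and>
       (if incr G K \<ge> 0 then G v - G u \<le> - e * (v - u) else G v - G u \<ge> e * (v - u))"
      using neg[OF _ \<open>\<eta>' > 0\<close>, of x] pos[OF _ \<open>\<eta>' > 0\<close>, of x] x by (cases "incr G K \<ge> 0") auto
    then obtain u v where uv: "u < v" "x \<in> {u..v}" "v - u < \<eta>'" 
       "if incr G K \<ge> 0 then G v - G u \<le> - e * (v - u) else G v - G u \<ge> e * (v - u)" by blast
    have "{u..v} \<subseteq> K" using uv x' ab by (auto simp: \<eta>'_def)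
    then have "{u..v} \<in> JJ" unfolding JJ_def mem_Collect_eq
      using uv K(1) by (intro bexI[of _ K] conjI exI[of _ u] exI[of _ v]) (auto split: if_splits)
    moreover have "len {u..v} < \<eta>" using uv by (simp add: \<eta>'_def)
    ultimately show "\<exists>K\<in>JJ. x \<in> K \<and> len K < \<eta>" using uv by blast
  qed blast
  have N: "negligible E" using finE by (rule negligible_finite)
  show "\<exists>T. A \<subseteq> T \<and> T \<in> lmeasurable \<and> measure lebesgue T \<le> \<epsilon>"
    using lmeasurable_Un_negligible[OF T(1) N] T(2,3) by (intro exI[of _ "T \<union> E"]) auto
qed

text \<open>Disjoint intervals of steepness at least \<open>n\<close> extend to a division of
  \<open>{c..d}\<close>, so their total length is at most \<open>V / n\<close>, where
  \<open>V\<close> bounds the variation.\<close>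

lemma negligible_infinite_slopes:
  assumes BV: "bounded_incr c d F" and A: "A \<subseteq> {c..d}"
    and inf: "\<And>x \<eta> n. x \<in> A \<Longrightarrow> \<eta> > 0 \<Longrightarrow> \<exists>u v. c \<le> u \<and> u < v \<and> v \<le> d \<and> x \<in> {u..v} \<and> v - u < \<eta> \<and> \<bar>F v - F u\<bar> \<ge> real n * (v - u)"
  shows "negligible A"
  unfolding negligible_outer_le
proof (intro allI impI)
  fix \<epsilon> :: real assume "\<epsilon> > 0"
  obtain V where V: "\<And>p. p division_of {c..d} \<Longrightarrow> (\<Sum>K\<in>p. \<bar>incr F K\<bar>) \<le> V"
    using BV unfolding bounded_incr_def by blast
  obtain n :: nat where n: "n > 0" "V / \<epsilon> \<le> real n"
  proof -
    obtain k :: nat where "V / \<epsilon> \<le> real k" using real_arch_simple by blast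
    then show ?thesis by (intro that[of "Suc k"]) auto
  qed
  define JJ where "JJ = {J. \<exists>u v. c \<le> u \<and> u < v \<and> v \<le> d \<and> J = {u..v} \<and> \<bar>F v - F u\<bar> \<ge> real n * (v - u)}"
  obtain T where T: "T \<in> lmeasurable" "A \<subseteq> T" "measure lebesgue T \<le> \<epsilon>"
  proof (rule Vitali_interval_outer_bound[of JJ A \<epsilon>])
    show "\<exists>u v. u < v \<and> K = {u..v}" if "K \<in> JJ" for K using that by (auto simp: JJ_def)
    show "\<exists>K\<in>JJ. x \<in> K \<and> len K < \<eta>" if x: "x \<in> A" and \<eta>: "\<eta> > 0" for x \<eta>
    proof -
      obtain u v where "c \<le> u \<and> u < v \<and> v \<le> d \<and> x \<in> {u..v} \<and> v - u < \<eta> \<and> \<bar>F v - F u\<bar> \<ge> real n * (v - u)"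
        using inf[OF x \<eta>] by blast
      then show ?thesis by (intro bexI[of _ "{u..v}"]) (auto simp: JJ_def)
    qed
    show "sum len D \<le> \<epsilon>" if D: "finite D" "D \<subseteq> JJ" "pairwise disjnt D" for D
    proof -
      have "D division_of \<Union>D"
        using D by (intro division_of_disjoint_intervals) (auto simp: JJ_def)
      moreover have "\<Union>D \<subseteq> cbox c d" using D(2) by (force simp: JJ_def)
      ultimately obtain q where q: "D \<subseteq> q" "q division_of cbox c d"
        by (rule partial_division_extend_interval)
      have "real n * sum len D = (\<Sum>J\<in>D. real n * len J)" by (simp add: sum_distrib_left)
      also have "\<dots> \<le> (\<Sum>J\<in>D. \<bar>incr F J\<bar>)"
        using D(2) by (intro sum_mono) (force simp: JJ_def)
      also have "\<dots> \<le> (\<Sum>J\<in>q. \<bar>incr F J\<bar>)" using q by (intro sum_mono2) auto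
      also have "\<dots> \<le> V" using V q(2) by simp
      also have "V \<le> real n * \<epsilon>" using n \<open>\<epsilon> > 0\<close> by (simp add: pos_divide_le_eq)
      finally show ?thesis using n by simp
    qed
  qed blast
  then show "\<exists>T. A \<subseteq> T \<and> T \<in> lmeasurable \<and> measure lebesgue T \<le> \<epsilon>" by blast
qed

lemma bounded_incr_minus_linear:
  assumes "bounded_incr c d F"
  shows "bounded_incr c d (\<lambda>x. F x - \<rho> * x)"
proof -
  obtain V where V: "\<And>p. p division_of {c..d} \<Longrightarrow> (\<Sum>K\<in>p. \<bar>incr F K\<bar>) \<le> V"
    using assms unfolding bounded_incr_def by blast
  have "(\<Sum>K\<in>p. \<bar>incr (\<lambda>x. F x - \<rho> * x) K\<bar>) \<le> V + \<bar>\<rho>\<bar> * len {c..d}" if p: "p division_of {c..d}" for p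
  proof -
    have "(\<Sum>K\<in>p. \<bar>incr (\<lambda>x. F x - \<rho> * x) K\<bar>) \<le> (\<Sum>K\<in>p. \<bar>incr F K\<bar> + \<bar>\<rho>\<bar> * len K)"
    proof (rule sum_mono)
      fix K assume K: "K \<in> p"
      obtain u v where uv: "K = {u..v}" "u \<le> v"
        using division_ofD(3,4)[OF p K] by (metis atLeastatMost_empty_iff2 box_real(2) linorder_le_cases)
      have "\<bar>incr (\<lambda>x. F x - \<rho> * x) K\<bar> = \<bar>(F v - F u) - \<rho> * (v - u)\<bar>"
        using uv by (simp add: algebra_simps)
      also have "\<dots> \<le> \<bar>F v - F u\<bar> + \<bar>\<rho> * (v - u)\<bar>" by linarith
      finally show "\<bar>incr (\<lambda>x. F x - \<rho> * x) K\<bar> \<le> \<bar>incr F K\<bar> + \<bar>\<rho>\<bar> * len K"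
        using uv by (simp add: abs_mult)
    qed
    also have "\<dots> = (\<Sum>K\<in>p. \<bar>incr F K\<bar>) + \<bar>\<rho>\<bar> * sum len p"
      by (simp add: sum.distrib sum_distrib_left)
    also have "sum len p \<le> len {c..d}"
      using subadditive_content_division[of p "{c..d}" c d] p by simp
    finally show ?thesis using V[OF p] by (simp add: mult_left_mono)
  qed
  then show ?thesis unfolding bounded_incr_def by blast
qed

text \<open>A difference quotient at \<open>x\<close> is the slope of the interval between
  \<open>x\<close> and the other point, on whichever side that point lies.\<close>

lemma slope_pair_segment:
  fixes F :: "real \<Rightarrow> real"
  assumes fr: "frequently (\<lambda>y. P ((F y - F x) / (y - x))) (at x)" and x: "c < x" "x < d" and "\<eta> > 0"
  shows "\<exists>u v. c \<le> u \<and> u < v \<and> v \<le> d \<and> x \<in> {u..v} \<and> v - u < \<eta> \<and> P ((F v - F u) / (v - u))"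
proof -
  have "eventually (\<lambda>y. y \<in> {c<..<d} \<and> dist y x < \<eta> \<and> y \<noteq> x) (at x)"
    using x \<open>\<eta> > 0\<close> by (intro eventually_conj eventually_at_in_open')
      (auto simp: eventually_at intro!: exI[of _ \<eta>] eventually_at_in_open')
  from frequently_eventually_conj[OF fr this] obtain y where y: "P ((F y - F x) / (y - x))" "y \<in> {c<..<d}" "dist y x < \<eta>" "y \<noteq> x"
    by (auto dest: frequently_ex)
  have "(F y - F x) / (y - x) = (F x - F y) / (x - y)"
    using y(4) by (metis minus_diff_eq minus_divide_divide)
  then show ?thesis using y x
    by (intro exI[of _ "min x y"] exI[of _ "max x y"]) (auto simp: min_def max_def dist_real_def)
qed

text \<open>The limit is the supremum of the rational eventual lower bounds. A rational
  \<open>r\<close> above it is no such bound, so every rational \<open>s > r\<close> is an eventual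
  upper bound.\<close>

lemma tendsto_if_not_frequently_crossing:
  fixes \<phi> :: "'a \<Rightarrow> real"
  assumes F: "F \<noteq> bot"
    and cross: "\<And>r s. r \<in> \<rat> \<Longrightarrow> s \<in> \<rat> \<Longrightarrow> r < s \<Longrightarrow> eventually (\<lambda>y. \<phi> y > r) F \<or> eventually (\<lambda>y. \<phi> y < s) F"
    and bd: "eventually (\<lambda>y. \<bar>\<phi> y\<bar> < real N) F"
  shows "\<exists>L. (\<phi> \<longlongrightarrow> L) F"
proof -
  define R where "R = {r. r \<in> \<rat> \<and> eventually (\<lambda>y. \<phi> y > r) F}"
  have "eventually (\<lambda>y. \<phi> y > - real N) F" using bd by eventually_elim linarith
  then have ne: "R \<noteq> {}" by (auto simp: R_def intro!: exI[of _ "- real N"])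
  have up: "r \<le> real N" if "r \<in> R" for r
  proof -
    have "eventually (\<lambda>y. r < real N) F"
      using bd that unfolding R_def mem_Collect_eq by (auto elim: eventually_elim2)
    then show ?thesis using F by (simp add: eventually_const)
  qed
  then have bdd: "bdd_above R" by (rule bdd_aboveI)
  have "(\<phi> \<longlongrightarrow> Sup R) F"
  proof (rule order_tendstoI)
    fix a assume "a < Sup R"
    then obtain r where "r \<in> R" "a < r" using less_cSup_iff[OF ne bdd] by blast
    then show "eventually (\<lambda>y. a < \<phi> y) F" by (auto simp: R_def elim: eventually_mono)
  next
    fix a assume a: "Sup R < a"
    obtain r where r: "r \<in> \<rat>" "Sup R < r" "r < a" using Rats_dense_in_real[OF a] by blast
    obtain s where s: "s \<in> \<rat>" "r < s" "s < a" using Rats_dense_in_real[OF r(3)] by blast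
    have "r \<notin> R" using cSup_upper[OF _ bdd] r(2) by force
    then have "eventually (\<lambda>y. \<phi> y < s) F" using cross[OF r(1) s(1,2)] r(1) by (auto simp: R_def)
    then show "eventually (\<lambda>y. \<phi> y < a) F" using s(3) by (auto elim: eventually_mono)
  qed
  then show ?thesis ..
qed

text \<open>Where no finite derivative exists, the difference quotients either oscillate across two
  rationals (\<open>A r s\<close>) or are unbounded (\<open>Z\<close>). These are countably many
  sets, each of them null.\<close>

lemma bounded_incr_differentiable_ae:
  assumes BV: "bounded_incr c d F"
  shows "negligible {x \<in> {c<..<d}. \<not> F differentiable (at x)}"
proof -
  define \<phi> where "\<phi> x y = (F y - F x) / (y - x)" for x y
  define A where "A r s = {x\<in>{c<..<d}. frequently (\<lambda>y. \<phi> x y \<le> r) (at x) \<and> frequently (\<lambda>y. \<phi> x y \<ge> s) (at x)}" for r s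
  define Z where "Z = {x\<in>{c<..<d}. \<forall>n. frequently (\<lambda>y. \<bar>\<phi> x y\<bar> \<ge> real n) (at x)}"
  have "negligible (A r s)" if rs: "r < s" for r s
  proof -
    \<comment> \<open>Subtracting the middle slope turns oscillation between \<open>r\<close> and
      \<open>s\<close> into slopes beyond \<open>-e\<close> and \<open>e\<close> with
      \<open>e = (s - r) / 2\<close>.\<close>
    define \<rho> where "\<rho> = (r + s) / 2"
    define G where "G x = F x - \<rho> * x" for x
    have *: "(F v - F u) / (v - u) = \<rho> + (G v - G u) / (v - u)" if "u < v" for u v
      using that by (simp add: G_def divide_simps) (simp add: algebra_simps)
    show ?thesis
    proof (rule negligible_oscillating_slopes[where G = G and e = "(s - r) / 2"])
      show "bounded_incr c d G" unfolding G_def by (rule bounded_incr_minus_linear[OF BV])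
      show "0 < (s - r) / 2" using rs by simp
      show "A r s \<subseteq> {c..d}" by (auto simp: A_def)
      fix x \<eta> :: real assume x: "x \<in> A r s" and "\<eta> > 0"
      then obtain u v where uv: "c \<le> u" "u < v" "v \<le> d" "x \<in> {u..v}" "v - u < \<eta>" "(F v - F u) / (v - u) \<le> r"
        using slope_pair_segment[of "\<lambda>z. z \<le> r" F x c d \<eta>] by (auto simp: A_def \<phi>_def)
      have "(G v - G u) / (v - u) \<le> - ((s - r) / 2)" using uv(6) *[OF uv(2)] by (simp add: \<rho>_def field_simps)
      then have "G v - G u \<le> - ((s - r) / 2) * (v - u)" using uv(2) by (simp add: pos_divide_le_eq)
      then show "\<exists>u v. c \<le> u \<and> u < v \<and> v \<le> d \<and> x \<in> {u..v} \<and> v - u < \<eta> \<and> G v - G u \<le> - ((s - r) / 2) * (v - u)"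
        using uv by blast
      obtain u v where uv: "c \<le> u" "u < v" "v \<le> d" "x \<in> {u..v}" "v - u < \<eta>" "(F v - F u) / (v - u) \<ge> s"
        using slope_pair_segment[of "\<lambda>z. z \<ge> s" F x c d \<eta>] x \<open>\<eta> > 0\<close> by (auto simp: A_def \<phi>_def)
      have "(G v - G u) / (v - u) \<ge> ((s - r) / 2)" using uv(6) *[OF uv(2)] by (simp add: \<rho>_def field_simps)
      then have "G v - G u \<ge> ((s - r) / 2) * (v - u)" using uv(2) by (simp add: pos_le_divide_eq)
      then show "\<exists>u v. c \<le> u \<and> u < v \<and> v \<le> d \<and> x \<in> {u..v} \<and> v - u < \<eta> \<and> G v - G u \<ge> ((s - r) / 2) * (v - u)"
        using uv by blast
    qed
  qed
  then have negA: "negligible (\<Union>(r, s)\<in>{(r, s). r \<in> \<rat> \<and> s \<in> \<rat> \<and> r < s}. A r s)"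
    by (intro negligible_countable_Union)
      (auto intro!: countable_image countable_subset[OF _ countable_SIGMA[OF countable_rat countable_rat]])
  have negZ: "negligible Z"
  proof (rule negligible_infinite_slopes[OF BV])
    show "Z \<subseteq> {c..d}" by (auto simp: Z_def)
    fix x \<eta> :: real and n :: nat assume x: "x \<in> Z" and \<eta>: "\<eta> > 0"
    obtain u v where uv: "c \<le> u" "u < v" "v \<le> d" "x \<in> {u..v}" "v - u < \<eta>" "\<bar>(F v - F u) / (v - u)\<bar> \<ge> real n"
      using slope_pair_segment[of "\<lambda>z. \<bar>z\<bar> \<ge> real n" F x c d \<eta>] x \<eta> by (auto simp: Z_def \<phi>_def)
    then have "\<bar>F v - F u\<bar> \<ge> real n * (v - u)" by (simp add: abs_divide pos_le_divide_eq)
    then show "\<exists>u v. c \<le> u \<and> u < v \<and> v \<le> d \<and> x \<in> {u..v} \<and> v - u < \<eta> \<and> \<bar>F v - F u\<bar> \<ge> real n * (v - u)"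
      using uv by blast
  qed
  have "{x \<in> {c<..<d}. \<not> F differentiable (at x)} \<subseteq> (\<Union>(r, s)\<in>{(r, s). r \<in> \<rat> \<and> s \<in> \<rat> \<and> r < s}. A r s) \<union> Z"
  proof (clarify, rule ccontr)
    fix x assume x: "x \<in> {c<..<d}" and nd: "\<not> F differentiable (at x)" and nZ: "x \<notin> Z"
      and nA: "x \<notin> (\<Union>(r, s)\<in>{(r, s). r \<in> \<rat> \<and> s \<in> \<rat> \<and> r < s}. A r s)"
    obtain N where "eventually (\<lambda>y. \<bar>\<phi> x y\<bar> < real N) (at x)"
      using nZ x by (auto simp: Z_def not_frequently not_le)
    moreover have "eventually (\<lambda>y. \<phi> x y > r) (at x) \<or> eventually (\<lambda>y. \<phi> x y < s) (at x)"
      if "r \<in> \<rat>" "s \<in> \<rat>" "r < s" for r s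
    proof -
      have "x \<notin> A r s" using nA that by auto
      then show ?thesis using x by (auto simp: A_def not_frequently not_le)
    qed
    ultimately obtain L where "(\<phi> x \<longlongrightarrow> L) (at x)"
      using tendsto_if_not_frequently_crossing[of "at x" "\<phi> x" N] by auto
    then have "(F has_real_derivative L) (at x)"
      unfolding \<phi>_def has_field_derivative_iff .
    then show False using nd real_differentiable_def by blast
  qed
  then show ?thesis by (rule negligible_subset[OF negligible_Un[OF negA negZ]])
qed

text \<open>On an interval shorter than the \<open>\<delta>\<close> that belongs to the tolerance 1
  the variation is at most 1. Countably many such intervals, with rational endpoints, cover the open
  interval.\<close>

theorem abs_cont_on_differentiable_ae:
  assumes F: "abs_cont_on a b F"
  shows "negligible {x \<in> {a<..<b}. \<not> F differentiable (at x)}"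
proof -
  obtain \<delta> where \<delta>: "\<delta> > 0" and
    sm: "\<And>p. \<lbrakk>p division_of \<Union>p; \<Union>p \<subseteq> {a..b}; sum len p < \<delta>\<rbrakk> \<Longrightarrow> (\<Sum>K\<in>p. \<bar>incr F K\<bar>) < 1"
    by (rule abs_cont_on_division[OF F zero_less_one]) (rule that; simp)
  have bv: "bounded_incr c d F" if "a \<le> c" "c \<le> d" "d \<le> b" "d - c < \<delta>" for c d
    unfolding bounded_incr_def
  proof (intro exI[of _ 1] allI impI)
    fix p assume p: "p division_of {c..d}"
    then have u: "\<Union>p = {c..d}" by (rule division_ofD(6))
    have "sum len p \<le> len {c..d}" using subadditive_content_division[of p "{c..d}" c d] p by simp
    then have "sum len p < \<delta>" using that by simp
    moreover have "p division_of \<Union>p" "\<Union>p \<subseteq> {a..b}" using p u that by auto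
    ultimately show "(\<Sum>K\<in>p. \<bar>incr F K\<bar>) \<le> 1" using sm by (simp add: less_imp_le)
  qed
  define P where "P = {(r, s). r \<in> \<rat> \<and> s \<in> \<rat> \<and> a \<le> r \<and> r \<le> s \<and> s \<le> b \<and> s - r < \<delta>}"
  have "negligible (\<Union>(r, s)\<in>P. {x \<in> {r<..<s}. \<not> F differentiable (at x)})"
  proof (rule negligible_countable_Union)
    have "countable P"
      by (rule countable_subset[OF _ countable_SIGMA[OF countable_rat countable_rat]]) (auto simp: P_def)
    then show "countable ((\<lambda>(r, s). {x \<in> {r<..<s}. \<not> F differentiable (at x)}) ` P)" by simp
    fix X assume "X \<in> (\<lambda>(r, s). {x \<in> {r<..<s}. \<not> F differentiable (at x)}) ` P"
    then obtain r s where rs: "a \<le> r" "r \<le> s" "s \<le> b" "s - r < \<delta>"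
      and X: "X = {x \<in> {r<..<s}. \<not> F differentiable (at x)}" by (auto simp: P_def)
    show "negligible X" unfolding X by (rule bounded_incr_differentiable_ae[OF bv[OF rs]])
  qed
  moreover have "{x \<in> {a<..<b}. \<not> F differentiable (at x)} \<subseteq> (\<Union>(r, s)\<in>P. {x \<in> {r<..<s}. \<not> F differentiable (at x)})"
  proof clarify
    fix x assume x: "x \<in> {a<..<b}" "\<not> F differentiable (at x)"
    obtain r where r: "r \<in> \<rat>" "max a (x - \<delta> / 2) < r" "r < x" using Rats_dense_in_real[of "max a (x - \<delta> / 2)" x] x \<delta> by auto
    obtain s where s: "s \<in> \<rat>" "x < s" "s < min b (x + \<delta> / 2)" using Rats_dense_in_real[of x "min b (x + \<delta> / 2)"] x \<delta> by auto
    show "x \<in> (\<Union>(r, s)\<in>P. {x \<in> {r<..<s}. \<not> F differentiable (at x)})"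
      using r s x by (intro UN_I[of "(r, s)"]) (auto simp: P_def)
  qed
  ultimately show ?thesis by (rule negligible_subset)
qed

section \<open>Absolute continuity and the fundamental theorem of calculus\<close>

lemma abs_cont_on_if_incr_le:
  assumes g: "abs_cont_on a b g" and AB: "A \<ge> 0" "B \<ge> 0"
    and le: "\<And>x y. a \<le> x \<Longrightarrow> x \<le> y \<Longrightarrow> y \<le> b \<Longrightarrow> \<bar>F y - F x\<bar> \<le> A * \<bar>g y - g x\<bar> + B * (y - x)"
  shows "abs_cont_on a b F"
proof (rule abs_cont_onI)
  fix \<epsilon> :: real assume "\<epsilon> > 0"
  then have "\<epsilon> / (2 * (A + 1)) > 0" using AB by simp
  then obtain \<delta> where \<delta>: "\<delta> > 0" and
    D: "\<And>(n::nat) (l::nat \<Rightarrow> real) (r::nat \<Rightarrow> real).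
       \<lbrakk>\<And>i. i < n \<Longrightarrow> a \<le> l i \<and> l i \<le> r i \<and> r i \<le> b;
        \<And>i j. i < n \<Longrightarrow> j < n \<Longrightarrow> i \<noteq> j \<Longrightarrow> r i \<le> l j \<or> r j \<le> l i;
        (\<Sum>i<n. r i - l i) < \<delta>\<rbrakk> \<Longrightarrow> (\<Sum>i<n. \<bar>g (r i) - g (l i)\<bar>) < \<epsilon> / (2 * (A + 1))"
    by (rule abs_cont_onE[OF g]) (rule that; blast)
  define \<delta>' where "\<delta>' = min \<delta> (\<epsilon> / (2 * (B + 1)))"
  have "\<delta>' > 0" using \<delta> \<open>\<epsilon> > 0\<close> AB by (simp add: \<delta>'_def)
  show "\<exists>\<delta>>0. \<forall>(n::nat) (l::nat \<Rightarrow> real) (r::nat \<Rightarrow> real).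
        (\<forall>i<n. a \<le> l i \<and> l i \<le> r i \<and> r i \<le> b) \<longrightarrow>
        (\<forall>i<n. \<forall>j<n. i \<noteq> j \<longrightarrow> r i \<le> l j \<or> r j \<le> l i) \<longrightarrow>
        (\<Sum>i<n. r i - l i) < \<delta> \<longrightarrow> (\<Sum>i<n. \<bar>F (r i) - F (l i)\<bar>) < \<epsilon>"
  proof (intro exI[of _ \<delta>'] conjI allI impI \<open>\<delta>' > 0\<close>)
    fix n :: nat and l r :: "nat \<Rightarrow> real"
    assume 1: "\<forall>i<n. a \<le> l i \<and> l i \<le> r i \<and> r i \<le> b"
      and 2: "\<forall>i<n. \<forall>j<n. i \<noteq> j \<longrightarrow> r i \<le> l j \<or> r j \<le> l i" and 3: "(\<Sum>i<n. r i - l i) < \<delta>'"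
    have G: "(\<Sum>i<n. \<bar>g (r i) - g (l i)\<bar>) < \<epsilon> / (2 * (A + 1))"
      using 1 2 3 by (intro D) (auto simp: \<delta>'_def)
    have "(\<Sum>i<n. \<bar>F (r i) - F (l i)\<bar>) \<le> (\<Sum>i<n. A * \<bar>g (r i) - g (l i)\<bar> + B * (r i - l i))"
      using 1 by (intro sum_mono le) auto
    also have "\<dots> = A * (\<Sum>i<n. \<bar>g (r i) - g (l i)\<bar>) + B * (\<Sum>i<n. r i - l i)"
      by (simp add: sum.distrib sum_distrib_left)
    also have "A * (\<Sum>i<n. \<bar>g (r i) - g (l i)\<bar>) \<le> A * (\<epsilon> / (2 * (A + 1)))"
      using G AB by (intro mult_left_mono) auto
    also have "A * (\<epsilon> / (2 * (A + 1))) < \<epsilon> / 2"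
      using \<open>\<epsilon> > 0\<close> AB by (simp add: divide_simps; simp add: algebra_simps)
    also have "B * (\<Sum>i<n. r i - l i) \<le> B * (\<epsilon> / (2 * (B + 1)))"
      using 3 AB by (intro mult_left_mono) (auto simp: \<delta>'_def)
    also have "B * (\<epsilon> / (2 * (B + 1))) < \<epsilon> / 2"
      using \<open>\<epsilon> > 0\<close> AB by (simp add: divide_simps; simp add: algebra_simps)
    finally show "(\<Sum>i<n. \<bar>F (r i) - F (l i)\<bar>) < \<epsilon>" by simp
  qed
qed

text \<open>The gauge integral yields integrability and value at once. Tags off \<open>N\<close> are
  controlled by differentiability. Tags in \<open>N\<close> get a small open neighbourhood
  \<open>U\<close> of \<open>N\<close> as gauge: their pieces have total length below
  \<open>\<delta>\<close>, so absolute continuity bounds the sum of the increments.\<close>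

theorem abs_cont_on_FTC:
  assumes F: "abs_cont_on a b F" and "a \<le> b" and N: "negligible N"
    and der: "\<And>x. x \<in> {a..b} - N \<Longrightarrow> (F has_vector_derivative f x) (at x within {a..b})"
  shows "((\<lambda>x. if x \<in> N then 0 else f x) has_integral F b - F a) {a..b}"
  unfolding has_integral_real
proof (intro allI impI)
  fix e :: real assume "e > 0"
  define f0 where "f0 x = (if x \<in> N then 0 else f x)" for x
  \<comment> \<open>The \<open>+ 1\<close> guards against \<open>a = b\<close>.\<close>
  define \<epsilon> where "\<epsilon> = e / (2 * (b - a + 1))"
  have "\<epsilon> > 0" using \<open>e > 0\<close> \<open>a \<le> b\<close> by (simp add: \<epsilon>_def)
  have "e / 2 > 0" using \<open>e > 0\<close> by simp
  obtain \<delta> where \<delta>: "\<delta> > 0" and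
    sm: "\<And>p. \<lbrakk>p division_of \<Union>p; \<Union>p \<subseteq> {a..b}; sum len p < \<delta>\<rbrakk> \<Longrightarrow> (\<Sum>K\<in>p. \<bar>incr F K\<bar>) < e / 2"
    by (rule abs_cont_on_division[OF F \<open>e / 2 > 0\<close>]) (rule that; simp)
  obtain U where U: "open U" "N \<subseteq> U" "U - N \<in> lmeasurable" "emeasure lebesgue (U - N) < ennreal \<delta>"
    by (rule sets_lebesgue_outer_open[OF fmeasurableD[OF negligible_imp_measurable[OF N]] \<delta>])
  have "U = (U - N) \<union> N" using U by blast
  then have Um: "U \<in> lmeasurable" "measure lebesgue U < \<delta>"
    using U(3,4) N negligible_imp_measurable[OF N] fmeasurable.Un[OF U(3) negligible_imp_measurable[OF N]]
      measure_Un_null_set[of "U - N" lebesgue N] emeasure_eq_measure2[OF U(3)] \<delta>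
    by (simp_all add: negligible_iff_null_sets fmeasurableD ennreal_less_iff)
  have "\<forall>x. \<exists>d>0. x \<in> {a..b} - N \<longrightarrow>
         (\<forall>y\<in>{a..b}. norm (y-x) < d \<longrightarrow> norm (F y - F x - (y-x) *\<^sub>R f x) \<le> \<epsilon> * norm (y-x))"
    using der[unfolded has_vector_derivative_def has_derivative_within_alt] \<open>\<epsilon> > 0\<close> zero_less_one by blast
  then obtain d where d: "\<And>x. 0 < d x"
       "\<And>x y. \<lbrakk>x \<in> {a..b} - N; y \<in> {a..b}; norm (y-x) < d x\<rbrakk>
            \<Longrightarrow> norm (F y - F x - (y-x) *\<^sub>R f x) \<le> \<epsilon> * norm (y-x)"
    by metis
  define \<gamma> where "\<gamma> x = (if x \<in> N then U else ball x (d x))" for x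
  show "\<exists>\<gamma>. gauge \<gamma> \<and> (\<forall>\<D>. \<D> tagged_division_of {a..b} \<and> \<gamma> fine \<D> \<longrightarrow>
        norm (sum (\<lambda>(x,k). len k *\<^sub>R (if x \<in> N then 0 else f x)) \<D> - (F b - F a)) < e)"
    unfolding f0_def[symmetric]
  proof (intro exI[of _ \<gamma>] conjI allI impI, goal_cases)
    case 1 show ?case using U d(1) by (auto simp: gauge_def \<gamma>_def)
  next
    case (2 p)
    then have p: "p tagged_division_of {a..b}" and fine: "\<gamma> fine p" by auto
    have fin: "finite p" using p by blast
    have seg: "\<exists>u v. K = {u..v} \<and> u \<le> v \<and> x \<in> {u..v} \<and> a \<le> u \<and> v \<le> b" if xK: "(x, K) \<in> p" for x K
    proof -
      obtain u v where uv: "K = cbox u v" using tagged_division_ofD(4)[OF p xK] by blast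
      moreover have "x \<in> K" "K \<subseteq> {a..b}" using tagged_division_ofD(2,3)[OF p xK] by auto
      ultimately show ?thesis by auto
    qed
    define p1 where "p1 = {z\<in>p. fst z \<notin> N}"
    define p2 where "p2 = {z\<in>p. fst z \<in> N}"
    have fin12: "finite p1" "finite p2" "p = p1 \<union> p2" "p1 \<inter> p2 = {}" using fin by (auto simp: p1_def p2_def)
    have E1: "\<bar>\<Sum>(x,K)\<in>p1. len K * f0 x - incr F K\<bar> \<le> \<epsilon> * (b - a)"
    proof -
      have "\<bar>\<Sum>(x,K)\<in>p1. len K * f0 x - incr F K\<bar> \<le> (\<Sum>(x,K)\<in>p1. \<epsilon> * len K)"
        unfolding real_norm_def[symmetric]
      proof (rule sum_norm_le, clarify)
        fix x K assume xK: "(x, K) \<in> p1"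
        then have "(x, K) \<in> p" "x \<notin> N" by (auto simp: p1_def)
        then obtain u v where uv: "K = {u..v}" "u \<le> v" "x \<in> {u..v}" "a \<le> u" "v \<le> b" using seg by blast
        have "K \<subseteq> ball x (d x)" using fineD[OF fine \<open>(x, K) \<in> p\<close>] \<open>x \<notin> N\<close> by (simp add: \<gamma>_def)
        moreover have "u \<in> K" "v \<in> K" using uv by auto
        ultimately have "u \<in> ball x (d x)" "v \<in> ball x (d x)" by blast+
        then have "norm (u - x) < d x" "norm (v - x) < d x" by (auto simp: dist_real_def)
        then have "norm (F u - F x - (u-x) *\<^sub>R f x) \<le> \<epsilon> * norm (u-x)" "norm (F v - F x - (v-x) *\<^sub>R f x) \<le> \<epsilon> * norm (v-x)"
          using uv \<open>x \<notin> N\<close> d(2)[of x u] d(2)[of x v] by simp_all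
        then have "\<bar>F u - F x - (u - x) * f x\<bar> \<le> \<epsilon> * (x - u)" "\<bar>F v - F x - (v - x) * f x\<bar> \<le> \<epsilon> * (v - x)"
          using uv by auto
        moreover have "len K * f0 x - incr F K = (F u - F x - (u - x) * f x) - (F v - F x - (v - x) * f x)"
          using uv \<open>x \<notin> N\<close> by (simp add: f0_def algebra_simps)
        moreover have "\<epsilon> * (x - u) + \<epsilon> * (v - x) = \<epsilon> * len K" using uv by (simp add: algebra_simps)
        ultimately show "norm (len K * f0 x - incr F K) \<le> \<epsilon> * len K" by simp
      qed
      also have "\<dots> \<le> (\<Sum>(x,K)\<in>p. \<epsilon> * len K)"
        using fin fin12 \<open>\<epsilon> > 0\<close> by (intro sum_mono2) auto
      also have "\<dots> = \<epsilon> * (\<Sum>(x,K)\<in>p. len K)" by (simp add: sum_distrib_left case_prod_unfold)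
      also have "(\<Sum>(x,K)\<in>p. len K) = b - a"
        using additive_content_tagged_division[of p a b] p \<open>a \<le> b\<close> by simp
      finally show ?thesis .
    qed
    have E2: "\<bar>\<Sum>(x,K)\<in>p2. len K * f0 x - incr F K\<bar> < e / 2"
    proof -
      have "\<bar>\<Sum>(x,K)\<in>p2. len K * f0 x - incr F K\<bar> \<le> (\<Sum>(x,K)\<in>p2. \<bar>incr F K\<bar>)"
        unfolding real_norm_def[symmetric]
        by (rule sum_norm_le) (auto simp: p2_def f0_def)
      also have "\<dots> = (\<Sum>z\<in>p2. \<bar>incr F (snd z)\<bar>)" by (simp add: case_prod_unfold)
      also have "\<dots> = (\<Sum>K\<in>snd ` p2. \<bar>incr F K\<bar>)"
      proof (rule sum.reindex_nontrivial[OF fin12(2), symmetric, unfolded o_def])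
        \<comment> \<open>Two tags share a piece only if its interior is empty, and then the
          increment over it vanishes.\<close>
        fix z z' assume z: "z \<in> p2" "z' \<in> p2" "z \<noteq> z'" "snd z = snd z'"
        obtain x K where zx: "z = (x, K)" by (cases z)
        obtain x' where zx': "z' = (x', K)" using z zx by (cases z') auto
        have zp: "(x, K) \<in> p" "(x', K) \<in> p" using z zx zx' by (auto simp: p2_def)
        then have "interior K = {}" using tagged_division_ofD(5)[OF p zp] z(3) zx zx' by auto
        moreover obtain u v where "K = {u..v}" "u \<le> v" using seg zp by blast
        ultimately show "\<bar>incr F (snd z)\<bar> = 0" using zx by (auto simp: incr_def)
      qed
      also have "\<dots> < e / 2"
      proof (rule sm)
        have tp: "p2 tagged_partial_division_of {a..b}"
          using p by (rule tagged_partial_division_subset[OF tagged_division_of_def[THEN iffD1, THEN conjunct1]]) (auto simp: p2_def)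
        show div: "snd ` p2 division_of \<Union> (snd ` p2)" by (rule partial_division_of_tagged_division[OF tp])
        show "\<Union> (snd ` p2) \<subseteq> {a..b}" using tagged_division_ofD(3)[OF p] by (fastforce simp: p2_def)
        have "sum len (snd ` p2) = (\<Sum>K\<in>snd ` p2. measure lebesgue K)"
          using seg by (intro sum.cong refl) (force simp: p2_def)
        also have "\<dots> = measure lebesgue (\<Union> (snd ` p2))" by (rule content_division[OF div])
        also have "\<dots> \<le> measure lebesgue U"
        proof (rule measure_mono_fmeasurable)
          show "\<Union> (snd ` p2) \<subseteq> U"
          proof clarify
            fix x y K assume "(y, K) \<in> p2" "x \<in> snd (y, K)"
            then have "(y, K) \<in> p" "y \<in> N" "x \<in> K" by (auto simp: p2_def)
            then show "x \<in> U" using fineD[OF fine \<open>(y, K) \<in> p\<close>] by (auto simp: \<gamma>_def)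
          qed
          show "\<Union> (snd ` p2) \<in> sets lebesgue" using lmeasurable_division[OF div] by blast
        qed (rule Um)
        also have "\<dots> < \<delta>" by (rule Um)
        finally show "sum len (snd ` p2) < \<delta>" .
      qed
      finally show ?thesis .
    qed
    have "(\<Sum>(x,K)\<in>p. incr F K) = F b - F a"
      using additive_tagged_division_1[OF \<open>a \<le> b\<close> p, of F] by (simp add: incr_def)
    then have "(\<Sum>(x,K)\<in>p. len K *\<^sub>R f0 x) - (F b - F a) = (\<Sum>(x,K)\<in>p. len K * f0 x - incr F K)"
      by (simp add: sum_subtractf case_prod_unfold)
    also have "\<dots> = (\<Sum>(x,K)\<in>p1. len K * f0 x - incr F K) + (\<Sum>(x,K)\<in>p2. len K * f0 x - incr F K)"
      unfolding fin12(3) by (rule sum.union_disjoint[OF fin12(1,2,4)])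
    finally have "norm ((\<Sum>(x,K)\<in>p. len K *\<^sub>R f0 x) - (F b - F a)) < \<epsilon> * (b - a) + e / 2"
      using E1 E2 by simp
    also have "\<epsilon> * (b - a) \<le> e / 2"
      using \<open>e > 0\<close> \<open>a \<le> b\<close> by (simp add: \<epsilon>_def divide_simps; simp add: algebra_simps)
    finally show ?case by simp
  qed
qed

text \<open>If the positive part of the derivative has infinite integral, then so has
  \<open>k\<close> and the claim is trivial. Otherwise that part is Lebesgue integrable and
  dominates the gauge integral of the derivative, which is \<open>F b - F a\<close>.\<close>

theorem abs_cont_on_nn_integral_ge:
  assumes F: "abs_cont_on a b F" and "a \<le> b" and N: "negligible N"
    and der: "\<And>x. x \<in> {a..b} - N \<Longrightarrow> (F has_real_derivative f x) (at x) \<and> ennreal (f x) \<le> k x"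
  shows "ennreal (F b - F a) \<le> (\<integral>\<^sup>+ x. indicator {a..b} x * k x \<partial>lborel)"
proof -
  define f0 where "f0 x = (if x \<in> N then 0 else f x)" for x
  define fp where "fp x = indicator {a..b} x * max 0 (f0 x)" for x
  have I: "(f0 has_integral F b - F a) {a..b}"
    unfolding f0_def
    using der by (intro abs_cont_on_FTC[OF F \<open>a \<le> b\<close> N])
      (auto simp: has_real_derivative_iff_has_vector_derivative intro: has_vector_derivative_at_within)
  have "(\<lambda>x. max 0 (f0 x * indicator {a..b} x)) \<in> borel_measurable lebesgue"
    using has_integral_implies_lebesgue_measurable_real[OF I] by measurable
  moreover have "(\<lambda>x. max 0 (f0 x * indicator {a..b} x)) = fp" by (auto simp: fp_def indicator_def)
  ultimately have fpm: "fp \<in> borel_measurable lebesgue" by simp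
  have "AE x in lebesgue. x \<notin> N" using N by (simp add: negligible_iff_null_sets AE_not_in)
  then have "AE x in lebesgue. ennreal (fp x) \<le> indicator {a..b} x * k x"
  proof eventually_elim
    case (elim x)
    then show ?case using der[of x] by (auto simp: fp_def f0_def indicator_def max_def)
  qed
  then have le: "(\<integral>\<^sup>+ x. ennreal (fp x) \<partial>lebesgue) \<le> (\<integral>\<^sup>+ x. indicator {a..b} x * k x \<partial>lborel)"
    by (subst nn_integral_completion[of lborel "\<lambda>x. indicator {a..b} x * k x", symmetric]) (rule nn_integral_mono_AE)
  show ?thesis
  proof (cases "(\<integral>\<^sup>+ x. ennreal (fp x) \<partial>lebesgue) = \<infinity>")
    case True then show ?thesis using le by (simp add: top_unique)
  next
    case False
    have int: "integrable lebesgue fp"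
      using fpm False by (intro integrableI_nonneg) (auto simp: fp_def top.not_eq_extremum)
    then have "(fp has_integral integral\<^sup>L lebesgue fp) UNIV" by (rule has_integral_integral_lebesgue)
    then have "((\<lambda>x. if x \<in> {a..b} then max 0 (f0 x) else 0) has_integral integral\<^sup>L lebesgue fp) UNIV"
      by (rule has_integral_eq[rotated]) (auto simp: fp_def)
    then have "((\<lambda>x. max 0 (f0 x)) has_integral integral\<^sup>L lebesgue fp) {a..b}"
      by (simp only: has_integral_restrict_UNIV)
    then have "F b - F a \<le> integral\<^sup>L lebesgue fp"
      by (rule has_integral_le[OF I]) simp
    then have "ennreal (F b - F a) \<le> ennreal (integral\<^sup>L lebesgue fp)" by (rule ennreal_leI)
    also have "\<dots> = (\<integral>\<^sup>+ x. ennreal (fp x) \<partial>lebesgue)"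
      by (rule nn_integral_eq_integral[OF int, symmetric]) (auto simp: fp_def)
    finally show ?thesis using le by simp
  qed
qed

section \<open>The Hamiltonian, the Lagrangian and the entropy\<close>

lemma tanh_artanh_real [simp]:
  assumes "\<bar>x::real\<bar> < 1"
  shows "tanh (artanh x) = x"
proof -
  have "exp (- 2 * artanh x) = inverse (exp (ln ((1 + x) / (1 - x))))"
    by (simp add: artanh_def exp_minus)
  also have "\<dots> = (1 - x) / (1 + x)"
    using assms by (subst exp_ln) (auto simp: divide_simps abs_less_iff)
  finally have e: "exp (- 2 * artanh x) = (1 - x) / (1 + x)" .
  show ?thesis
    unfolding tanh_real_altdef e using assms by (simp add: field_simps abs_less_iff)
qed

lemma abs_tanh_real_less_1: "\<bar>tanh (x::real)\<bar> < 1"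
  using tanh_real_bounds[of x] by (auto simp: abs_less_iff)

lemma tanh_add_real: "tanh (x + y :: real) = (tanh x + tanh y) / (1 + tanh x * tanh y)"
  by (rule tanh_add) auto

lemma one_plus_mult_tanh_pos: 
  fixes u v :: real assumes "\<bar>u\<bar> < 1" "\<bar>v\<bar> \<le> 1"
  shows "1 + u * v > 0"
proof -
  have "\<bar>u * v\<bar> \<le> \<bar>u\<bar> * 1" unfolding abs_mult using assms by (intro mult_left_mono) auto
  then show ?thesis using assms by linarith
qed

lemma cosh_add_tanh: "cosh (x + y :: real) = cosh x * cosh y * (1 + tanh x * tanh y)"
  by (simp add: cosh_add tanh_def field_simps)

lemma ln_cosh_add: "ln (cosh (x + y :: real)) = ln (cosh x) + ln (cosh y) + ln (1 + tanh x * tanh y)"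
  using one_plus_mult_tanh_pos[of "tanh x" "tanh y"] abs_tanh_real_less_1[of x] abs_tanh_real_less_1[of y]
  by (simp add: cosh_add_tanh ln_mult)

lemma sinh_double_tanh: "sinh (2 * x :: real) = 2 * tanh x / (1 - (tanh x)\<^sup>2)"
proof -
  have "(cosh x)\<^sup>2 * (1 - (tanh x)\<^sup>2) = (cosh x)\<^sup>2 - (sinh x)\<^sup>2"
    by (simp add: tanh_def power_divide right_diff_distrib)
  then have "1 - (tanh x)\<^sup>2 = 1 / (cosh x)\<^sup>2"
    by (simp add: hyperbolic_pythagoras nonzero_eq_divide_eq mult.commute)
  then show ?thesis by (simp add: sinh_double tanh_def power2_eq_square)
qed

lemma cosh_tangent_le: "cosh (z::real) \<ge> cosh w + (z - w) * sinh w"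
proof -
  have "exp w * exp (z - w) \<ge> exp w * (1 + (z - w))" "exp (- w) * exp (w - z) \<ge> exp (- w) * (1 + (w - z))"
    by (intro mult_left_mono exp_ge_add_one_self; simp)+
  then show ?thesis by (simp add: cosh_field_def sinh_field_def field_simps flip: exp_add)
qed

lemma H_cosh: "H x p = cosh (2 * p) - 1 - x * sinh (2 * p)"
  by (simp add: H_def cosh_field_def sinh_field_def field_simps)

lemma Hp_eq: "Hp x p = 2 * sinh (2 * p) - 2 * x * cosh (2 * p)"
  unfolding Hp_def H_cosh by (rule DERIV_imp_deriv) (auto intro!: derivative_eq_intros)

lemma Hx_eq: "Hx x p = - sinh (2 * p)"
  unfolding Hx_def H_cosh by (rule DERIV_imp_deriv) (auto intro!: derivative_eq_intros)

text \<open>In the coordinate \<open>x = tanh h\<close> the Hamiltonian is one shifted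
  \<open>cosh\<close>, which shows both its convexity in \<open>p\<close> and its symmetry under
  \<open>p \<mapsto> h - p\<close>.\<close>

lemma H_tanh: "H (tanh h) p = cosh (2 * p - h) / cosh h - 1"
  by (simp add: H_cosh cosh_diff tanh_def field_simps)

text \<open>Reversibility: time reversal exchanges the momentum \<open>p\<close> with
  \<open>h - p\<close>, where \<open>h = artanh x\<close> is the derivative of the entropy. Here
  \<open>h = b + p\<close>.\<close>

lemma H_tanh_symmetric: "H (tanh (b + p)) b = H (tanh (b + p)) p"
proof -
  have "2 * b - (b + p) = b - p" "2 * p - (b + p) = - (b - p)" by simp_all
  then show ?thesis unfolding H_tanh by (simp only: cosh_minus)
qed

text \<open>On \<open>[-1,1]\<close> this is the convex conjugate of
  \<open>ln (cosh h)\<close>.\<close>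

definition ent :: "real \<Rightarrow> real" where
  "ent x = (1 - x) / 2 * ln (1 - x) + (1 + x) / 2 * ln (1 + x)"

lemma I0_ent: "I0 \<alpha> \<theta> x = ent x - \<alpha> * x\<^sup>2 / 2 - \<theta> * x + Cconst \<alpha> \<theta>"
  by (simp add: I0_def I0base_def ent_def)

lemma ent_tanh: "ent (tanh h) = h * tanh h - ln (cosh h)"
proof -
  have "1 + tanh h = exp h / cosh h" "1 - tanh h = exp (- h) / cosh h"
    by (simp_all add: tanh_def field_simps cosh_plus_sinh cosh_minus_sinh)
  then have ln: "ln (1 + tanh h) = h - ln (cosh h)" "ln (1 - tanh h) = - h - ln (cosh h)"
    by (simp_all add: ln_div)
  show ?thesis unfolding ent_def ln by (simp add: field_simps)
qed

lemma continuous_on_ent: "continuous_on {-1..1} ent"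
proof -
  define g :: "real \<Rightarrow> real" where "g = (\<lambda>x. x / 2 * ln x)"
  have "continuous (at x within {0..}) g" if "x \<ge> 0" for x
  proof (cases "x = 0")
    case True
    have "((\<lambda>x::real. x / 2 * ln x) \<longlongrightarrow> 0) (at_right 0)" by real_asymp
    moreover have "at (0::real) within {0..} = at_right 0"
      by (intro at_within_Ici_at_right)
    ultimately show ?thesis using True by (simp add: continuous_within g_def)
  next
    case False
    then show ?thesis using that unfolding g_def by (auto intro!: continuous_intros)
  qed
  then have g: "continuous_on {0..} g" by (simp add: continuous_on_eq_continuous_within)
  have "continuous_on {-1..1} (\<lambda>x. g (1 - x) + g (1 + x))"
    by (intro continuous_intros continuous_on_compose2[OF g]) auto
  then show ?thesis by (rule continuous_on_eq) (simp add: g_def ent_def)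
qed

lemma ent_has_derivative:
  assumes "\<bar>x\<bar> < 1"
  shows "(ent has_real_derivative artanh x) (at x)"
proof -
  have "((\<lambda>x. (1 - x) / 2 * ln (1 - x) + (1 + x) / 2 * ln (1 + x)) has_real_derivative
     (- ln (1 - x) / 2 - 1 / 2) + (ln (1 + x) / 2 + 1 / 2)) (at x)"
    using assms by (auto intro!: derivative_eq_intros simp: abs_less_iff) (simp add: field_simps)
  moreover have "(- ln (1 - x) / 2 - 1 / 2) + (ln (1 + x) / 2 + 1 / 2) = artanh x"
    using assms by (simp add: artanh_def ln_div abs_less_iff field_simps)
  ultimately show ?thesis unfolding ent_def[abs_def] by simp
qed

text \<open>Nonnegativity of the relative entropy of the weights \<open>1 - a\<close>,
  \<open>1 + a\<close> with respect to \<open>1 - tanh h\<close>, \<open>1 + tanh h\<close>. A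
  weight of \<open>a\<close> may be 0, where \<open>0 * ln 0 = 0\<close>.\<close>

lemma ent_Fenchel_Young:
  assumes "a \<in> {-1..1}"
  shows "a * h - ln (cosh h) \<le> ent a"
proof -
  have *: "s * ln s \<ge> s * ln w + s - w" if "s \<ge> 0" "w > 0" for s w :: real
  proof (cases "s = 0")
    case False
    then have "ln (w / s) \<le> w / s - 1" using that by (intro ln_le_minus_one) auto
    then have "ln w - ln s \<le> w / s - 1" using that False by (simp add: ln_div)
    then have "s * (ln w - ln s) \<le> s * (w / s - 1)" using that by (intro mult_left_mono) auto
    then show ?thesis using False by (simp add: algebra_simps)
  qed (use that in auto)
  have "1 + tanh h = exp h / cosh h" "1 - tanh h = exp (- h) / cosh h"
    by (simp_all add: tanh_def field_simps cosh_plus_sinh cosh_minus_sinh)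
  then have ln: "ln (1 + tanh h) = h - ln (cosh h)" "ln (1 - tanh h) = - h - ln (cosh h)"
    by (simp_all add: ln_div)
  have e: "2 * ent a = (1 - a) * ln (1 - a) + (1 + a) * ln (1 + a)" by (simp add: ent_def field_simps)
  have "(1 - a) * ln (1 - a) \<ge> (1 - a) * ln (1 - tanh h) + (1 - a) - (1 - tanh h)"
    "(1 + a) * ln (1 + a) \<ge> (1 + a) * ln (1 + tanh h) + (1 + a) - (1 + tanh h)"
    using assms tanh_real_bounds[of h] by (intro *; simp)+
  then have "2 * ent a \<ge> 2 * (a * h - ln (cosh h))" unfolding ln e by (simp add: algebra_simps)
  then show ?thesis by simp
qed

lemma deriv_I0:
  assumes "\<bar>x\<bar> < 1"
  shows "(I0 \<alpha> \<theta> has_real_derivative artanh x - \<alpha> * x - \<theta>) (at x)"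
  unfolding I0_ent[abs_def] by (auto intro!: derivative_eq_intros ent_has_derivative assms)

text \<open>The purpose of the normalising constant: a nonnegative \<open>I0\<close> is not
  truncated by the passage to \<open>ennreal\<close>.\<close>

lemma I0_nonneg:
  assumes "x \<in> {-1..1}" shows "0 \<le> I0 \<alpha> \<theta> x"
proof -
  have eq: "I0base \<alpha> \<theta> = (\<lambda>x. ent x - \<alpha> * x\<^sup>2 / 2 - \<theta> * x)" by (auto simp: I0base_def ent_def)
  have "continuous_on {-1..1} (I0base \<alpha> \<theta>)"
    unfolding eq by (intro continuous_intros continuous_on_ent) auto
  then have "compact (I0base \<alpha> \<theta> ` {-1..1})" by (intro compact_continuous_image) auto
  then have "bdd_below (I0base \<alpha> \<theta> ` {-1..1})" by (simp add: bounded_imp_bdd_below compact_imp_bounded)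
  from cINF_lower[OF this assms] show ?thesis by (simp add: I0_def Cconst_def)
qed

lemma Lag_ge: "ennreal (p * v - H x p) \<le> Lag x v"
  unfolding Lag_def by (rule SUP_upper) simp

text \<open>The function under the supremum is concave, and for the velocity
  \<open>Hp (tanh h) p\<close> its tangent at \<open>p\<close> is horizontal; the tangent inequality
  for \<open>cosh\<close> makes this explicit.\<close>

lemma Lag_Hp: "Lag (tanh h) (Hp (tanh h) p) = ennreal (p * Hp (tanh h) p - H (tanh h) p)"
proof (rule antisym)
  have Hp: "Hp (tanh h) p = 2 * sinh (2 * p - h) / cosh h"
    by (simp add: Hp_eq sinh_diff tanh_def field_simps)
  show "Lag (tanh h) (Hp (tanh h) p) \<le> ennreal (p * Hp (tanh h) p - H (tanh h) p)"
    unfolding Lag_def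
  proof (intro SUP_least ennreal_leI)
    fix p'
    have "cosh (2 * p' - h) \<ge> cosh (2 * p - h) + (2 * p' - 2 * p) * sinh (2 * p - h)"
      using cosh_tangent_le[of "2 * p - h" "2 * p' - h"] by simp
    then show "p' * Hp (tanh h) p - H (tanh h) p' \<le> p * Hp (tanh h) p - H (tanh h) p"
      by (simp add: Hp H_tanh divide_simps; simp add: algebra_simps)
  qed
qed (rule Lag_ge)

text \<open>Comparison of the maximising momentum with the momentum 0, at which \<open>H\<close>
  vanishes.\<close>

lemma Legendre_Hp_nonneg: "0 \<le> p * Hp (tanh h) p - H (tanh h) p"
proof -
  have Hp: "Hp (tanh h) p = 2 * sinh (2 * p - h) / cosh h"
    by (simp add: Hp_eq sinh_diff tanh_def field_simps)
  have "cosh (- h) \<ge> cosh (2 * p - h) + (- 2 * p) * sinh (2 * p - h)"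
    using cosh_tangent_le[of "2 * p - h" "- h"] by simp
  then show ?thesis by (simp add: Hp H_tanh divide_simps; simp add: algebra_simps)
qed

section \<open>Lower and upper bounds for the action\<close>

text \<open>The flow of \<open>b' = - sinh (2 * b)\<close>, that is of
  \<open>(tanh b)' = - 2 * tanh b\<close>. It runs the momentum equation backwards, hence contracts
  towards 0 and exists for all \<open>t \<ge> 0\<close>, whereas forwards a nonzero momentum becomes
  infinite in finite time.\<close>

definition tilt :: "real \<Rightarrow> real \<Rightarrow> real" where
  "tilt t q = artanh (exp (- 2 * t) * tanh q)"

lemma exp_mult_exp_cancel: "exp (- 2 * s) * u * (exp (2 * s) * v) = u * (v :: real)"
proof -
  have "exp (- 2 * s) * u * (exp (2 * s) * v) = (exp (- 2 * s) * exp (2 * s)) * (u * v)"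
    by (simp only: mult_ac)
  also have "exp (- 2 * s) * exp (2 * s) = 1" by (simp flip: exp_add)
  finally show ?thesis by simp
qed

lemma abs_exp_mult_tanh_less_1:
  fixes t q :: real
  assumes "t \<ge> 0" shows "\<bar>exp (- 2 * t) * tanh q\<bar> < 1"
proof -
  have "\<bar>exp (- 2 * t) * tanh q\<bar> \<le> 1 * \<bar>tanh q\<bar>"
    unfolding abs_mult using assms by (intro mult_right_mono) auto
  then show ?thesis using abs_tanh_real_less_1[of q] by simp
qed

lemma tanh_tilt: "t \<ge> 0 \<Longrightarrow> tanh (tilt t q) = exp (- 2 * t) * tanh q"
  unfolding tilt_def by (rule tanh_artanh_real[OF abs_exp_mult_tanh_less_1])

lemma tilt_0 [simp]: "tilt 0 q = q"
  by (simp add: tilt_def artanh_tanh_real)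

lemma abs_tilt_le:
  assumes "t \<ge> 0" shows "\<bar>tilt t q\<bar> \<le> \<bar>q\<bar>"
proof -
  have "tanh \<bar>tilt t q\<bar> \<le> tanh \<bar>q\<bar>"
    unfolding tanh_real_abs tanh_tilt[OF assms] abs_mult
    using assms by (intro mult_left_le_one_le) auto
  then show ?thesis by (simp only: tanh_real_le_iff)
qed

lemma artanh_exp_has_derivative:
  assumes "\<bar>exp (c * s) * k\<bar> < 1"
  shows "((\<lambda>s. artanh (exp (c * s) * k)) has_real_derivative c / 2 * sinh (2 * artanh (exp (c * s) * k))) (at s)"
proof -
  have "((\<lambda>s. exp (c * s) * k) has_real_derivative c * (exp (c * s) * k)) (at s)"
    by (auto intro!: derivative_eq_intros)
  from DERIV_chain2[OF artanh_real_has_field_derivative[OF assms] this]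
  have "((\<lambda>s. artanh (exp (c * s) * k)) has_real_derivative
     1 / (1 - (exp (c * s) * k)\<^sup>2) * (c * (exp (c * s) * k))) (at s)" .
  then show ?thesis unfolding sinh_double_tanh tanh_artanh_real[OF assms] by (simp add: mult_ac)
qed

lemma tilt_has_derivative:
  assumes "s \<ge> 0"
  shows "((\<lambda>s. tilt s q) has_real_derivative - sinh (2 * tilt s q)) (at s)"
  using artanh_exp_has_derivative[of "-2" s "tanh q"] abs_exp_mult_tanh_less_1[OF assms, of q]
  unfolding tilt_def by simp

lemma tilt_Lipschitz:
  assumes "0 \<le> s" "0 \<le> t"
  shows "\<bar>tilt t q - tilt s q\<bar> \<le> sinh (2 * \<bar>q\<bar>) * \<bar>t - s\<bar>"
proof -
  have "norm (tilt t q - tilt s q) \<le> sinh (2 * \<bar>q\<bar>) * norm (t - s)"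
  proof (rule field_differentiable_bound[of "{0..}"])
    show "((\<lambda>t. tilt t q) has_field_derivative - sinh (2 * tilt z q)) (at z within {0..})" if "z \<in> {0..}" for z
      using that by (intro has_field_derivative_at_within[OF tilt_has_derivative]) auto
    show "norm (- sinh (2 * tilt z q)) \<le> sinh (2 * \<bar>q\<bar>)" if "z \<in> {0..}" for z
    proof -
      have "sinh \<bar>2 * tilt z q\<bar> \<le> sinh (2 * \<bar>q\<bar>)"
        unfolding sinh_real_le_iff using abs_tilt_le[of z q] that by (simp add: abs_mult)
      then show ?thesis by (simp only: sinh_real_abs real_norm_def abs_minus_cancel)
    qed
  qed (use assms in auto)
  then show ?thesis by simp
qed

lemma ln_cosh_has_derivative: "((\<lambda>x. ln (cosh x)) has_real_derivative tanh x) (at x)"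
  by (auto intro!: derivative_eq_intros simp: tanh_def)

lemma tanh_mult_sinh_double: "tanh p * sinh (2 * p) = cosh (2 * p) - (1::real)"
  unfolding cosh_double_cosh cosh_square_eq sinh_double by (simp add: tanh_def power2_eq_square)

lemma abs_ln_cosh_diff_le: "\<bar>ln (cosh x) - ln (cosh (y::real))\<bar> \<le> \<bar>x - y\<bar>"
proof -
  have "norm (ln (cosh x) - ln (cosh y)) \<le> 1 * norm (x - y)"
  proof (rule field_differentiable_bound[of UNIV])
    show "((\<lambda>x. ln (cosh x)) has_field_derivative tanh z) (at z within UNIV)" for z :: real
      using ln_cosh_has_derivative[of z] by simp
    show "norm (tanh z) \<le> 1" for z :: real using abs_tanh_real_less_1[of z] by simp
  qed auto
  then show ?thesis by simp
qed

text \<open>The calibrating momentum is prescribed at the final time and followed backwards, because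
  forwards it could become infinite before \<open>t\<close>. Its equation does not involve
  \<open>\<gamma>\<close>, so the same momentum serves every path.\<close>

theorem action_ge:
  assumes "t > 0" and ac: "abs_cont_on 0 t \<gamma>" and range: "\<gamma> ` {0..t} \<subseteq> {-1..1}"
  shows "ennreal (q * \<gamma> t - ln (cosh q) - (tilt t q * \<gamma> 0 - ln (cosh (tilt t q)))) \<le> action t \<gamma>"
proof -
  define p where "p s = tilt (t - s) q" for s
  define F where "F s = p s * \<gamma> s - ln (cosh (p s))" for s
  have dp: "(p has_real_derivative sinh (2 * p s)) (at s)" if "s \<le> t" for s
  proof -
    have "((\<lambda>s. tilt (t - s) q) has_real_derivative - sinh (2 * tilt (t - s) q) * (- 1)) (at s)"
      by (rule DERIV_chain2[where f = "\<lambda>s. tilt s q" and g = "\<lambda>s. t - s", OF tilt_has_derivative])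
        (use that in \<open>auto intro!: derivative_eq_intros\<close>)
    then show ?thesis by (simp add: p_def[abs_def])
  qed
  have pq: "\<bar>p s\<bar> \<le> \<bar>q\<bar>" if "s \<le> t" for s
    using abs_tilt_le[of "t - s" q] that by (simp add: p_def)
  have plip: "\<bar>p y - p x\<bar> \<le> sinh (2 * \<bar>q\<bar>) * (y - x)" if "0 \<le> x" "x \<le> y" "y \<le> t" for x y
    using tilt_Lipschitz[of "t - x" "t - y" q] that by (simp add: p_def)
  have \<gamma>1: "\<bar>\<gamma> s\<bar> \<le> 1" if "0 \<le> s" "s \<le> t" for s
    using range that by (force simp: abs_le_iff)
  have acF: "abs_cont_on 0 t F"
  proof (rule abs_cont_on_if_incr_le[OF ac, of "\<bar>q\<bar>" "2 * sinh (2 * \<bar>q\<bar>)"])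
    fix x y assume xy: "0 \<le> x" "x \<le> y" "y \<le> t"
    have "F y - F x = p y * (\<gamma> y - \<gamma> x) + \<gamma> x * (p y - p x) - (ln (cosh (p y)) - ln (cosh (p x)))"
      by (simp add: F_def algebra_simps)
    then have "\<bar>F y - F x\<bar> \<le> \<bar>p y * (\<gamma> y - \<gamma> x)\<bar> + \<bar>\<gamma> x * (p y - p x)\<bar> + \<bar>ln (cosh (p y)) - ln (cosh (p x))\<bar>"
      by linarith
    also have "\<dots> \<le> \<bar>q\<bar> * \<bar>\<gamma> y - \<gamma> x\<bar> + 1 * \<bar>p y - p x\<bar> + \<bar>p y - p x\<bar>"
      unfolding abs_mult using xy pq \<gamma>1
      by (intro add_mono mult_right_mono abs_ln_cosh_diff_le) auto
    also have "\<dots> \<le> \<bar>q\<bar> * \<bar>\<gamma> y - \<gamma> x\<bar> + 2 * sinh (2 * \<bar>q\<bar>) * (y - x)"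
      using plip[OF xy] by simp
    finally show "\<bar>F y - F x\<bar> \<le> \<bar>q\<bar> * \<bar>\<gamma> y - \<gamma> x\<bar> + 2 * sinh (2 * \<bar>q\<bar>) * (y - x)" .
  qed auto
  \<comment> \<open>The endpoints join the exceptional set because differentiability is known only
    in the open interval.\<close>
  define N where "N = {x \<in> {0<..<t}. \<not> \<gamma> differentiable (at x)} \<union> {0, t}"
  have N: "negligible N"
    unfolding N_def by (intro negligible_Un abs_cont_on_differentiable_ae[OF ac] negligible_finite) auto
  have "ennreal (F t - F 0) \<le> (\<integral>\<^sup>+ x. indicator {0..t} x * Lag (\<gamma> x) (vector_derivative \<gamma> (at x)) \<partial>lborel)"
  proof (rule abs_cont_on_nn_integral_ge[OF acF _ N])
    fix x assume x: "x \<in> {0..t} - N"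
    then have x': "0 < x" "x < t" "\<gamma> differentiable (at x)" by (auto simp: N_def less_le)
    define v where "v = vector_derivative \<gamma> (at x)"
    have dg: "(\<gamma> has_real_derivative v) (at x)"
      using x'(3) unfolding v_def has_real_derivative_iff_has_vector_derivative vector_derivative_works .
    have dpx: "(p has_real_derivative sinh (2 * p x)) (at x)" using dp x' by simp
    have "(F has_real_derivative (p x * v + sinh (2 * p x) * \<gamma> x) - tanh (p x) * sinh (2 * p x)) (at x)"
      unfolding F_def[abs_def]
      by (rule DERIV_diff[OF DERIV_mult'[OF dpx dg] DERIV_chain2[OF ln_cosh_has_derivative dpx]])
    \<comment> \<open>The term \<open>ln (cosh p)\<close> was put into \<open>F\<close> to produce
      the part \<open>cosh (2 * p) - 1\<close> of the Hamiltonian, which does not contain the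
      position.\<close>
    also have "(p x * v + sinh (2 * p x) * \<gamma> x) - tanh (p x) * sinh (2 * p x) = p x * v - H (\<gamma> x) (p x)"
      unfolding tanh_mult_sinh_double by (simp add: H_cosh)
    finally show "(F has_real_derivative p x * v - H (\<gamma> x) (p x)) (at x) \<and>
       ennreal (p x * v - H (\<gamma> x) (p x)) \<le> Lag (\<gamma> x) (vector_derivative \<gamma> (at x))"
      using Lag_ge[of "p x" v "\<gamma> x"] unfolding v_def ..
  qed (use \<open>t > 0\<close> in simp)
  moreover have "F t - F 0 = q * \<gamma> t - ln (cosh q) - (tilt t q * \<gamma> 0 - ln (cosh (tilt t q)))"
    by (simp add: F_def p_def)
  ultimately show ?thesis by (simp add: action_def)
qed

lemma abs_cont_on_if_Lipschitz:
  assumes "B \<ge> 0" "\<And>x y. a \<le> x \<Longrightarrow> x \<le> y \<Longrightarrow> y \<le> b \<Longrightarrow> \<bar>F y - F x\<bar> \<le> B * (y - x)"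
  shows "abs_cont_on a b F"
  by (rule abs_cont_on_if_incr_le[of a b "\<lambda>_. 0" 0 B])
    (auto simp: abs_cont_on_def assms intro!: exI[of _ 1])

text \<open>The addition formula for \<open>tanh (b + p)\<close> with
  \<open>tanh b = exp (- 2 * s) * u\<close> and \<open>tanh p = exp (2 * s) * v\<close>. Unlike
  \<open>p\<close> itself the quotient still makes sense once \<open>exp (2 * s) * |v|\<close> has
  reached 1.\<close>

definition char_path :: "real \<Rightarrow> real \<Rightarrow> real \<Rightarrow> real" where
  "char_path u v s = (exp (- 2 * s) * u + exp (2 * s) * v) / (1 + u * v)"

lemma char_path_has_derivative:
  "(char_path u v has_real_derivative 2 * (exp (2 * s) * v - exp (- 2 * s) * u) / (1 + u * v)) (at s)"
proof -
  have "((\<lambda>s. exp (- 2 * s) * u + exp (2 * s) * v) has_real_derivative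
      2 * (exp (2 * s) * v - exp (- 2 * s) * u)) (at s)"
    by (auto intro!: derivative_eq_intros simp: algebra_simps)
  from DERIV_cdivide[OF this] show ?thesis unfolding char_path_def[abs_def] .
qed

text \<open>The factorisations isolate \<open>exp (2 * s) * v\<close>: for \<open>|u| < 1\<close>,
  \<open>|v| < 1\<close> and \<open>s \<ge> 0\<close> the other factor and the denominator are
  positive, so the momentum alone decides when the path leaves.\<close>

lemma char_path_gap:
  assumes "1 + u * v \<noteq> 0"
  shows "1 - char_path u v s = (1 - exp (2 * s) * v) * (1 - exp (- 2 * s) * u) / (1 + u * v)"
    and "1 + char_path u v s = (1 + exp (2 * s) * v) * (1 + exp (- 2 * s) * u) / (1 + u * v)"
proof -
  have "exp (2 * s) * v * (exp (- 2 * s) * u) = u * v"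
    using exp_mult_exp_cancel[of s u v] by (simp only: mult_ac)
  then show "1 - char_path u v s = (1 - exp (2 * s) * v) * (1 - exp (- 2 * s) * u) / (1 + u * v)"
    and "1 + char_path u v s = (1 + exp (2 * s) * v) * (1 + exp (- 2 * s) * u) / (1 + u * v)"
    using assms by (simp_all add: char_path_def divide_simps; simp add: algebra_simps)+
qed

lemma exp_mult_less:
  fixes s t v :: real
  assumes "\<bar>v\<bar> \<le> exp (- 2 * t)" "s < t" shows "\<bar>exp (2 * s) * v\<bar> < 1"
proof -
  have "\<bar>exp (2 * s) * v\<bar> \<le> exp (2 * s) * exp (- 2 * t)"
    unfolding abs_mult using assms(1) by (auto intro: mult_left_mono)
  also have "\<dots> = exp (2 * (s - t))" by (simp flip: exp_add)
  also have "\<dots> < 1" using assms(2) by simp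
  finally show ?thesis .
qed

lemma char_path_tanh:
  assumes "s \<ge> 0" "\<bar>exp (2 * s) * v\<bar> < 1"
  shows "char_path (tanh q) v s = tanh (tilt s q + artanh (exp (2 * s) * v))"
proof -
  show ?thesis
    using assms exp_mult_exp_cancel[of s "tanh q" v]
    by (simp only: tanh_add_real tanh_tilt char_path_def tanh_artanh_real)
qed

lemma char_path_Hamilton:
  assumes "s \<ge> 0" "\<bar>exp (2 * s) * v\<bar> < 1"
  shows "(char_path (tanh q) v has_real_derivative
           Hp (char_path (tanh q) v s) (artanh (exp (2 * s) * v))) (at s)"
proof -
  define b where "b = tilt s q"
  define p where "p = artanh (exp (2 * s) * v)"
  have tp: "tanh p = exp (2 * s) * v" using assms by (simp add: p_def)
  have tb: "tanh b = exp (- 2 * s) * tanh q" using assms by (simp add: b_def tanh_tilt)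
  have bp: "tanh b * tanh p = tanh q * v" unfolding tb tp by (rule exp_mult_exp_cancel)
  have X: "char_path (tanh q) v s = tanh (b + p)"
    using char_path_tanh[OF assms(1,2)] by (simp add: b_def p_def)
  have c: "cosh (b + p) = cosh b * cosh p * (1 + tanh b * tanh p)" by (rule cosh_add_tanh)
  have "Hp (tanh (b + p)) p = 2 * sinh (p - b) / cosh (b + p)"
  proof -
    have "p - b = 2 * p - (b + p)" by simp
    then have "sinh (p - b) = sinh (2 * p) * cosh (b + p) - cosh (2 * p) * sinh (b + p)"
      by (simp only: sinh_diff)
    then show ?thesis by (simp add: Hp_eq tanh_def field_simps)
  qed
  also have "\<dots> = 2 * (tanh p - tanh b) / (1 + tanh b * tanh p)"
    unfolding c by (simp add: sinh_diff tanh_def field_simps)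
  also have "\<dots> = 2 * (exp (2 * s) * v - exp (- 2 * s) * tanh q) / (1 + tanh q * v)"
    unfolding bp unfolding tp tb ..
  finally show ?thesis using char_path_has_derivative[of "tanh q" v s] X by (simp add: p_def)
qed

lemma gap_sign:
  fixes A :: real
  assumes "1 - X = A * u / D" "u > 0" "D > 0"
  shows "X \<le> 1 \<longleftrightarrow> 0 \<le> A" "X < 1 \<longleftrightarrow> 0 < A"
proof -
  have "0 \<le> A * u / D \<longleftrightarrow> 0 \<le> A" "0 < A * u / D \<longleftrightarrow> 0 < A"
    using assms(2,3) by (simp_all add: zero_le_divide_iff zero_less_divide_iff zero_le_mult_iff zero_less_mult_iff)
  then show "X \<le> 1 \<longleftrightarrow> 0 \<le> A" "X < 1 \<longleftrightarrow> 0 < A" unfolding assms(1)[symmetric] by auto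
qed

text \<open>Read off from the signs in \<open>char_path_gap\<close>. The bound
  \<open>exp (- 2 * s)\<close> decreases in \<open>s\<close>, so a characteristic that has left
  never returns, and its position at time \<open>t\<close> tells whether it stayed inside all the
  time.\<close>

lemma abs_char_path_le_iff:
  assumes "s \<ge> 0" "\<bar>v\<bar> < 1"
  shows "\<bar>char_path (tanh q) v s\<bar> \<le> 1 \<longleftrightarrow> \<bar>v\<bar> \<le> exp (- 2 * s)"
    and "\<bar>char_path (tanh q) v s\<bar> < 1 \<longleftrightarrow> \<bar>v\<bar> < exp (- 2 * s)"
proof -
  have pos: "1 + tanh q * v > 0"
    using one_plus_mult_tanh_pos[OF abs_tanh_real_less_1] assms by simp
  have u: "1 - exp (- 2 * s) * tanh q > 0" "1 + exp (- 2 * s) * tanh q > 0"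
    using abs_exp_mult_tanh_less_1[OF assms(1), of q] by (auto simp: abs_less_iff)
  note gap = char_path_gap[OF less_imp_neq[OF pos, symmetric], of s]
  have ex: "exp (2 * s) * v \<le> 1 \<longleftrightarrow> v \<le> exp (- 2 * s)" "- (exp (2 * s) * v) \<le> 1 \<longleftrightarrow> - v \<le> exp (- 2 * s)"
    "exp (2 * s) * v < 1 \<longleftrightarrow> v < exp (- 2 * s)" "- (exp (2 * s) * v) < 1 \<longleftrightarrow> - v < exp (- 2 * s)"
    by (simp_all add: exp_minus field_simps)
  have "char_path (tanh q) v s \<le> 1 \<longleftrightarrow> 0 \<le> 1 - exp (2 * s) * v"
    "- char_path (tanh q) v s \<le> 1 \<longleftrightarrow> 0 \<le> 1 + exp (2 * s) * v"
    "char_path (tanh q) v s < 1 \<longleftrightarrow> 0 < 1 - exp (2 * s) * v"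
    "- char_path (tanh q) v s < 1 \<longleftrightarrow> 0 < 1 + exp (2 * s) * v"
    using gap_sign[OF gap(1) u(1) pos] gap_sign[of "- char_path (tanh q) v s", OF _ u(2) pos] gap(2)
    by simp_all
  then show "\<bar>char_path (tanh q) v s\<bar> \<le> 1 \<longleftrightarrow> \<bar>v\<bar> \<le> exp (- 2 * s)"
    and "\<bar>char_path (tanh q) v s\<bar> < 1 \<longleftrightarrow> \<bar>v\<bar> < exp (- 2 * s)"
    unfolding abs_le_iff abs_less_iff using ex by auto
qed

text \<open>A primitive of the Lagrangian along the characteristic. It is written with the reversed
  momentum \<open>tilt s q\<close>, which stays bounded when the path reaches an endpoint of
  \<open>[-1,1]\<close> and the momentum becomes infinite.\<close>

definition path_value :: "real \<Rightarrow> real \<Rightarrow> real \<Rightarrow> real" where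
  "path_value q v s = ent (char_path (tanh q) v s) + ln (cosh (tilt s q)) - char_path (tanh q) v s * tilt s q"

text \<open>The bound on \<open>v\<close> is not strict, so as to include characteristics that hit 1
  or -1 exactly at time \<open>t\<close>; the targets 1 and -1 need them. As
  \<open>path_value\<close> is continuous up to time \<open>t\<close>, differentiability in the
  interior is enough for the fundamental theorem.\<close>

lemma action_char_path_le:
  assumes "t > 0" and v: "\<bar>v\<bar> \<le> exp (- 2 * t)"
  shows "abs_cont_on 0 t (char_path (tanh q) v)"
    and "char_path (tanh q) v ` {0..t} \<subseteq> {-1..1}"
    and "action t (char_path (tanh q) v) \<le> ennreal (path_value q v t - path_value q v 0)"
    and "0 \<le> path_value q v t - path_value q v 0"
proof -
  let ?X = "char_path (tanh q) v"
  have "exp (- 2 * t) < 1" using assms by simp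
  then have v1: "\<bar>v\<bar> < 1" using v by linarith
  have pos: "1 + tanh q * v > 0"
    using one_plus_mult_tanh_pos[OF abs_tanh_real_less_1] v1 by simp
  show rng: "?X ` {0..t} \<subseteq> {-1..1}"
  proof (clarify)
    fix s assume s: "s \<in> {0..t}"
    have "exp (- 2 * t) \<le> exp (- 2 * s)" using s by simp
    then have "\<bar>v\<bar> \<le> exp (- 2 * s)" using v by linarith
    then have "\<bar>?X s\<bar> \<le> 1" using abs_char_path_le_iff(1)[of s v q] s v1 by simp
    then show "?X s \<in> {-1..1}" by (auto simp: abs_le_iff)
  qed
  define C where "C = 2 * (exp (2 * t) + 1) / (1 + tanh q * v)"
  have scale: "\<bar>2 * w / d\<bar> \<le> K / d" if "2 * \<bar>w\<bar> \<le> K" "d > 0" for w d K :: real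
    using that by (simp add: abs_mult divide_right_mono)
  show "abs_cont_on 0 t ?X"
  proof (rule abs_cont_on_if_Lipschitz[of C])
    show "C \<ge> 0" using pos by (simp add: C_def)
    fix x y assume xy: "0 \<le> x" "x \<le> y" "y \<le> t"
    have "norm (?X y - ?X x) \<le> C * norm (y - x)"
    proof (rule field_differentiable_bound[of "{0..t}"])
      show "(?X has_field_derivative 2 * (exp (2 * z) * v - exp (- 2 * z) * tanh q) / (1 + tanh q * v)) (at z within {0..t})" for z
        by (rule has_field_derivative_at_within[OF char_path_has_derivative])
      fix z assume z: "z \<in> {0..t}"
      have "\<bar>exp (2 * z) * v - exp (- 2 * z) * tanh q\<bar> \<le> \<bar>exp (2 * z) * v\<bar> + \<bar>exp (- 2 * z) * tanh q\<bar>" by linarith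
      also have "\<dots> \<le> exp (2 * t) * 1 + 1"
        using z v1 abs_exp_mult_tanh_less_1[of z q] unfolding abs_mult[of "exp (2 * z)"]
        by (intro add_mono mult_mono) auto
      finally have "2 * \<bar>exp (2 * z) * v - exp (- 2 * z) * tanh q\<bar> \<le> 2 * (exp (2 * t) + 1)" by simp
      then show "norm (2 * (exp (2 * z) * v - exp (- 2 * z) * tanh q) / (1 + tanh q * v)) \<le> C"
        unfolding C_def real_norm_def by (rule scale[OF _ pos])
    qed (use xy in auto)
    then show "\<bar>?X y - ?X x\<bar> \<le> C * (y - x)" using xy by simp
  qed
  define P where "P s = artanh (exp (2 * s) * v)" for s
  define D where "D s = Hp (?X s) (P s)" for s
  \<comment> \<open>The endpoints get the value 0, because at \<open>s = t\<close> the argument of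
    \<open>artanh\<close> may be 1 or -1. Two points do not affect the integral.\<close>
  define l where "l s = (if s \<in> {0<..<t} then P s * D s - H (?X s) (P s) else 0)" for s
  have in_t: "?X s = tanh (tilt s q + P s)" "(?X has_real_derivative D s) (at s)" if "s \<in> {0<..<t}" for s
    using char_path_tanh[of s v q] char_path_Hamilton[of s v q] exp_mult_less[OF v, of s] that
    by (auto simp: P_def D_def)
  have contX: "continuous_on {0..t} ?X"
    by (intro DERIV_continuous_on[OF has_field_derivative_at_within[OF char_path_has_derivative]])
  have contT: "continuous_on {0..t} (\<lambda>s. tilt s q)"
    by (rule DERIV_continuous_on[OF has_field_derivative_at_within[OF tilt_has_derivative]]) auto
  have int: "(l has_integral path_value q v t - path_value q v 0) {0..t}"
  proof (rule fundamental_theorem_of_calculus_interior)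
    show "continuous_on {0..t} (path_value q v)"
      unfolding path_value_def[abs_def]
      by (intro continuous_intros contX contT continuous_on_compose2[OF continuous_on_ent contX]) (use rng in auto)
    fix s assume s: "s \<in> {0<..<t}"
    define b where "b = tilt s q"
    have db: "((\<lambda>s. tilt s q) has_real_derivative - sinh (2 * b)) (at s)"
      using tilt_has_derivative[of s q] s by (simp add: b_def)
    note X = in_t[OF s]
    have de: "((\<lambda>s. ent (?X s)) has_real_derivative (b + P s) * D s) (at s)"
      using DERIV_chain2[OF ent_has_derivative X(2)] abs_tanh_real_less_1
      by (simp add: X(1) artanh_tanh_real b_def)
    have "(path_value q v has_real_derivative
       ((b + P s) * D s + tanh b * (- sinh (2 * b))) - (?X s * (- sinh (2 * b)) + D s * b)) (at s)"
      unfolding path_value_def[abs_def] b_def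
      by (rule DERIV_diff[OF DERIV_add[OF de DERIV_chain2[OF ln_cosh_has_derivative db]] DERIV_mult'[OF X(2) db], unfolded b_def])
    also have "((b + P s) * D s + tanh b * (- sinh (2 * b))) - (?X s * (- sinh (2 * b)) + D s * b)
       = P s * D s - H (?X s) b"
      using tanh_mult_sinh_double[of b] by (simp add: H_cosh algebra_simps)
    \<comment> \<open>Reversibility replaces the reversed momentum by the momentum, and the
      integrand becomes the Lagrangian.\<close>
    also have "H (?X s) b = H (?X s) (P s)" unfolding X(1) b_def by (rule H_tanh_symmetric)
    finally show "(path_value q v has_vector_derivative l s) (at s)"
      using s by (simp add: l_def has_real_derivative_iff_has_vector_derivative)
  qed (use assms in auto)
  have l0: "0 \<le> l s" for s
    using Legendre_Hp_nonneg[of "P s" "tilt s q + P s"] in_t(1)[of s] by (simp add: l_def D_def)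
  show "0 \<le> path_value q v t - path_value q v 0"
    using has_integral_nonneg[OF int] l0 by simp
  have "action t ?X = (\<integral>\<^sup>+ s. ennreal (l s) * indicator {0..t} s \<partial>lborel)"
    unfolding action_def
  proof (rule nn_integral_cong_AE)
    have "AE s in lborel. s \<noteq> 0" "AE s in lborel. s \<noteq> t" by (rule AE_lborel_singleton)+
    then show "AE s in lborel. indicator {0..t} s * Lag (?X s) (vector_derivative ?X (at s)) =
        ennreal (l s) * indicator {0..t} s"
    proof eventually_elim
      case (elim s)
      show ?case
      proof (cases "s \<in> {0..t}")
        case True
        then have s: "s \<in> {0<..<t}" using elim by auto
        have "vector_derivative ?X (at s) = Hp (?X s) (P s)"
          using in_t(2)[OF s] unfolding D_def has_real_derivative_iff_has_vector_derivative
          by (rule vector_derivative_at)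
        then have "Lag (?X s) (vector_derivative ?X (at s)) = ennreal (l s)"
          using Lag_Hp[of "tilt s q + P s" "P s"] s in_t(1)[OF s] by (simp add: l_def D_def)
        then show ?thesis using True by simp
      qed simp
    qed
  qed
  also have "\<dots> = ennreal (path_value q v t - path_value q v 0)"
    by (rule nn_integral_has_integral_lebesgue'[OF l0 int])
  finally show "action t ?X \<le> ennreal (path_value q v t - path_value q v 0)" by simp
qed

text \<open>For \<open>\<alpha> > 1\<close> the second derivative of \<open>I0\<close>, which is
  \<open>1 / (1 - y^2) - \<alpha>\<close>, is negative exactly for \<open>|y|\<close> below this
  number.\<close>

definition inner_radius :: "real \<Rightarrow> real" where
  "inner_radius \<alpha> = sqrt (1 - 1 / \<alpha>)"

lemma inner_radius_bounds: "\<alpha> > 1 \<Longrightarrow> 0 < inner_radius \<alpha> \<and> inner_radius \<alpha> < 1"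
  by (simp add: inner_radius_def)

lemma inner_iff:
  assumes "\<alpha> > 1"
  shows "\<alpha> * (1 - y\<^sup>2) > 1 \<longleftrightarrow> \<bar>y\<bar> < inner_radius \<alpha>"
proof -
  have "\<alpha> * (1 - y\<^sup>2) > 1 \<longleftrightarrow> y\<^sup>2 < 1 - 1 / \<alpha>" using assms by (simp add: field_simps)
  also have "\<dots> \<longleftrightarrow> y\<^sup>2 < (inner_radius \<alpha>)\<^sup>2" using assms by (simp add: inner_radius_def)
  also have "\<dots> \<longleftrightarrow> \<bar>y\<bar> < \<bar>inner_radius \<alpha>\<bar>" using abs_le_square_iff[of "inner_radius \<alpha>" y] by auto
  finally show ?thesis using inner_radius_bounds[OF assms] by simp
qed

section \<open>The value function as a minimum of the dual functional\<close>

context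
  fixes \<alpha> \<theta> :: real
begin

abbreviation fld :: "real \<Rightarrow> real" where "fld y \<equiv> \<alpha> * y + \<theta>"

text \<open>Characteristics satisfy \<open>X'' = 4 * X\<close>, so this is
  \<open>cosh (2 * t) * X 0 + sinh (2 * t) * X' 0 / 2\<close>. In this form it is smooth in
  \<open>y\<close> up to and beyond 1 and -1, where the initial momentum is infinite.\<close>

definition flow :: "real \<Rightarrow> real \<Rightarrow> real" where
  "flow t y = cosh (2 * t) * y + sinh (2 * t) * (y * cosh (2 * fld y) - sinh (2 * fld y))"

definition Psi :: "real \<Rightarrow> real \<Rightarrow> real \<Rightarrow> real" where
  "Psi t b y = \<alpha> * y\<^sup>2 / 2 - ln (cosh (fld y)) + ln (cosh (tilt t (fld y))) - b * tilt t (fld y)"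

definition val :: "real \<Rightarrow> real \<Rightarrow> real \<Rightarrow> real" where
  "val t b y = ent b + Cconst \<alpha> \<theta> + Psi t b y"

text \<open>At time 0 the reversed momentum is \<open>artanh y\<close> minus the derivative of
  \<open>I0\<close> at \<open>y\<close>, which is \<open>fld y\<close>; this fixes both parameters
  of the path.\<close>

lemma flow_char_path:
  assumes "\<bar>y\<bar> < 1"
  shows "flow t y = char_path (tanh (fld y)) (tanh (artanh y - fld y)) t"
proof -
  define q where "q = fld y"
  define p where "p = artanh y - q"
  have y: "y = tanh (q + p)" using assms by (simp add: p_def)
  have c: "cosh (q + p) = cosh q * cosh p * (1 + tanh q * tanh p)" by (rule cosh_add_tanh)
  have "sinh (p - q) = sinh (q + p) * cosh (2 * q) - cosh (q + p) * sinh (2 * q)"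
    using sinh_diff[of "q + p" "2 * q"] by (simp add: algebra_simps)
  then have "y * cosh (2 * q) - sinh (2 * q) = sinh (p - q) / cosh (q + p)"
    unfolding y by (simp add: tanh_def field_simps)
  also have "\<dots> = (tanh p - tanh q) / (1 + tanh q * tanh p)"
    unfolding c by (simp add: sinh_diff tanh_def field_simps)
  finally have g: "y * cosh (2 * q) - sinh (2 * q) = (tanh p - tanh q) / (1 + tanh q * tanh p)" .
  have y2: "y = (tanh q + tanh p) / (1 + tanh q * tanh p)" unfolding y by (rule tanh_add_real)
  have "flow t y = cosh (2 * t) * ((tanh q + tanh p) / (1 + tanh q * tanh p))
       + sinh (2 * t) * ((tanh p - tanh q) / (1 + tanh q * tanh p))"
    unfolding flow_def q_def[symmetric] g using y2 by simp
  also have "\<dots> = ((cosh (2 * t) - sinh (2 * t)) * tanh q + (cosh (2 * t) + sinh (2 * t)) * tanh p) / (1 + tanh q * tanh p)"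
    by (simp add: algebra_simps add_divide_distrib diff_divide_distrib)
  finally show ?thesis
    by (simp add: char_path_def cosh_minus_sinh cosh_plus_sinh q_def p_def)
qed

lemma abs_flow_le_iff:
  assumes "\<bar>y\<bar> < 1" "t \<ge> 0"
  shows "\<bar>flow t y\<bar> \<le> 1 \<longleftrightarrow> \<bar>tanh (artanh y - fld y)\<bar> \<le> exp (- 2 * t)"
    and "\<bar>flow t y\<bar> < 1 \<longleftrightarrow> \<bar>tanh (artanh y - fld y)\<bar> < exp (- 2 * t)"
  unfolding flow_char_path[OF assms(1)]
  by (rule abs_char_path_le_iff[OF assms(2) abs_tanh_real_less_1])+

lemma It_le_val:
  assumes "t > 0" "\<bar>y\<bar> < 1" "\<bar>flow t y\<bar> \<le> 1"
  shows "It \<alpha> \<theta> t (flow t y) \<le> ennreal (val t (flow t y) y)"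
    and "0 \<le> val t (flow t y) y"
proof -
  define q where "q = fld y"
  define v where "v = tanh (artanh y - q)"
  define b where "b = flow t y"
  have v: "\<bar>v\<bar> \<le> exp (- 2 * t)"
    using abs_flow_le_iff(1)[OF assms(2), of t] assms by (simp add: v_def q_def)
  let ?X = "char_path (tanh q) v"
  note A = action_char_path_le[OF \<open>t > 0\<close> v, of q]
  have X0: "?X 0 = y"
    using tanh_add_real[of q "artanh y - q"] assms(2) by (simp add: char_path_def v_def)
  have Xt: "?X t = b" using flow_char_path[OF assms(2), of t] by (simp add: b_def q_def v_def)
  have y: "y \<in> {-1..1}" using assms by auto
  have eq: "I0 \<alpha> \<theta> y + (path_value q v t - path_value q v 0) = val t b y"
    unfolding path_value_def X0 Xt val_def Psi_def q_def[symmetric] I0_ent tilt_0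
    by (simp add: q_def algebra_simps power2_eq_square)
  have "S t y b \<le> action t ?X"
    unfolding S_def using A(1,2) X0 Xt by (intro INF_lower) auto
  also note A(3)
  finally have "ennreal (I0 \<alpha> \<theta> y) + S t y b \<le> ennreal (I0 \<alpha> \<theta> y) + ennreal (path_value q v t - path_value q v 0)"
    by (rule add_left_mono)
  also have "\<dots> = ennreal (val t b y)"
    using I0_nonneg[OF y, of \<alpha> \<theta>] A(4) eq by (simp flip: ennreal_plus)
  finally show "It \<alpha> \<theta> t b \<le> ennreal (val t b y)"
    unfolding It_def using y by (intro INF_lower2)
  show "0 \<le> val t b y" using I0_nonneg[OF y, of \<alpha> \<theta>] A(4) eq by linarith
qed

text \<open>The final momentum \<open>q'\<close> complements the tilted field to
  \<open>artanh b\<close>. As tilting multiplies every \<open>tanh\<close> by the same number,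
  \<open>cosh (q' + tilt t q)\<close> and \<open>cosh (q + tilt t q')\<close> share the factor
  \<open>1 + exp (- 2 * t) * tanh q * tanh q'\<close>. It cancels, and what remains is the
  Fenchel-Young inequality for \<open>ent\<close> at \<open>a\<close>.\<close>

lemma calibrated_bound_ge_val:
  fixes t b a :: real
  assumes t: "t \<ge> 0" and b: "\<bar>b\<bar> < 1" and a: "a \<in> {-1..1}"
  defines "q' \<equiv> artanh b - tilt t (fld a)"
  shows "val t b a \<le> I0 \<alpha> \<theta> a + (q' * b - ln (cosh q') - (tilt t q' * a - ln (cosh (tilt t q'))))"
proof -
  define q where "q = fld a"
  have bq: "b = tanh (q' + tilt t q)" using b by (simp add: q'_def q_def)
  have e1: "ln (cosh (q' + tilt t q)) = ln (cosh q') + ln (cosh (tilt t q)) + ln (1 + exp (- 2 * t) * (tanh q * tanh q'))"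
    using ln_cosh_add[of q' "tilt t q"] t by (simp add: tanh_tilt mult_ac)
  have e2: "ln (cosh (q + tilt t q')) = ln (cosh q) + ln (cosh (tilt t q')) + ln (1 + exp (- 2 * t) * (tanh q * tanh q'))"
    using ln_cosh_add[of q "tilt t q'"] t by (simp add: tanh_tilt mult_ac)
  have e3: "ent b = (q' + tilt t q) * b - ln (cosh (q' + tilt t q))"
    using ent_tanh[of "q' + tilt t q"] bq by simp
  have e4: "a * (q + tilt t q') - ln (cosh (q + tilt t q')) \<le> ent a" by (rule ent_Fenchel_Young[OF a])
  have e5: "a * q = \<alpha> * a\<^sup>2 + \<theta> * a" by (simp add: q_def algebra_simps power2_eq_square)
  show ?thesis
    using e4 unfolding val_def Psi_def q_def[symmetric] I0_ent e3 e1 e2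
    by (simp add: algebra_simps; use e5 in \<open>simp add: algebra_simps\<close>)
qed

text \<open>Truncation at 0 can only enlarge the right-hand side. This is applied to
  \<open>val t b a - I0 \<alpha> \<theta> a\<close>, whose sign is not known.\<close>

lemma ennreal_add_le: "ennreal (x + y) \<le> ennreal x + ennreal y"
proof (cases "0 \<le> x \<and> 0 \<le> y")
  case True then show ?thesis by simp
next
  case False
  then have "ennreal (x + y) \<le> ennreal x \<or> ennreal (x + y) \<le> ennreal y" by (auto intro: ennreal_leI)
  then show ?thesis by (metis add.commute add.right_neutral add_left_mono order_trans zero_le)
qed

text \<open>For \<open>b\<close> equal to 1 or -1 the momentum \<open>artanh b\<close> is infinite.
  Therefore a path to \<open>b\<close> is calibrated with the momentum that belongs to the target
  \<open>b * s\<close>. The loss is at most \<open>(1 - s) * |q|\<close>, and \<open>s\<close> tends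
  to 1 from the left.\<close>

lemma It_ge:
  assumes t: "t > 0" and b: "b \<in> {-1..1}" and E: "\<And>a. a \<in> {-1..1} \<Longrightarrow> E \<le> val t b a"
  shows "ennreal E \<le> It \<alpha> \<theta> t b"
  unfolding It_def
proof (rule INF_greatest)
  fix a :: real assume a: "a \<in> {-1..1}"
  have "ennreal (val t b a - I0 \<alpha> \<theta> a) \<le> action t \<gamma>"
    if g: "abs_cont_on 0 t \<gamma>" "\<gamma> ` {0..t} \<subseteq> {-1..1}" "\<gamma> 0 = a" "\<gamma> t = b" for \<gamma>
  proof -
    define q where "q = fld a"
    have "eventually (\<lambda>s. ennreal (val t (b * s) a - (1 - s) * \<bar>q\<bar> - I0 \<alpha> \<theta> a) \<le> action t \<gamma>) (at_left 1)"
    proof (rule eventually_at_leftI[of 0])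
      fix s :: real assume s: "s \<in> {0<..<1}"
      have "\<bar>b\<bar> * s \<le> 1 * s" using s b by (intro mult_right_mono) auto
      also have "1 * s < 1" using s by simp
      finally have bs: "\<bar>b * s\<bar> < 1" using s by (simp add: abs_mult)
      define q' where "q' = artanh (b * s) - tilt t q"
      \<comment> \<open>Since \<open>artanh (b * s)\<close> may grow without bound as
        \<open>s\<close> tends to 1, \<open>b * q'\<close> is only estimated from below; the
        unbounded part has the favourable sign.\<close>
      have "0 \<le> b * artanh (b * s)"
      proof (cases "b \<ge> 0")
        case True
        then have "tanh 0 \<le> tanh (artanh (b * s))" using bs s by simp
        then show ?thesis using True by (simp del: tanh_artanh_real)
      next
        case False
        then have "tanh (artanh (b * s)) \<le> tanh 0" using bs s by (simp add: mult_nonpos_nonneg)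
        then show ?thesis using False by (simp del: tanh_artanh_real add: mult_nonpos_nonpos)
      qed
      moreover have "b * tilt t q \<le> \<bar>q\<bar>"
      proof -
        have "\<bar>b\<bar> * \<bar>tilt t q\<bar> \<le> 1 * \<bar>q\<bar>" using b abs_tilt_le[of t q] t by (intro mult_mono) auto
        then show ?thesis by (simp flip: abs_mult)
      qed
      ultimately have "b * q' \<ge> - \<bar>q\<bar>" by (simp add: q'_def right_diff_distrib)
      then have "(1 - s) * (b * q') \<ge> (1 - s) * (- \<bar>q\<bar>)" using s by (intro mult_left_mono) auto
      then have "q' * b \<ge> q' * (b * s) - (1 - s) * \<bar>q\<bar>" by (simp add: algebra_simps)
      moreover have "val t (b * s) a \<le> I0 \<alpha> \<theta> a + (q' * (b * s) - ln (cosh q') - (tilt t q' * a - ln (cosh (tilt t q'))))"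
        using calibrated_bound_ge_val[OF less_imp_le[OF t] bs a] by (simp add: q'_def q_def)
      ultimately have "val t (b * s) a - (1 - s) * \<bar>q\<bar>
          \<le> I0 \<alpha> \<theta> a + (q' * b - ln (cosh q') - (tilt t q' * a - ln (cosh (tilt t q'))))" by linarith
      then have "ennreal (val t (b * s) a - (1 - s) * \<bar>q\<bar> - I0 \<alpha> \<theta> a)
          \<le> ennreal (q' * b - ln (cosh q') - (tilt t q' * a - ln (cosh (tilt t q'))))" by (intro ennreal_leI) simp
      also have "\<dots> \<le> action t \<gamma>"
        using action_ge[OF t g(1,2), of q'] g(3,4) by simp
      finally show "ennreal (val t (b * s) a - (1 - s) * \<bar>q\<bar> - I0 \<alpha> \<theta> a) \<le> action t \<gamma>" .
    qed simp
    moreover have "((\<lambda>s. ennreal (val t (b * s) a - (1 - s) * \<bar>q\<bar> - I0 \<alpha> \<theta> a)) \<longlongrightarrow> ennreal (val t b a - I0 \<alpha> \<theta> a)) (at_left 1)"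
    proof (rule tendsto_ennrealI)
      have "continuous_on {0..1} (\<lambda>s. val t (b * s) a - (1 - s) * \<bar>q\<bar> - I0 \<alpha> \<theta> a)"
      proof -
        have "b * s \<in> {-1..1}" if "s \<in> {0..1}" for s
        proof -
          have "\<bar>b\<bar> * \<bar>s\<bar> \<le> 1 * 1" using that b by (intro mult_mono) auto
          then show ?thesis by (auto simp: abs_le_iff simp flip: abs_mult)
        qed
        then show ?thesis
          unfolding val_def Psi_def
          by (intro continuous_intros continuous_on_compose2[OF continuous_on_ent]) auto
      qed
      from continuous_on_Icc_at_leftD[OF this]
      show "((\<lambda>s. val t (b * s) a - (1 - s) * \<bar>q\<bar> - I0 \<alpha> \<theta> a) \<longlongrightarrow> val t b a - I0 \<alpha> \<theta> a) (at_left 1)" by simp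
    qed
    ultimately show ?thesis by (intro tendsto_upperbound[where F = "at_left (1::real)"]) auto
  qed
  then have "ennreal (val t b a - I0 \<alpha> \<theta> a) \<le> S t a b"
    unfolding S_def by (intro INF_greatest) auto
  then have "ennreal (I0 \<alpha> \<theta> a) + ennreal (val t b a - I0 \<alpha> \<theta> a) \<le> ennreal (I0 \<alpha> \<theta> a) + S t a b"
    by (rule add_left_mono)
  moreover have "ennreal (val t b a) \<le> ennreal (I0 \<alpha> \<theta> a) + ennreal (val t b a - I0 \<alpha> \<theta> a)"
    using ennreal_add_le[of "I0 \<alpha> \<theta> a" "val t b a - I0 \<alpha> \<theta> a"] by simp
  moreover have "ennreal E \<le> ennreal (val t b a)" by (rule ennreal_leI[OF E[OF a]])
  ultimately show "ennreal E \<le> ennreal (I0 \<alpha> \<theta> a) + S t a b" by order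
qed

section \<open>Minimisers of the dual functional\<close>

text \<open>Half the initial rate at which neighbouring characteristics separate. They focus when
  \<open>tanh (2 * t) * stretch y = - 1\<close>, which happens at a finite time only if
  \<open>stretch y < - 1\<close>.\<close>

definition stretch :: "real \<Rightarrow> real" where
  "stretch y = cosh (2 * fld y) + 2 * \<alpha> * y * sinh (2 * fld y) - 2 * \<alpha> * cosh (2 * fld y)"

abbreviation slope :: "real \<Rightarrow> real \<Rightarrow> real" where
  "slope t y \<equiv> cosh (2 * t) + sinh (2 * t) * stretch y"

lemma flow_has_derivative:
  "(flow t has_real_derivative slope t y) (at y)"
  unfolding flow_def[abs_def] stretch_def
  by (auto intro!: derivative_eq_intros simp: algebra_simps)

lemma continuous_on_flow: "continuous_on A (flow t)"
  by (intro DERIV_continuous_on[OF has_field_derivative_at_within[OF flow_has_derivative]])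

text \<open>The formula for the flow pushes both endpoints outwards. This yields solutions of
  \<open>flow t y = b\<close> by the intermediate value theorem and excludes 1 and -1 as such
  solutions.\<close>

lemma flow_endpoints:
  assumes "t > 0"
  shows "flow t 1 > 1" "flow t (- 1) < - 1"
proof -
  have s: "sinh (2 * t) > 0" and c: "cosh (2 * t) \<ge> 1" using assms by (simp_all add: cosh_real_ge_1)
  have "cosh (2 * (\<alpha> + \<theta>)) - sinh (2 * (\<alpha> + \<theta>)) > 0" unfolding cosh_minus_sinh by simp
  from mult_pos_pos[OF s this] show "flow t 1 > 1" using c by (simp add: flow_def)
  have "cosh (2 * (\<theta> - \<alpha>)) + sinh (2 * (\<theta> - \<alpha>)) > 0" unfolding cosh_plus_sinh by simp
  from mult_pos_pos[OF s this] show "flow t (- 1) < - 1" using c by (simp add: flow_def algebra_simps)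
qed

lemma tilt_has_derivative_arg:
  assumes "t \<ge> 0"
  shows "((\<lambda>q. tilt t q) has_real_derivative
     exp (- 2 * t) * (1 - (tanh q)\<^sup>2) / (1 - (exp (- 2 * t) * tanh q)\<^sup>2)) (at q)"
proof -
  have "((\<lambda>q. exp (- 2 * t) * tanh q) has_real_derivative exp (- 2 * t) * (1 - (tanh q)\<^sup>2)) (at q)"
    by (auto intro!: derivative_eq_intros)
  from DERIV_chain2[OF artanh_real_has_field_derivative[OF abs_exp_mult_tanh_less_1[OF assms]] this]
  show ?thesis unfolding tilt_def[abs_def] by simp
qed

definition Psi_weight :: "real \<Rightarrow> real \<Rightarrow> real" where
  "Psi_weight t q = exp (- 2 * t) * (1 - (tanh q)\<^sup>2) / (1 - (exp (- 2 * t) * tanh q)\<^sup>2)"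

lemma Psi_weight_pos:
  assumes "t \<ge> 0" shows "Psi_weight t q > 0"
proof -
  have "(tanh q)\<^sup>2 < 1" "(exp (- 2 * t) * tanh q)\<^sup>2 < 1"
    unfolding abs_square_less_1 using abs_tanh_real_less_1 abs_exp_mult_tanh_less_1[OF assms] by auto
  then show ?thesis by (simp add: Psi_weight_def)
qed

text \<open>The formula for the flow in terms of \<open>m\<close> and \<open>u\<close>, with all
  denominators cleared, for comparison with the derivative of \<open>Psi\<close>.\<close>

lemma flow_eq_tanh:
  fixes t y :: real
  defines "u \<equiv> tanh (fld y)" and "m \<equiv> exp (- 2 * t)"
  shows "m * (1 - u\<^sup>2) * flow t y = y * (1 - m\<^sup>2 * u\<^sup>2) - u * (1 - m\<^sup>2)"
proof -
  define q where "q = fld y"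
  have c2: "(cosh q)\<^sup>2 * (1 - u\<^sup>2) = 1"
    by (simp add: u_def q_def[symmetric] tanh_def power_divide right_diff_distrib hyperbolic_pythagoras)
  have su: "sinh q = u * cosh q" by (simp add: u_def q_def[symmetric] tanh_def)
  have "(1 - u\<^sup>2) * cosh (2 * q) = (cosh q)\<^sup>2 * (1 - u\<^sup>2) * (1 + u\<^sup>2)"
    unfolding cosh_double su by (simp add: power_mult_distrib algebra_simps)
  then have C: "(1 - u\<^sup>2) * cosh (2 * q) = 1 + u\<^sup>2" using c2 by simp
  have "(1 - u\<^sup>2) * sinh (2 * q) = (cosh q)\<^sup>2 * (1 - u\<^sup>2) * (2 * u)"
    unfolding sinh_double su by (simp add: power2_eq_square algebra_simps)
  then have Sh: "(1 - u\<^sup>2) * sinh (2 * q) = 2 * u" using c2 by simp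
  have "m * exp (2 * t) = 1" unfolding m_def by (simp flip: exp_add)
  then have ct: "m * cosh (2 * t) = (1 + m\<^sup>2) / 2" and st: "m * sinh (2 * t) = (1 - m\<^sup>2) / 2"
    by (simp_all add: cosh_field_def sinh_field_def m_def[symmetric] power2_eq_square field_simps)
      (simp_all add: m_def)
  have "m * (1 - u\<^sup>2) * flow t y = m * cosh (2 * t) * ((1 - u\<^sup>2) * y)
      + m * sinh (2 * t) * (y * ((1 - u\<^sup>2) * cosh (2 * q)) - (1 - u\<^sup>2) * sinh (2 * q))"
    by (simp add: flow_def q_def algebra_simps)
  also have "\<dots> = (1 + m\<^sup>2) / 2 * ((1 - u\<^sup>2) * y) + (1 - m\<^sup>2) / 2 * (y * (1 + u\<^sup>2) - 2 * u)"
    unfolding ct st C Sh ..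
  also have "\<dots> = y * (1 - m\<^sup>2 * u\<^sup>2) - u * (1 - m\<^sup>2)"
    by (simp add: field_simps)
  finally show ?thesis .
qed

text \<open>The weight is the derivative of \<open>tilt t\<close> and hence positive. So for
  \<open>\<alpha> > 0\<close> the sign of \<open>flow t y - b\<close> decides whether
  \<open>Psi\<close> rises or falls, and a critical point at which the flow decreases is a local
  maximum.\<close>

lemma Psi_has_derivative:
  assumes "t \<ge> 0"
  shows "(Psi t b has_real_derivative
           \<alpha> * Psi_weight t (fld y) * (flow t y - b)) (at y)"
proof -
  define q where "q = fld y"
  define u where "u = tanh q"
  define m where "m = exp (- 2 * t)"
  define k where "k = Psi_weight t q"
  have dq: "((\<lambda>y. fld y) has_real_derivative \<alpha>) (at y)"
    by (auto intro!: derivative_eq_intros)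
  have dT: "((\<lambda>y. tilt t (fld y)) has_real_derivative k * \<alpha>) (at y)"
    unfolding k_def q_def Psi_weight_def by (rule DERIV_chain2[OF tilt_has_derivative_arg[OF assms] dq])
  have d2: "((\<lambda>y. \<alpha> * y\<^sup>2 / 2) has_real_derivative \<alpha> * y) (at y)"
    by (auto intro!: derivative_eq_intros)
  have "(Psi t b has_real_derivative
      \<alpha> * y - tanh (fld y) * \<alpha> + tanh (tilt t (fld y)) * (k * \<alpha>) - b * (k * \<alpha>)) (at y)"
    unfolding Psi_def[abs_def]
    by (rule DERIV_diff[OF DERIV_add[OF DERIV_diff[OF d2 DERIV_chain2[OF ln_cosh_has_derivative dq]]
          DERIV_chain2[OF ln_cosh_has_derivative dT]] DERIV_cmult[OF dT]])
  also have "\<alpha> * y - tanh (fld y) * \<alpha> + tanh (tilt t (fld y)) * (k * \<alpha>) - b * (k * \<alpha>)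
      = \<alpha> * (y - u + m * u * k - b * k)"
    unfolding q_def[symmetric] u_def m_def using tanh_tilt[OF assms, of q] by (simp add: algebra_simps)
  also have "y - u + m * u * k - b * k = k * (flow t y - b)"
  proof -
    have pos: "1 - m\<^sup>2 * u\<^sup>2 > 0"
      using abs_exp_mult_tanh_less_1[OF assms, of q] unfolding abs_square_less_1[symmetric]
      by (simp add: m_def u_def power_mult_distrib)
    have kk: "k * (1 - m\<^sup>2 * u\<^sup>2) = m * (1 - u\<^sup>2)"
      unfolding k_def Psi_weight_def m_def[symmetric] u_def[symmetric]
      using pos by (simp add: power_mult_distrib)
    have "(k * flow t y) * (1 - m\<^sup>2 * u\<^sup>2) = m * (1 - u\<^sup>2) * flow t y"
      unfolding kk[symmetric] by simp
    also have "\<dots> = y * (1 - m\<^sup>2 * u\<^sup>2) - u * (1 - m\<^sup>2)"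
      unfolding m_def u_def q_def by (rule flow_eq_tanh)
    also have "\<dots> = (y - u) * (1 - m\<^sup>2 * u\<^sup>2) + m * u * (m * (1 - u\<^sup>2))"
      by (simp add: power2_eq_square algebra_simps)
    also have "\<dots> = (y - u + m * u * k) * (1 - m\<^sup>2 * u\<^sup>2)"
      unfolding kk[symmetric] by (simp add: algebra_simps)
    finally have "k * flow t y = y - u + m * u * k" using pos by simp
    then show ?thesis by (simp add: algebra_simps)
  qed
  finally show ?thesis by (simp add: k_def q_def mult.assoc)
qed

lemma continuous_on_Psi: "t \<ge> 0 \<Longrightarrow> continuous_on A (Psi t b)"
  by (intro DERIV_continuous_on[OF has_field_derivative_at_within[OF Psi_has_derivative]])

text \<open>At 1 and -1 the functional decreases into the interval by \<open>flow_endpoints\<close>,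
  so minimisers are interior and critical.\<close>

lemma Psi_minimizer_flow:
  assumes t: "t > 0" and \<alpha>: "\<alpha> > 0" and b: "b \<in> {-1..1}" and y: "y \<in> {-1..1}"
    and min: "\<And>a. a \<in> {-1..1} \<Longrightarrow> Psi t b y \<le> Psi t b a"
  shows "\<bar>y\<bar> < 1" "flow t y = b"
proof -
  note D = Psi_has_derivative[OF less_imp_le[OF t], of b]
  have w: "\<alpha> * Psi_weight t q > 0" for q using \<alpha> Psi_weight_pos[of t q] t by simp
  have "y \<noteq> 1"
  proof
    assume y1: "y = 1"
    have "\<alpha> * Psi_weight t (fld y) * (flow t y - b) > 0"
      by (rule mult_pos_pos[OF w]) (use flow_endpoints(1)[OF t] b y1 in simp)
    from DERIV_pos_inc_left[OF D this] obtain d where d: "d > 0" "\<And>h. 0 < h \<Longrightarrow> h < d \<Longrightarrow> Psi t b (y - h) < Psi t b y" by blast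
    then have "Psi t b (y - min (d/2) 1) < Psi t b y" by simp
    then show False using min[of "y - min (d/2) 1"] d(1) y1 by (simp add: min_def split: if_splits)
  qed
  moreover have "y \<noteq> - 1"
  proof
    assume y1: "y = - 1"
    have "\<alpha> * Psi_weight t (fld y) * (flow t y - b) < 0"
      by (rule mult_pos_neg[OF w]) (use flow_endpoints(2)[OF t] b y1 in simp)
    from DERIV_neg_dec_right[OF D this] obtain d where d: "d > 0" "\<And>h. 0 < h \<Longrightarrow> h < d \<Longrightarrow> Psi t b (y + h) < Psi t b y" by blast
    then have "Psi t b (y + min (d/2) 1) < Psi t b y" by simp
    then show False using min[of "y + min (d/2) 1"] d(1) y1 by (simp add: min_def split: if_splits)
  qed
  ultimately show y1: "\<bar>y\<bar> < 1" using y by (auto simp: abs_less_iff)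
  have "\<alpha> * Psi_weight t (fld y) * (flow t y - b) = 0"
  proof (rule DERIV_local_min[OF D])
    show "0 < 1 - \<bar>y\<bar>" using y1 by simp
    show "\<forall>z. \<bar>y - z\<bar> < 1 - \<bar>y\<bar> \<longrightarrow> Psi t b y \<le> Psi t b z"
      by (intro allI impI min) auto
  qed
  then show "flow t y = b" using w[of "fld y"] by auto
qed

lemma ex_Psi_minimizer:
  assumes t: "t > 0" and \<alpha>: "\<alpha> \<ge> 0" and b: "b \<in> {-1..1}"
  shows "\<exists>y. \<bar>y\<bar> < 1 \<and> flow t y = b \<and> (\<forall>a\<in>{-1..1}. Psi t b y \<le> Psi t b a)"
proof (cases "\<alpha> = 0")
  case True
  \<comment> \<open>For \<open>\<alpha> = 0\<close> the functional does not depend on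
    \<open>y\<close>, so any start of a characteristic that ends in \<open>b\<close> is a
    minimiser.\<close>
  obtain y where y: "y \<in> {-1..1}" "flow t y = b"
    using IVT'[OF _ _ _ continuous_on_flow, of t "-1" b 1] flow_endpoints[OF t] b by auto
  moreover have "y \<noteq> 1" "y \<noteq> - 1" using y flow_endpoints[OF t] b by auto
  ultimately have "\<bar>y\<bar> < 1" by (auto simp: abs_less_iff less_le)
  moreover have "Psi t b y \<le> Psi t b a" for a unfolding Psi_def by (simp add: True)
  ultimately show ?thesis using y(2) by blast
next
  case False
  obtain y where y: "y \<in> {-1..1}" "\<forall>a\<in>{-1..1}. Psi t b y \<le> Psi t b a"
    using continuous_attains_inf[OF _ _ continuous_on_Psi, of "{-1..1}" t b] t by auto
  then show ?thesis using Psi_minimizer_flow[of t b y] t b False \<alpha> by (intro exI[of _ y]) auto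
qed

text \<open>The lower bound over all starting points and the cost of one characteristic meet,
  because \<open>y\<close> minimises and its characteristic ends in \<open>b\<close>.\<close>

lemma It_eq_val:
  assumes t: "t > 0" and b: "b \<in> {-1..1}" and y: "\<bar>y\<bar> < 1" "flow t y = b"
    and min: "\<And>a. a \<in> {-1..1} \<Longrightarrow> Psi t b y \<le> Psi t b a"
  shows "It \<alpha> \<theta> t b = ennreal (val t b y)" "0 \<le> val t b y"
proof -
  have "\<bar>flow t y\<bar> \<le> 1" using b y by (auto simp: abs_le_iff)
  note le = It_le_val[OF t y(1) this]
  have "ennreal (val t b y) \<le> It \<alpha> \<theta> t b"
    by (rule It_ge[OF t b]) (simp add: val_def min)
  with le show "It \<alpha> \<theta> t b = ennreal (val t b y)" "0 \<le> val t b y" using y(2) by auto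
qed

section \<open>Smoothness while characteristics do not cross\<close>

lemma Psi_shift: "Psi t b' y = Psi t b y - (b' - b) * tilt t (fld y)"
  by (simp add: Psi_def algebra_simps)

text \<open>The sign of \<open>f'\<close> is known only while \<open>f\<close> is in the window.
  Just after the last point with \<open>f \<ge> b\<close> the values would lie between -1 and
  \<open>b\<close>, hence in the window, where \<open>f\<close> cannot decrease.\<close>

lemma window_monotone_right:
  fixes f :: "real \<Rightarrow> real"
  assumes d: "\<And>z. (f has_real_derivative f' z) (at z)" and le: "y1 \<le> y2"
    and b: "\<bar>b\<bar> < 1" "f y1 \<ge> b"
    and mono: "\<And>z. z \<in> {y1..y2} \<Longrightarrow> \<bar>f z\<bar> < 1 \<Longrightarrow> f' z \<ge> 0"
  shows "f y2 \<ge> b"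
proof (rule ccontr)
  assume "\<not> f y2 \<ge> b"
  then have f2: "f y2 < b" by simp
  have cont: "continuous_on A f" for A
    by (intro DERIV_continuous_on[OF has_field_derivative_at_within[OF d]])
  define Z where "Z = {z\<in>{y1..y2}. b \<le> f z}"
  have "closed Z" unfolding Z_def by (intro continuous_on_closed_Collect_le continuous_intros cont)
  moreover have ne: "Z \<noteq> {}" "bdd_above Z" using le b by (auto simp: Z_def)
  ultimately have "Sup Z \<in> Z" by (intro closed_contains_Sup)
  define s where "s = Sup Z"
  have s: "y1 \<le> s" "s \<le> y2" "b \<le> f s" using \<open>Sup Z \<in> Z\<close> by (auto simp: Z_def s_def)
  have right: "f z < b" if "s < z" "z \<le> y2" for z
  proof (rule ccontr)
    assume "\<not> f z < b"
    then have "z \<in> Z" using that s by (auto simp: Z_def)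
    then show False using cSup_upper[OF _ ne(2), of z] that by (simp add: s_def)
  qed
  have "s < y2" using s f2 by (cases "s = y2") auto
  have "isCont f s" using d DERIV_isCont by blast
  then have "eventually (\<lambda>z. - 1 < f z) (at s)"
    using order_tendstoD(1)[of f "f s" "at s" "-1"] s b by (simp add: isCont_def)
  then obtain \<delta> where \<delta>: "\<delta> > 0" "\<And>z. z \<noteq> s \<Longrightarrow> \<bar>z - s\<bar> < \<delta> \<Longrightarrow> - 1 < f z"
    by (auto simp: eventually_at dist_real_def)
  define z where "z = min y2 (s + \<delta> / 2)"
  have z: "s < z" "z \<le> y2" using \<open>s < y2\<close> \<delta> by (auto simp: z_def)
  obtain x where x: "s < x" "x < z" "f z - f s = (z - s) * f' x"
    using MVT2[OF z(1), of f f'] d by auto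
  have "x \<noteq> s" "\<bar>x - s\<bar> < \<delta>" using x z \<delta>(1) by (auto simp: z_def)
  then have "\<bar>f x\<bar> < 1" using \<delta>(2)[of x] right[of x] x z b by auto
  then have "f' x \<ge> 0" using mono[of x] x z s by auto
  then have "(z - s) * f' x \<ge> 0" using z by (intro mult_nonneg_nonneg) auto
  then have "f z \<ge> f s" using x(3) by linarith
  then show False using right[OF z] s by simp
qed

lemma window_monotone_left:
  fixes f :: "real \<Rightarrow> real"
  assumes d: "\<And>z. (f has_real_derivative f' z) (at z)" and le: "y1 \<le> y2"
    and b: "\<bar>b\<bar> < 1" "f y2 \<le> b"
    and mono: "\<And>z. z \<in> {y1..y2} \<Longrightarrow> \<bar>f z\<bar> < 1 \<Longrightarrow> f' z \<ge> 0"
  shows "f y1 \<le> b"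
proof -
  have "- b \<le> - f (- (- y1))"
  proof (rule window_monotone_right[of "\<lambda>z. - f (- z)" "\<lambda>z. f' (- z)" "- y2" "- y1"])
    show "((\<lambda>z. - f (- z)) has_real_derivative f' (- z)) (at z)" for z
    proof -
      have "((\<lambda>z. f (- z)) has_real_derivative f' (- z) * (- 1)) (at z)"
        by (rule DERIV_chain2[where f = f and g = uminus, OF d]) (auto intro!: derivative_eq_intros)
      from DERIV_minus[OF this] show ?thesis by simp
    qed
  qed (use assms in auto)
  then show ?thesis by simp
qed

text \<open>The flow rises above \<open>b\<close> immediately after \<open>y1\<close>. It may leave
  the window before \<open>y2\<close>, but by \<open>window_monotone_right\<close> it cannot come
  back down to \<open>b\<close>.\<close>

lemma flow_unique_in_window:
  assumes inc: "\<And>z. \<bar>z\<bar> < 1 \<Longrightarrow> \<bar>flow t z\<bar> < 1 \<Longrightarrow> slope t z > 0"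
    and y: "\<bar>y1\<bar> < 1" "\<bar>y2\<bar> < 1" "y1 < y2" and b: "\<bar>b\<bar> < 1" "flow t y1 = b" "flow t y2 = b"
  shows False
proof -
  note D = flow_has_derivative[of t]
  have "slope t y1 > 0" using inc y b by simp
  from DERIV_pos_inc_right[OF D this] obtain d where d: "d > 0"
    "\<And>h. 0 < h \<Longrightarrow> h < d \<Longrightarrow> flow t y1 < flow t (y1 + h)" by blast
  have "eventually (\<lambda>z. flow t z < 1) (at y1)"
    using order_tendstoD(2)[OF DERIV_isCont[OF D, unfolded isCont_def], of y1 1] b by auto
  then obtain \<delta> where \<delta>: "\<delta> > 0" "\<And>z. z \<noteq> y1 \<Longrightarrow> \<bar>z - y1\<bar> < \<delta> \<Longrightarrow> flow t z < 1"
    by (auto simp: eventually_at dist_real_def)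
  define h where "h = min (d / 2) (min (\<delta> / 2) (y2 - y1))"
  have h: "0 < h" "h < d" "h < \<delta>" "y1 + h \<le> y2" using d \<delta> y by (auto simp: h_def)
  have f: "b < flow t (y1 + h)" "flow t (y1 + h) < 1" using d(2)[of h] \<delta>(2)[of "y1 + h"] h b by auto
  have "flow t y2 \<ge> flow t (y1 + h)"
    using f b h y by (intro window_monotone_right[OF D h(4)] less_imp_le[OF inc]) auto
  then show False using f b by simp
qed

lemma C1partialI:
  assumes g: "\<And>x. x \<in> {-1..1} \<Longrightarrow> g x = ennreal (E x) \<and> 0 \<le> E x"
    and cont: "continuous_on {-1..1} E"
    and der: "\<And>x. \<bar>x\<bar> < 1 \<Longrightarrow> (E has_real_derivative E' x) (at x)"
    and cont': "continuous_on {-1<..<1} E'"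
    and lim: "filterlim E' at_top (at_left 1)" "filterlim E' at_bot (at_right (-1))"
  shows "C1partial g"
proof -
  define f where "f x = enn2real (g x)" for x
  have f: "f x = E x" if "x \<in> {-1..1}" for x using g[OF that] by (simp add: f_def)
  have df: "(f has_real_derivative E' x) (at x)" if "x \<in> {-1<..<1}" for x
    by (rule has_field_derivative_transform_within_open[OF der, of x "{-1<..<1}"]) (use that f in auto)
  have deq: "deriv f x = E' x" if "x \<in> {-1<..<1}" for x using df[OF that] by (rule DERIV_imp_deriv)
  have "continuous_on {-1..1} f" using cont by (rule continuous_on_eq) (simp add: f)
  moreover have "\<forall>x\<in>{-1<..<1}. f differentiable (at x)" using df real_differentiable_def by blast
  moreover have "continuous_on {-1<..<1} (deriv f)" using cont' by (rule continuous_on_eq) (simp add: deq)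
  moreover have "filterlim (deriv f) at_top (at_left 1)"
    using lim(1) by (rule filterlim_cong[OF refl refl, THEN iffD1, rotated])
      (auto simp: eventually_at_left_field deq intro!: exI[of _ "-1"])
  moreover have "filterlim (deriv f) at_bot (at_right (-1))"
    using lim(2) by (rule filterlim_cong[OF refl refl, THEN iffD1, rotated])
      (auto simp: eventually_at_right_field deq intro!: exI[of _ "1"])
  ultimately show ?thesis
    unfolding C1partial_def f_def[abs_def] Let_def using g by simp
qed

lemma filterlim_artanh_plus_bounded:
  assumes T: "\<And>x. \<bar>x\<bar> < 1 \<Longrightarrow> \<bar>T x\<bar> \<le> C"
  shows "filterlim (\<lambda>x. artanh x - T x :: real) at_top (at_left 1)"
    and "filterlim (\<lambda>x. artanh x - T x :: real) at_bot (at_right (-1))"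
proof -
  have "filterlim (\<lambda>x. - C + artanh x :: real) at_top (at_left 1)"
    by (rule filterlim_tendsto_add_at_top[OF tendsto_const artanh_real_at_left_1])
  then show "filterlim (\<lambda>x. artanh x - T x) at_top (at_left 1)"
  proof (rule filterlim_at_top_mono)
    show "\<forall>\<^sub>F x in at_left 1. - C + artanh x \<le> artanh x - T x"
      by (auto simp: eventually_at_left_field intro!: exI[of _ "-1"]; smt (verit) T)
  qed
  show "filterlim (\<lambda>x. artanh x - T x) at_bot (at_right (-1))"
    unfolding filterlim_at_bot
  proof
    fix Z
    have "\<forall>\<^sub>F x in at_right (-1). artanh x \<le> Z - C"
      using artanh_real_at_right_1 unfolding filterlim_at_bot by blast
    moreover have "\<forall>\<^sub>F x in at_right (-1). \<bar>x::real\<bar> < 1"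
      by (auto simp: eventually_at_right_field intro!: exI[of _ "1"])
    ultimately show "\<forall>\<^sub>F x in at_right (-1). artanh x - T x \<le> Z"
    proof eventually_elim
      case (elim x)
      then show ?case using T[of x] by linarith
    qed
  qed
qed

text \<open>The formulas for characteristics assume \<open>t > 0\<close>, while the first phase
  includes \<open>t = 0\<close>. There a path joins \<open>b\<close> only to itself, and its action
  is an integral over one point.\<close>

lemma It_0:
  assumes b: "b \<in> {-1..1}"
  shows "It \<alpha> \<theta> 0 b = ennreal (I0 \<alpha> \<theta> b)"
proof (rule antisym)
  have "action 0 (\<lambda>_. b) = (\<integral>\<^sup>+ (s::real). 0 \<partial>lborel)"
    unfolding action_def
  proof (rule nn_integral_cong_AE)
    have "AE s in lborel. s \<noteq> (0::real)" by (rule AE_lborel_singleton)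
    then show "AE s in lborel. indicator {0..0} s * Lag b (vector_derivative (\<lambda>_. b) (at s)) = 0"
      by eventually_elim auto
  qed
  moreover have "abs_cont_on 0 0 (\<lambda>_. b)" by (auto simp: abs_cont_on_def intro!: exI[of _ 1])
  ultimately have "S 0 b b \<le> 0"
    unfolding S_def using b by (intro INF_lower2[of "\<lambda>_. b"]) auto
  then have "ennreal (I0 \<alpha> \<theta> b) + S 0 b b \<le> ennreal (I0 \<alpha> \<theta> b)" by simp
  then show "It \<alpha> \<theta> 0 b \<le> ennreal (I0 \<alpha> \<theta> b)" unfolding It_def using b by (intro INF_lower2)
  show "ennreal (I0 \<alpha> \<theta> b) \<le> It \<alpha> \<theta> 0 b"
    unfolding It_def
  proof (rule INF_greatest)
    fix a :: real
    show "ennreal (I0 \<alpha> \<theta> b) \<le> ennreal (I0 \<alpha> \<theta> a) + S 0 a b"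
    proof (cases "a = b")
      case False
      then have "{\<gamma>. abs_cont_on 0 0 \<gamma> \<and> \<gamma> ` {0..0} \<subseteq> {-1..1} \<and> \<gamma> 0 = a \<and> \<gamma> 0 = b} = {}" by auto
      then have "S 0 a b = top" unfolding S_def by (simp only: image_empty Inf_empty)
      then show ?thesis by simp
    qed (simp add: add_increasing2)
  qed
qed

lemma abs_tilt_affine_le:
  assumes "t \<ge> 0" "y \<in> {-1..1}"
  shows "\<bar>tilt t (fld y)\<bar> \<le> \<bar>\<alpha>\<bar> + \<bar>\<theta>\<bar>"
proof -
  have "\<bar>tilt t (fld y)\<bar> \<le> \<bar>fld y\<bar>" by (rule abs_tilt_le[OF assms(1)])
  also have "\<dots> \<le> \<bar>\<alpha>\<bar> * \<bar>y\<bar> + \<bar>\<theta>\<bar>" using abs_triangle_ineq[of "\<alpha> * y" \<theta>] by (simp add: abs_mult)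
  also have "\<dots> \<le> \<bar>\<alpha>\<bar> * 1 + \<bar>\<theta>\<bar>" using assms(2) by (intro add_mono mult_left_mono) auto
  finally show ?thesis by simp
qed

lemma C1partial_It_0: "C1partial (It \<alpha> \<theta> 0)"
proof (rule C1partialI[where E = "I0 \<alpha> \<theta>" and E' = "\<lambda>x. artanh x - fld x"])
  show "It \<alpha> \<theta> 0 x = ennreal (I0 \<alpha> \<theta> x) \<and> 0 \<le> I0 \<alpha> \<theta> x" if "x \<in> {-1..1}" for x
    using It_0[OF that] I0_nonneg[OF that] by simp
  show "continuous_on {-1..1} (I0 \<alpha> \<theta>)"
    unfolding I0_ent[abs_def] by (intro continuous_intros continuous_on_ent) auto
  show "(I0 \<alpha> \<theta> has_real_derivative artanh x - fld x) (at x)" if "\<bar>x\<bar> < 1" for x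
    using deriv_I0[OF that, of \<alpha> \<theta>] by (simp add: algebra_simps)
  show "continuous_on {-1<..<1} (\<lambda>x. artanh x - fld x)" by (intro continuous_intros) auto
  have "\<bar>fld x\<bar> \<le> \<bar>\<alpha>\<bar> + \<bar>\<theta>\<bar>" if "\<bar>x\<bar> < 1" for x
    using abs_tilt_affine_le[of 0 x] that by (auto simp: abs_less_iff)
  from filterlim_artanh_plus_bounded[of "\<lambda>x. fld x", OF this]
  show "filterlim (\<lambda>x. artanh x - fld x) at_top (at_left 1)"
    "filterlim (\<lambda>x. artanh x - fld x) at_bot (at_right (-1))" by simp_all
qed

text \<open>A minimum of functions affine in \<open>b\<close> with uniformly bounded slopes is
  Lipschitz. The set \<open>Y\<close> is left free so that this also covers the minima on either
  side of a fold.\<close>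

lemma continuous_on_min_Psi:
  assumes t: "t \<ge> 0" and Y: "Y \<subseteq> {-1..1}"
    and y: "\<And>b. b \<in> A \<Longrightarrow> y b \<in> Y" "\<And>b a. b \<in> A \<Longrightarrow> a \<in> Y \<Longrightarrow> Psi t b (y b) \<le> Psi t b a"
  shows "continuous_on A (\<lambda>b. Psi t b (y b))"
proof -
  define K where "K b = Psi t b (y b)" for b
  define T where "T b = tilt t (\<alpha> * y b + \<theta>)" for b
  have Tb: "\<bar>T b\<bar> \<le> \<bar>\<alpha>\<bar> + \<bar>\<theta>\<bar>" if "b \<in> A" for b
    unfolding T_def by (rule abs_tilt_affine_le[OF t]) (use y(1)[OF that] Y in blast)
  have Kle: "K b' \<le> K b - (b' - b) * T b" if "b \<in> A" "b' \<in> A" for b b'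
    using y(2)[OF that(2) y(1)[OF that(1)]] Psi_shift[of t b' "y b" b] by (simp add: K_def T_def)
  have "continuous_on A K"
  proof (rule lipschitz_on_continuous_on[of "\<bar>\<alpha>\<bar> + \<bar>\<theta>\<bar>"], rule lipschitz_onI)
    fix b b' :: real assume b: "b \<in> A" "b' \<in> A"
    have "\<bar>(b' - b) * T b\<bar> \<le> (\<bar>\<alpha>\<bar> + \<bar>\<theta>\<bar>) * \<bar>b' - b\<bar>" "\<bar>(b' - b) * T b'\<bar> \<le> (\<bar>\<alpha>\<bar> + \<bar>\<theta>\<bar>) * \<bar>b' - b\<bar>"
      unfolding abs_mult
      using mult_right_mono[OF Tb[OF b(1)], of "\<bar>b' - b\<bar>"] mult_right_mono[OF Tb[OF b(2)], of "\<bar>b' - b\<bar>"]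
      by (simp_all add: mult.commute)
    moreover have "K b' - K b \<le> - ((b' - b) * T b)" "K b - K b' \<le> (b' - b) * T b'"
      using Kle[OF b] Kle[OF b(2,1)] by (simp_all add: algebra_simps)
    ultimately show "dist (K b) (K b') \<le> (\<bar>\<alpha>\<bar> + \<bar>\<theta>\<bar>) * dist b b'"
      unfolding dist_real_def abs_minus_commute[of b b'] by linarith
  qed simp
  then show ?thesis unfolding K_def .
qed

text \<open>An envelope argument: each interior \<open>b\<close> is reached from one
  \<open>y b\<close> only, which depends continuously on \<open>b\<close> since its graph is closed
  and its values lie in a compact interval. The minimum then has derivative \<open>- T b\<close>. As
  \<open>T\<close> is bounded, the blow-up at the endpoints comes from
  \<open>artanh\<close>.\<close>

lemma C1partial_if_flow_increasing:
  assumes t: "t > 0" and \<alpha>: "\<alpha> \<ge> 0"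
    and inc: "\<And>z. \<bar>z\<bar> < 1 \<Longrightarrow> \<bar>flow t z\<bar> < 1 \<Longrightarrow> slope t z > 0"
  shows "C1partial (It \<alpha> \<theta> t)"
proof -
  have "\<forall>b\<in>{-1..1}. \<exists>y. \<bar>y\<bar> < 1 \<and> flow t y = b \<and> (\<forall>a\<in>{-1..1}. Psi t b y \<le> Psi t b a)"
    using ex_Psi_minimizer[OF t \<alpha>] by blast
  then obtain y where y: "\<And>b. b \<in> {-1..1} \<Longrightarrow> \<bar>y b\<bar> < 1"
      "\<And>b. b \<in> {-1..1} \<Longrightarrow> flow t (y b) = b"
      "\<And>b a. b \<in> {-1..1} \<Longrightarrow> a \<in> {-1..1} \<Longrightarrow> Psi t b (y b) \<le> Psi t b a"
    by metis
  define T where "T b = tilt t (\<alpha> * y b + \<theta>)" for b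
  define K where "K b = Psi t b (y b)" for b
  have y1: "y b \<in> {-1..1}" if "b \<in> {-1..1}" for b using y(1)[OF that] by auto
  have Kle: "K b' \<le> K b - (b' - b) * T b" if "b \<in> {-1..1}" "b' \<in> {-1..1}" for b b'
    using y(3)[OF that(2) y1[OF that(1)]] Psi_shift[of t b' "y b" b] by (simp add: K_def T_def)
  have Tb: "\<bar>T b\<bar> \<le> \<bar>\<alpha>\<bar> + \<bar>\<theta>\<bar>" if "b \<in> {-1..1}" for b
    unfolding T_def using t by (intro abs_tilt_affine_le y1 that) simp
  \<comment> \<open>Testing each of the two minima with the minimiser of the other squeezes the
    difference quotient between \<open>- T b\<close> and \<open>- T b'\<close>.\<close>
  have Kdiff: "\<bar>K b' - K b + (b' - b) * T b\<bar> \<le> \<bar>b' - b\<bar> * \<bar>T b' - T b\<bar>" if "b \<in> {-1..1}" "b' \<in> {-1..1}" for b b'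
  proof -
    have "K b' - K b + (b' - b) * T b \<le> 0" using Kle[OF that] by simp
    moreover have "K b' - K b + (b' - b) * T b \<ge> - ((b' - b) * (T b' - T b))"
      using Kle[OF that(2,1)] by (simp add: algebra_simps)
    ultimately have "\<bar>K b' - K b + (b' - b) * T b\<bar> \<le> \<bar>(b' - b) * (T b' - T b)\<bar>" by linarith
    then show ?thesis by (simp add: abs_mult)
  qed
  have contK: "continuous_on {-1..1} K"
    unfolding K_def using t y1 y(3) by (intro continuous_on_min_Psi[where Y = "{-1..1}"]) auto
  \<comment> \<open>Restricted to compact parts of the open interval, because uniqueness of the
    starting point is known only for \<open>|b| < 1\<close>.\<close>
  have cy: "continuous_on {c..d} y" if "- 1 < c" "d < 1" for c d
  proof (rule continuous_from_closed_graph[of "{-1..1}"])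
    show "y \<in> {c..d} \<rightarrow> {-1..1}" using y1 that by auto
    have "(\<lambda>x. (x, y x)) ` {c..d} = ({c..d} \<times> {-1..1}) \<inter> {z. flow t (snd z) = fst z}"
    proof (intro equalityI subsetI)
      fix z assume "z \<in> (\<lambda>x. (x, y x)) ` {c..d}"
      then obtain x where x: "z = (x, y x)" "x \<in> {c..d}" by blast
      then have "x \<in> {-1..1}" using that by auto
      then show "z \<in> ({c..d} \<times> {-1..1}) \<inter> {z. flow t (snd z) = fst z}"
        using x y(2)[of x] y1[of x] by auto
    next
      fix z assume z: "z \<in> ({c..d} \<times> {-1..1}) \<inter> {z. flow t (snd z) = fst z}"
      obtain x w where xw: "z = (x, w)" by (cases z)
      have x: "x \<in> {c..d}" "w \<in> {-1..1}" "flow t w = x" using z xw by auto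
      then have x1: "\<bar>x\<bar> < 1" "x \<in> {-1..1}" using that by auto
      have "w \<noteq> 1" "w \<noteq> - 1" using flow_endpoints[OF t] x x1 by auto
      then have w1: "\<bar>w\<bar> < 1" using x by (auto simp: abs_less_iff less_le)
      have "w = y x"
        using flow_unique_in_window[OF inc w1 y(1)[OF x1(2)] _ x1(1) x(3) y(2)[OF x1(2)]]
          flow_unique_in_window[OF inc y(1)[OF x1(2)] w1 _ x1(1) y(2)[OF x1(2)] x(3)]
        by (meson linorder_neqE_linordered_idom)
      then show "z \<in> (\<lambda>x. (x, y x)) ` {c..d}" using x xw by auto
    qed
    moreover have "closed (({c..d} \<times> {-1..1}) \<inter> {z. flow t (snd z) = fst z})"
      by (intro closed_Int closed_Times closed_Collect_eq continuous_on_compose2[OF continuous_on_flow]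
          continuous_intros) auto
    ultimately show "closed ((\<lambda>x. (x, y x)) ` {c..d})" by simp
  qed simp
  have cT: "isCont T b" if "\<bar>b\<bar> < 1" for b
  proof -
    define c where "c = (b - 1) / 2"
    define d where "d = (b + 1) / 2"
    have cd: "- 1 < c" "d < 1" "b \<in> {c<..<d}" using that by (auto simp: c_def d_def)
    have "continuous_on UNIV (tilt t)"
      using t by (intro DERIV_continuous_on[OF has_field_derivative_at_within[OF tilt_has_derivative_arg]]) simp
    then have "continuous_on {c..d} T"
      unfolding T_def by (rule continuous_on_compose2) (intro continuous_intros cy cd, simp)
    then show ?thesis by (rule continuous_on_interior) (use cd in simp)
  qed
  have dK: "(K has_real_derivative - T b) (at b)" if "\<bar>b\<bar> < 1" for b
  proof -
    have b: "b \<in> {-1..1}" using that by auto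
    have "((\<lambda>b'. (K b' - K b) / (b' - b)) \<longlongrightarrow> - T b) (at b)"
    proof (rule LIM_zero_cancel, rule tendsto_rabs_zero_cancel, rule tendsto_sandwich[OF _ _ tendsto_const])
      show "((\<lambda>b'. \<bar>T b' - T b\<bar>) \<longlongrightarrow> 0) (at b)"
        using cT[OF that] by (intro tendsto_rabs_zero LIM_zero) (simp add: isCont_def)
      have "eventually (\<lambda>b'. b' \<in> {-1<..<1} - {b}) (at b)"
        using that by (intro eventually_at_in_open) auto
      then show "eventually (\<lambda>b'. \<bar>(K b' - K b) / (b' - b) - - T b\<bar> \<le> \<bar>T b' - T b\<bar>) (at b)"
      proof eventually_elim
        case (elim b')
        then have ne: "b' - b \<noteq> 0" and b': "b' \<in> {-1..1}" by auto
        have "(K b' - K b) / (b' - b) - - T b = (K b' - K b + (b' - b) * T b) / (b' - b)"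
          using ne by (simp add: add_divide_distrib)
        then have "\<bar>(K b' - K b) / (b' - b) - - T b\<bar> = \<bar>K b' - K b + (b' - b) * T b\<bar> / \<bar>b' - b\<bar>"
          by (simp add: abs_divide)
        also have "\<dots> \<le> \<bar>T b' - T b\<bar>"
          using Kdiff[OF b b'] ne by (simp add: divide_le_eq mult.commute)
        finally show ?case .
      qed
    qed simp
    then show ?thesis unfolding has_field_derivative_iff .
  qed
  show ?thesis
  proof (rule C1partialI[where E = "\<lambda>b. val t b (y b)" and E' = "\<lambda>b. artanh b - T b"])
    show "It \<alpha> \<theta> t b = ennreal (val t b (y b)) \<and> 0 \<le> val t b (y b)" if "b \<in> {-1..1}" for b
      using It_eq_val[OF t that y(1,2)[OF that] y(3)[OF that]] by blast
    have eq: "(\<lambda>b. val t b (y b)) = (\<lambda>b. ent b + Cconst \<alpha> \<theta> + K b)" by (simp add: val_def K_def)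
    show "continuous_on {-1..1} (\<lambda>b. val t b (y b))"
      unfolding eq by (intro continuous_intros continuous_on_ent contK)
    show "((\<lambda>b. val t b (y b)) has_real_derivative artanh b - T b) (at b)" if "\<bar>b\<bar> < 1" for b
      unfolding eq using DERIV_add[OF DERIV_add[OF ent_has_derivative[OF that] DERIV_const] dK[OF that]] by simp
    show "continuous_on {-1<..<1} (\<lambda>b. artanh b - T b)"
      by (intro continuous_intros continuous_at_imp_continuous_on ballI cT) auto
    show "filterlim (\<lambda>b. artanh b - T b) at_top (at_left 1)" "filterlim (\<lambda>b. artanh b - T b) at_bot (at_right (-1))"
      by (rule filterlim_artanh_plus_bounded[of T, OF Tb]; simp add: abs_less_iff)+
  qed
qed

section \<open>Overhangs\<close>

lemma cosh_double_tanh: "cosh (2 * x :: real) * (1 - (tanh x)\<^sup>2) = 1 + (tanh x)\<^sup>2"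
proof -
  have c2: "(cosh x)\<^sup>2 * (1 - (tanh x)\<^sup>2) = 1"
    by (simp add: tanh_def power_divide right_diff_distrib hyperbolic_pythagoras)
  have "cosh (2 * x) = (cosh x)\<^sup>2 * (1 + (tanh x)\<^sup>2)"
    by (simp add: cosh_double tanh_def power_divide distrib_left)
  then have "cosh (2 * x) * (1 - (tanh x)\<^sup>2) = (cosh x)\<^sup>2 * (1 - (tanh x)\<^sup>2) * (1 + (tanh x)\<^sup>2)" by simp
  then show ?thesis unfolding c2 by simp
qed

text \<open>Survival of a characteristic with initial momentum \<open>f\<close> takes the form
  \<open>tanh (2 * t) * cosh (2 * f) < 1\<close>, which can be compared with the focusing condition
  \<open>tanh (2 * t) * stretch y = - 1\<close>.\<close>

lemma abs_tanh_less_exp_iff: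
  fixes f t :: real
  shows "\<bar>tanh f\<bar> < exp (- 2 * t) \<longleftrightarrow> sinh (2 * t) * cosh (2 * f) < cosh (2 * t)"
proof -
  define m where "m = exp (- 2 * t)"
  define T where "T = (tanh f)\<^sup>2"
  have m: "m > 0" by (simp add: m_def)
  have T: "1 - T > 0" using abs_tanh_real_less_1[of f] by (simp add: T_def abs_square_less_1)
  have "m * exp (2 * t) = 1" unfolding m_def by (simp flip: exp_add)
  moreover have c: "cosh (2 * t) = (exp (2 * t) + m) / 2" and s: "sinh (2 * t) = (exp (2 * t) - m) / 2"
    by (simp_all add: cosh_field_def sinh_field_def m_def)
  have "2 * m * cosh (2 * t) = m * exp (2 * t) + m\<^sup>2" "2 * m * sinh (2 * t) = m * exp (2 * t) - m\<^sup>2"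
    unfolding c s by (simp_all add: power2_eq_square field_simps)
  ultimately have ct: "2 * m * cosh (2 * t) = 1 + m\<^sup>2" and st: "2 * m * sinh (2 * t) = 1 - m\<^sup>2"
    by simp_all
  have "sinh (2 * t) * cosh (2 * f) < cosh (2 * t) \<longleftrightarrow>
    (2 * m * (1 - T)) * (sinh (2 * t) * cosh (2 * f)) < (2 * m * (1 - T)) * cosh (2 * t)"
    using m T by (subst mult_less_cancel_left_pos) auto
  also have "(2 * m * (1 - T)) * (sinh (2 * t) * cosh (2 * f)) = (2 * m * sinh (2 * t)) * (cosh (2 * f) * (1 - T))" by simp
  also have "\<dots> = (1 - m\<^sup>2) * (1 + T)" unfolding st T_def cosh_double_tanh ..
  also have "(2 * m * (1 - T)) * cosh (2 * t) = (2 * m * cosh (2 * t)) * (1 - T)" by simp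
  also have "\<dots> = (1 + m\<^sup>2) * (1 - T)" unfolding ct ..
  also have "(1 - m\<^sup>2) * (1 + T) < (1 + m\<^sup>2) * (1 - T) \<longleftrightarrow> T < m\<^sup>2" by (auto simp: algebra_simps)
  also have "\<dots> \<longleftrightarrow> \<bar>tanh f\<bar> < \<bar>m\<bar>" unfolding T_def using abs_le_square_iff[of m "tanh f"] by auto
  finally show ?thesis using m by (simp add: m_def)
qed

text \<open>The slope of the initial momentum graph is \<open>1 / (1 - y\<^sup>2) - \<alpha>\<close>: characteristics can only be
  compressed where this is negative, and there they focus before they leave the interval.\<close>

lemma stretch_plus_cosh:
  fixes y :: real
  assumes y: "\<bar>y\<bar> < 1"
  defines "q \<equiv> fld y"
  shows "(1 - y\<^sup>2) * (stretch y + cosh (2 * (artanh y - q))) = 2 * (1 - \<alpha> * (1 - y\<^sup>2)) * (cosh (2 * q) - y * sinh (2 * q))"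
proof -
  define h where "h = artanh y"
  have th: "tanh h = y" using y by (simp add: h_def)
  have y2: "1 - y\<^sup>2 \<noteq> 0" using y by (simp add: abs_square_eq_1)
  have C: "(1 - y\<^sup>2) * cosh (2 * h) = 1 + y\<^sup>2" using cosh_double_tanh[of h] th by (simp add: mult.commute)
  have Sh: "(1 - y\<^sup>2) * sinh (2 * h) = 2 * y" using sinh_double_tanh[of h] th y2 by simp
  have cd: "cosh (2 * (h - q)) = cosh (2 * h) * cosh (2 * q) - sinh (2 * h) * sinh (2 * q)"
    by (simp add: right_diff_distrib cosh_diff)
  have "(1 - y\<^sup>2) * cosh (2 * (h - q)) = ((1 - y\<^sup>2) * cosh (2 * h)) * cosh (2 * q) - ((1 - y\<^sup>2) * sinh (2 * h)) * sinh (2 * q)"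
    unfolding cd by (simp add: algebra_simps)
  also have "\<dots> = (1 + y\<^sup>2) * cosh (2 * q) - 2 * y * sinh (2 * q)" unfolding C Sh ..
  finally have e: "(1 - y\<^sup>2) * cosh (2 * (h - q)) = (1 + y\<^sup>2) * cosh (2 * q) - 2 * y * sinh (2 * q)" .
  show ?thesis
    unfolding h_def[symmetric] distrib_left e stretch_def q_def[symmetric]
    by (simp add: algebra_simps power2_eq_square)
qed

lemma cosh_minus_mult_sinh_pos:
  fixes y q :: real assumes "\<bar>y\<bar> < 1" shows "cosh q - y * sinh q > 0"
proof -
  have "\<bar>y * sinh q\<bar> \<le> 1 * \<bar>sinh q\<bar>" unfolding abs_mult using assms by (intro mult_right_mono) auto
  also have "\<dots> < cosh q" using sinh_less_cosh_real[of "\<bar>q\<bar>"] by simp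
  finally show ?thesis by linarith
qed

lemma stretch_plus_cosh_sign:
  assumes y: "\<bar>y\<bar> < 1"
  shows "\<alpha> * (1 - y\<^sup>2) \<le> 1 \<Longrightarrow> stretch y + cosh (2 * (artanh y - fld y)) \<ge> 0"
    and "\<alpha> * (1 - y\<^sup>2) > 1 \<Longrightarrow> stretch y + cosh (2 * (artanh y - fld y)) < 0"
proof -
  have y2: "1 - y\<^sup>2 > 0" using y by (simp add: abs_square_less_1)
  note e = stretch_plus_cosh[OF y] and p = cosh_minus_mult_sinh_pos[OF y, of "2 * fld y"]
  show "stretch y + cosh (2 * (artanh y - fld y)) \<ge> 0" if "\<alpha> * (1 - y\<^sup>2) \<le> 1"
  proof -
    have "(1 - y\<^sup>2) * (stretch y + cosh (2 * (artanh y - fld y))) \<ge> 0"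
      unfolding e using that p by (intro mult_nonneg_nonneg) auto
    then show ?thesis using y2 by (simp add: zero_le_mult_iff)
  qed
  show "stretch y + cosh (2 * (artanh y - fld y)) < 0" if "\<alpha> * (1 - y\<^sup>2) > 1"
  proof -
    have "(1 - y\<^sup>2) * (stretch y + cosh (2 * (artanh y - fld y))) < 0"
      unfolding e by (rule mult_neg_pos) (use that p in auto)
    then show ?thesis using y2 by (simp add: mult_less_0_iff)
  qed
qed

text \<open>Here \<open>stretch y\<close> is at least minus \<open>cosh\<close> of twice the initial
  momentum, and survival makes \<open>cosh (2 * t)\<close> exceed \<open>sinh (2 * t)\<close> times
  that same \<open>cosh\<close>. So the characteristic leaves before it can focus.\<close>

lemma flow_slope_pos_outside:
  assumes t: "t > 0" and y: "\<bar>y\<bar> < 1" and w: "\<bar>flow t y\<bar> < 1" and out: "\<alpha> * (1 - y\<^sup>2) \<le> 1"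
  shows "slope t y > 0"
proof -
  let ?f = "artanh y - fld y"
  have "sinh (2 * t) * cosh (2 * ?f) < cosh (2 * t)"
    using abs_flow_le_iff(2)[OF y, of t] w t abs_tanh_less_exp_iff by simp
  moreover have "sinh (2 * t) * (stretch y + cosh (2 * ?f)) \<ge> 0"
    using stretch_plus_cosh_sign(1)[OF y out] t by simp
  ultimately show ?thesis by (simp add: distrib_left)
qed

lemma Gt_memberI:
  assumes t: "t > 0" and y: "\<bar>y\<bar> < 1" and w: "\<bar>flow t y\<bar> < 1"
  shows "(flow t y, artanh (exp (2 * t) * tanh (artanh y - fld y))) \<in> Gt \<alpha> \<theta> t"
proof -
  define q where "q = fld y"
  define v where "v = tanh (artanh y - q)"
  define P where "P s = artanh (exp (2 * s) * v)" for s
  let ?X = "char_path (tanh q) v"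
  have v: "\<bar>v\<bar> < exp (- 2 * t)"
    using abs_flow_le_iff(2)[OF y, of t] w t by (simp add: v_def q_def)
  have ev: "\<bar>exp (2 * s) * v\<bar> < 1" if "s \<le> t" for s
  proof -
    have "\<bar>exp (2 * s) * v\<bar> < exp (2 * s) * exp (- 2 * t)"
      unfolding abs_mult using v by (simp add: mult_strict_left_mono)
    also have "\<dots> \<le> 1" using that by (simp flip: exp_add)
    finally show ?thesis .
  qed
  have X0: "?X 0 = y"
    using tanh_add_real[of q "artanh y - q"] y by (simp add: char_path_def v_def)
  have P0: "P 0 = deriv (I0 \<alpha> \<theta>) y"
    using DERIV_imp_deriv[OF deriv_I0[OF y, of \<alpha> \<theta>]] by (simp add: P_def v_def q_def artanh_tanh_real)
  have der: "(?X has_real_derivative Hp (?X s) (P s)) (at s within {0..t})"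
    "(P has_real_derivative - Hx (?X s) (P s)) (at s within {0..t})" if s: "s \<in> {0..t}" for s
  proof -
    show "(?X has_real_derivative Hp (?X s) (P s)) (at s within {0..t})"
      unfolding P_def using s ev[of s] by (intro has_field_derivative_at_within[OF char_path_Hamilton]) auto
    show "(P has_real_derivative - Hx (?X s) (P s)) (at s within {0..t})"
    proof -
      have "(P has_real_derivative 2 / 2 * sinh (2 * P s)) (at s)"
        unfolding P_def by (rule artanh_exp_has_derivative) (use ev s in simp)
      then have "(P has_real_derivative - Hx (?X s) (P s)) (at s)" unfolding Hx_eq by simp
      then show ?thesis by (rule has_field_derivative_at_within)
    qed
  qed
  have "?X t = flow t y" using flow_char_path[OF y, of t] by (simp add: q_def v_def)
  then have "(flow t y, P t) \<in> Gt \<alpha> \<theta> t"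
    unfolding Gt_def using X0 P0 der y
    by (intro CollectI exI[of _ ?X] exI[of _ P] exI[of _ y]) auto
  then show ?thesis by (simp add: P_def v_def q_def)
qed

text \<open>Just left of \<open>y\<close> the flow exceeds its value \<open>b\<close> at
  \<open>y\<close>, while at -1 it lies below, so a second characteristic ends in \<open>b\<close>.
  Its momentum differs because two trajectories of the Hamilton flow cannot meet.\<close>

lemma overhang_if_flow_decreasing:
  assumes t: "t > 0" and y: "\<bar>y\<bar> < 1" and w: "\<bar>flow t y\<bar> < 1"
    and dec: "slope t y < 0"
  shows "overhang (Gt \<alpha> \<theta> t)"
proof -
  define b where "b = flow t y"
  from DERIV_neg_dec_left[OF flow_has_derivative dec] obtain d where d: "d > 0"
    "\<And>h. 0 < h \<Longrightarrow> h < d \<Longrightarrow> flow t y < flow t (y - h)" by blast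
  define h where "h = min (d / 2) ((y + 1) / 2)"
  have h: "0 < h" "h < d" "- 1 < y - h" using d y by (auto simp: h_def min_def abs_less_iff field_simps)
  have "flow t (- 1) \<le> b" "b \<le> flow t (y - h)" "- 1 \<le> y - h"
    using flow_endpoints(2)[OF t] h d(2)[of h] w unfolding b_def by linarith+
  then obtain z where z: "- 1 \<le> z" "z \<le> y - h" "flow t z = b"
    using IVT'[OF _ _ _ continuous_on_flow, of t "-1" b "y - h"] by blast
  have "z \<noteq> - 1" using z flow_endpoints(2)[OF t] w by (auto simp: b_def)
  then have z1: "\<bar>z\<bar> < 1" using z h y by auto
  let ?v = "\<lambda>y. tanh (artanh y - fld y)"
  let ?u = "\<lambda>y. tanh (fld y)"
  have G: "(b, artanh (exp (2 * t) * ?v y)) \<in> Gt \<alpha> \<theta> t" "(b, artanh (exp (2 * t) * ?v z)) \<in> Gt \<alpha> \<theta> t"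
    using Gt_memberI[OF t y w] Gt_memberI[OF t z1] z(3) w by (auto simp: b_def)
  have "artanh (exp (2 * t) * ?v y) \<noteq> artanh (exp (2 * t) * ?v z)"
  proof
    assume eq: "artanh (exp (2 * t) * ?v y) = artanh (exp (2 * t) * ?v z)"
    have ev: "\<bar>exp (2 * t) * ?v x\<bar> < 1" if x: "\<bar>x\<bar> < 1" "\<bar>flow t x\<bar> < 1" for x
    proof -
      have "\<bar>?v x\<bar> < exp (- 2 * t)" using abs_flow_le_iff(2)[OF x(1), of t] x t by simp
      then have "exp (2 * t) * \<bar>?v x\<bar> < exp (2 * t) * exp (- 2 * t)" by simp
      also have "\<dots> = 1" by (simp flip: exp_add)
      finally show ?thesis by (simp add: abs_mult)
    qed
    have "exp (2 * t) * ?v y = exp (2 * t) * ?v z"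
      using arg_cong[OF eq, of tanh] ev[OF y w] ev[OF z1] z(3) w by (simp add: b_def)
    then have vv: "?v y = ?v z" by simp
    define v where "v = ?v y"
    define m where "m = exp (- 2 * t)"
    define M where "M = exp (2 * t)"
    have mM: "m * M = 1" unfolding m_def M_def by (simp flip: exp_add)
    have m: "0 < m" "\<bar>v\<bar> < m" "m < 1"
      using abs_flow_le_iff(2)[OF y, of t] w t by (simp_all add: v_def m_def)
    have pos: "1 + ?u x * v > 0" for x
      using one_plus_mult_tanh_pos[OF abs_tanh_real_less_1] m by simp
    have e1: "b = char_path (?u y) v t"
      unfolding b_def v_def by (rule flow_char_path[OF y])
    have e2: "b = char_path (?u z) v t"
      unfolding v_def vv z(3)[symmetric] by (rule flow_char_path[OF z1])
    have "(m * ?u y + M * v) / (1 + ?u y * v) = (m * ?u z + M * v) / (1 + ?u z * v)"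
      using e1 e2 unfolding char_path_def m_def M_def by (rule trans[OF sym])
    then have "(m * ?u y + M * v) * (1 + ?u z * v) = (m * ?u z + M * v) * (1 + ?u y * v)"
      using pos[of y] pos[of z] by (simp add: frac_eq_eq)
    \<comment> \<open>For fixed \<open>v\<close> the final position is a Moebius function of
      \<open>u\<close> with determinant \<open>m - M * v^2\<close>, which is positive as long as the
      characteristic is inside.\<close>
    then have "(?u y - ?u z) * (m - M * v\<^sup>2) = 0" by (simp add: algebra_simps power2_eq_square)
    moreover have "m - M * v\<^sup>2 > 0"
    proof -
      have "v\<^sup>2 < m\<^sup>2" using m abs_le_square_iff[of m v] by auto
      then have "M * v\<^sup>2 < M * m\<^sup>2" by (simp add: M_def)
      also have "\<dots> = m" using mM by (simp add: power2_eq_square mult_ac)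
      finally show ?thesis by simp
    qed
    ultimately have uu: "?u y = ?u z" by simp
    then have "y = z"
      using vv by (metis add_diff_cancel_left' artanh_tanh_real diff_add_cancel tanh_artanh_real tanh_real_eq_iff y z1)
    then show False using z h by simp
  qed
  then show ?thesis using G unfolding overhang_def by blast
qed

section \<open>Loss of differentiability\<close>

lemma Psi_time_Lipschitz:
  assumes s: "0 \<le> s" and t: "0 \<le> t" and y: "y \<in> {-1..1}"
  shows "\<bar>Psi t b y - Psi s b y\<bar> \<le> (1 + \<bar>b\<bar>) * sinh (2 * (\<bar>\<alpha>\<bar> + \<bar>\<theta>\<bar>)) * \<bar>t - s\<bar>"
proof -
  define q where "q = fld y"
  have "\<bar>q\<bar> \<le> \<bar>\<alpha>\<bar> + \<bar>\<theta>\<bar>" using abs_tilt_affine_le[of 0 y] y by (simp add: q_def)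
  then have "sinh (2 * \<bar>q\<bar>) \<le> sinh (2 * (\<bar>\<alpha>\<bar> + \<bar>\<theta>\<bar>))" unfolding sinh_real_le_iff by simp
  then have L: "\<bar>tilt t q - tilt s q\<bar> \<le> sinh (2 * (\<bar>\<alpha>\<bar> + \<bar>\<theta>\<bar>)) * \<bar>t - s\<bar>"
    using tilt_Lipschitz[OF s t, of q] by (meson abs_ge_zero mult_right_mono order_trans)
  have "\<bar>Psi t b y - Psi s b y\<bar>
      = \<bar>(ln (cosh (tilt t q)) - ln (cosh (tilt s q))) - b * (tilt t q - tilt s q)\<bar>"
    by (simp add: Psi_def q_def algebra_simps)
  also have "\<dots> \<le> \<bar>ln (cosh (tilt t q)) - ln (cosh (tilt s q))\<bar> + \<bar>b * (tilt t q - tilt s q)\<bar>"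
    by (rule abs_triangle_ineq4)
  also have "\<dots> \<le> (1 + \<bar>b\<bar>) * \<bar>tilt t q - tilt s q\<bar>"
    using abs_ln_cosh_diff_le[of "tilt t q" "tilt s q"] unfolding abs_mult distrib_right by simp
  also have "\<dots> \<le> (1 + \<bar>b\<bar>) * (sinh (2 * (\<bar>\<alpha>\<bar> + \<bar>\<theta>\<bar>)) * \<bar>t - s\<bar>)"
    by (rule mult_left_mono[OF L]) simp
  finally show ?thesis by (simp add: mult.assoc)
qed

text \<open>Just right of \<open>y\<close> the flow lies below its value at \<open>y\<close>, so
  \<open>Psi\<close> has negative derivative there: a critical point inside a fold is no
  minimiser.\<close>

lemma Psi_decreases_at_fold:
  assumes t: "t > 0" and \<alpha>: "\<alpha> > 0" and y: "\<bar>y\<bar> < 1"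
    and dec: "slope t y < 0"
  shows "\<exists>a\<in>{-1..1}. Psi t (flow t y) a < Psi t (flow t y) y"
proof -
  let ?b = "flow t y"
  from DERIV_neg_dec_right[OF flow_has_derivative dec] obtain d where d: "d > 0"
    "\<And>h. 0 < h \<Longrightarrow> h < d \<Longrightarrow> flow t (y + h) < ?b" by blast
  define h where "h = min (d / 2) (1 - y)"
  have h: "0 < h" "h < d" "y + h \<le> 1" using d y by (auto simp: h_def)
  obtain z where z: "y < z" "z < y + h" and
    e: "Psi t ?b (y + h) - Psi t ?b y = (y + h - y) * (\<alpha> * Psi_weight t (fld z) * (flow t z - ?b))"
    using MVT2[of y "y + h" "Psi t ?b", OF _ Psi_has_derivative[OF less_imp_le[OF t]]] h(1) by auto
  have "flow t z < ?b" using d(2)[of "z - y"] z h by simp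
  moreover have "\<alpha> * Psi_weight t (fld z) > 0" using \<alpha> Psi_weight_pos[of t] t by simp
  ultimately have "(y + h - y) * (\<alpha> * Psi_weight t (fld z) * (flow t z - ?b)) < 0"
    using h by (intro mult_pos_neg) auto
  then show ?thesis using e h y by (intro bexI[of _ "y + h"]) auto
qed

lemma tilt_inj:
  assumes "t \<ge> 0" "tilt t q = tilt t q'" shows "q = q'"
proof -
  have "exp (- 2 * t) * tanh q = exp (- 2 * t) * tanh q'"
    using arg_cong[OF assms(2), of tanh] by (simp only: tanh_tilt[OF assms(1)])
  then show ?thesis by simp
qed

text \<open>For each minimiser \<open>a\<close> the smooth function \<open>val t b' a\<close> of
  \<open>b'\<close> touches the value function from above at \<open>b\<close>. A derivative would
  have to agree with the slopes of both, but these differ because \<open>tilt t\<close> is injective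
  and \<open>\<alpha> > 0\<close>.\<close>

lemma not_differentiable_if_two_minimizers:
  assumes t: "t > 0" and \<alpha>: "\<alpha> > 0" and b: "\<bar>b\<bar> < 1"
    and y: "y \<in> {-1..1}" "z \<in> {-1..1}" "y \<noteq> z"
    and min: "\<And>a. a \<in> {-1..1} \<Longrightarrow> Psi t b y \<le> Psi t b a" "Psi t b z = Psi t b y"
  shows "\<not> diff_on_open (It \<alpha> \<theta> t)"
proof
  assume "diff_on_open (It \<alpha> \<theta> t)"
  moreover have "b \<in> {-1<..<1}" using b by auto
  ultimately have "(\<lambda>x. enn2real (It \<alpha> \<theta> t x)) differentiable (at b)" unfolding diff_on_open_def by blast
  then obtain D where D: "((\<lambda>x. enn2real (It \<alpha> \<theta> t x)) has_real_derivative D) (at b)"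
    using real_differentiable_def by blast
  define f where "f x = enn2real (It \<alpha> \<theta> t x)" for x
  have f: "f b' \<le> val t b' a" if b': "b' \<in> {-1..1}" and a: "a \<in> {-1..1}" for b' a
  proof -
    obtain w where w: "\<bar>w\<bar> < 1" "flow t w = b'" "\<forall>a\<in>{-1..1}. Psi t b' w \<le> Psi t b' a"
      using ex_Psi_minimizer[OF t less_imp_le[OF \<alpha>] b'] by blast
    then have "f b' = val t b' w"
      using It_eq_val[OF t b' w(1,2)] by (simp add: f_def)
    then show ?thesis using w(3) a by (simp add: val_def)
  qed
  have b1: "b \<in> {-1..1}" using b by auto
  have fb: "f b = val t b y"
    using It_eq_val[OF t b1 Psi_minimizer_flow[OF t \<alpha> b1 y(1) min(1)] min(1)] by (simp add: f_def)
  have "D = artanh b - tilt t (fld a)" if a: "a \<in> {-1..1}" "Psi t b a = Psi t b y" for a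
  proof -
    have "((\<lambda>b. Psi t b a) has_real_derivative - tilt t (fld a)) (at b)"
      unfolding Psi_def by (auto intro!: derivative_eq_intros)
    from DERIV_add[OF DERIV_add[OF ent_has_derivative[OF b] DERIV_const[of "Cconst \<alpha> \<theta>"]] this]
    have "((\<lambda>b. val t b a) has_real_derivative artanh b - tilt t (fld a)) (at b)"
      unfolding val_def by simp
    from DERIV_diff[OF this D]
    have "((\<lambda>b. val t b a - f b) has_real_derivative artanh b - tilt t (fld a) - D) (at b)"
      unfolding f_def .
    then have "artanh b - tilt t (fld a) - D = 0"
    proof (rule DERIV_local_min[of _ _ _ "1 - \<bar>b\<bar>"])
      show "\<forall>b'. \<bar>b - b'\<bar> < 1 - \<bar>b\<bar> \<longrightarrow> val t b a - f b \<le> val t b' a - f b'"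
      proof (intro allI impI)
        fix b' assume "\<bar>b - b'\<bar> < 1 - \<bar>b\<bar>"
        then have "b' \<in> {-1..1}" by auto
        from f[OF this a(1)] show "val t b a - f b \<le> val t b' a - f b'"
          using fb a(2) by (simp add: val_def)
      qed
    qed (use b in simp)
    then show ?thesis by simp
  qed
  from this[OF y(1)] this[OF y(2) min(2)] have "tilt t (fld y) = tilt t (fld z)" by simp
  then have "fld y = fld z" using tilt_inj[OF less_imp_le[OF t]] by blast
  then show False using y(3) \<alpha> by simp
qed

text \<open>The minimum left of \<open>c\<close> minus the minimum right of \<open>c\<close> changes
  sign between \<open>b1\<close> and \<open>b2\<close>. At a zero there is a global minimiser on
  each side, and the two are distinct because \<open>c\<close> lies in the fold and cannot be
  one.\<close>

lemma not_differentiable_if_fold_straddled: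
  assumes t: "t > 0" and \<alpha>: "\<alpha> > 0" and c: "\<bar>c\<bar> < 1"
    and dec: "slope t c < 0"
    and b: "- 1 < b1" "b1 \<le> b2" "b2 < 1"
    and l: "l \<in> {-1..c}" "\<And>y. y \<in> {c..1} \<Longrightarrow> Psi t b1 l < Psi t b1 y"
    and r: "r \<in> {c..1}" "\<And>y. y \<in> {-1..c} \<Longrightarrow> Psi t b2 r < Psi t b2 y"
  shows "\<not> diff_on_open (It \<alpha> \<theta> t)"
proof -
  have t0: "t \<ge> 0" using t by simp
  have sub: "{-1..c} \<subseteq> {-1..1}" "{c..1} \<subseteq> {-1..1}" using c by auto
  have "\<exists>y\<in>Y. \<forall>a\<in>Y. Psi t b y \<le> Psi t b a" if "Y = {-1..c} \<or> Y = {c..1}" for b Y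
    using that c by (intro continuous_attains_inf continuous_on_Psi t0) auto
  then have "\<forall>b. \<exists>y\<in>{-1..c}. \<forall>a\<in>{-1..c}. Psi t b y \<le> Psi t b a"
    "\<forall>b. \<exists>y\<in>{c..1}. \<forall>a\<in>{c..1}. Psi t b y \<le> Psi t b a" by blast+
  then obtain yl yr where yl: "\<And>b. yl b \<in> {-1..c}" "\<And>b a. a \<in> {-1..c} \<Longrightarrow> Psi t b (yl b) \<le> Psi t b a"
    and yr: "\<And>b. yr b \<in> {c..1}" "\<And>b a. a \<in> {c..1} \<Longrightarrow> Psi t b (yr b) \<le> Psi t b a"
    by metis
  define G where "G b = Psi t b (yl b) - Psi t b (yr b)" for b
  have "continuous_on {b1..b2} G"
    unfolding G_def using yl yr
    by (intro continuous_intros continuous_on_min_Psi[OF t0 sub(1)] continuous_on_min_Psi[OF t0 sub(2)]) auto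
  moreover have "G b1 \<le> 0" using yl(2)[OF l(1), of b1] l(2)[OF yr(1), of b1] by (simp add: G_def)
  moreover have "0 \<le> G b2" using yr(2)[OF r(1), of b2] r(2)[OF yl(1), of b2] by (simp add: G_def)
  ultimately obtain b where b': "b1 \<le> b" "b \<le> b2" "G b = 0" using IVT'[of G b1 0 b2] b by blast
  have bb: "\<bar>b\<bar> < 1" "b \<in> {-1..1}" using b b' by auto
  have eq: "Psi t b (yr b) = Psi t b (yl b)" using b'(3) by (simp add: G_def)
  have min: "Psi t b (yl b) \<le> Psi t b a" if "a \<in> {-1..1}" for a
    using yl(2)[of a b] yr(2)[of a b] eq that by (cases "a \<le> c") auto
  have ylr: "yl b \<in> {-1..1}" "yr b \<in> {-1..1}" using yl(1)[of b] yr(1)[of b] sub by blast+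
  have "yl b \<noteq> yr b"
  proof
    assume "yl b = yr b"
    then have ylc: "yl b = c" using yl(1)[of b] yr(1)[of b] by auto
    have "flow t (yl b) = b" by (rule Psi_minimizer_flow(2)[OF t \<alpha> bb(2) ylr(1) min])
    then show False using Psi_decreases_at_fold[OF t \<alpha> c dec] min ylc by fastforce
  qed
  then show ?thesis
    by (rule not_differentiable_if_two_minimizers[OF t \<alpha> bb(1) ylr _ min eq])
qed

text \<open>The point of the conclusion is a margin uniform in \<open>y\<close>: it survives a small
  change of time.\<close>

lemma ex_gap_left:
  fixes f :: "real \<Rightarrow> real"
  assumes D: "\<And>x. (f has_real_derivative f' x) (at x)" and pos: "f' c > 0" and "a < c"
    and nonneg: "\<And>x. x \<in> {c..d} \<Longrightarrow> f' x \<ge> 0"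
  shows "\<exists>l\<in>{a..c}. \<exists>\<epsilon>>0. \<forall>y\<in>{c..d}. f l + \<epsilon> \<le> f y"
proof -
  from DERIV_pos_inc_left[OF D pos] obtain \<delta> where \<delta>: "\<delta> > 0"
    "\<And>h. 0 < h \<Longrightarrow> h < \<delta> \<Longrightarrow> f (c - h) < f c" by blast
  define l where "l = c - min (\<delta> / 2) (c - a)"
  have l: "l \<in> {a..c}" "f l < f c" using \<delta>(1) \<delta>(2)[of "c - l"] \<open>a < c\<close> by (auto simp: l_def min_def)
  have "f c \<le> f y" if "y \<in> {c..d}" for y
    using that D nonneg by (intro DERIV_nonneg_imp_nondecreasing[where f = f]) (auto intro!: exI)
  then show ?thesis using l by (intro bexI[of _ l] exI[of _ "f c - f l"]) auto
qed

lemma ex_gap_right: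
  fixes f :: "real \<Rightarrow> real"
  assumes D: "\<And>x. (f has_real_derivative f' x) (at x)" and neg: "f' c < 0" and "c < d"
    and nonpos: "\<And>x. x \<in> {a..c} \<Longrightarrow> f' x \<le> 0"
  shows "\<exists>r\<in>{c..d}. \<exists>\<epsilon>>0. \<forall>y\<in>{a..c}. f r + \<epsilon> \<le> f y"
proof -
  have "\<exists>l\<in>{- d..- c}. \<exists>\<epsilon>>0. \<forall>y\<in>{- c..- a}. f (- l) + \<epsilon> \<le> f (- y)"
  proof (rule ex_gap_left[where f' = "\<lambda>x. f' (- x) * (- 1)"])
    show "((\<lambda>x. f (- x)) has_real_derivative f' (- x) * (- 1)) (at x)" for x
      by (rule DERIV_chain2[where f = f and g = uminus, OF D]) (auto intro!: derivative_eq_intros)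
  qed (use neg nonpos \<open>c < d\<close> in auto)
  then obtain l \<epsilon> where l: "l \<in> {- d..- c}" "\<epsilon> > 0" "\<forall>y\<in>{- c..- a}. f (- l) + \<epsilon> \<le> f (- y)" by blast
  then show ?thesis by (intro bexI[of _ "- l"] exI[of _ \<epsilon>] conjI ballI) (auto dest: bspec[of _ _ "- _"])
qed

text \<open>On \<open>{c..1}\<close> the flow stays at or above \<open>flow t c > b\<close> by
  window monotonicity, so \<open>Psi\<close> does not decrease there, and moving left from
  \<open>c\<close> is strictly better.\<close>

lemma ex_left_better:
  assumes t: "t > 0" and \<alpha>: "\<alpha> > 0" and c: "\<bar>c\<bar> < 1" and w: "\<bar>flow t c\<bar> < 1"
    and mono: "\<And>z. \<bar>z\<bar> < 1 \<Longrightarrow> \<bar>flow t z\<bar> < 1 \<Longrightarrow> slope t z \<ge> 0"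
    and b: "b < flow t c"
  shows "\<exists>l\<in>{-1..c}. \<exists>\<epsilon>>0. \<forall>y\<in>{c..1}. Psi t b l + \<epsilon> \<le> Psi t b y"
proof -
  note D = Psi_has_derivative[OF less_imp_le[OF t], of b]
  have wt: "\<alpha> * Psi_weight t q > 0" for q using \<alpha> Psi_weight_pos[of t q] t by simp
  have fl: "flow t c \<le> flow t y" if y: "y \<in> {c..1}" for y
  proof (rule window_monotone_right[OF flow_has_derivative _ w])
    show "slope t z \<ge> 0" if "z \<in> {c..y}" "\<bar>flow t z\<bar> < 1" for z
    proof -
      have "z \<noteq> 1" using that flow_endpoints(1)[OF t] by auto
      then show ?thesis using that y c by (intro mono) (auto simp: abs_less_iff less_le)
    qed
  qed (use y in auto)
  show ?thesis
  proof (rule ex_gap_left[OF D])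
    show "\<alpha> * Psi_weight t (fld c) * (flow t c - b) > 0"
      by (rule mult_pos_pos[OF wt]) (use b in simp)
    show "\<alpha> * Psi_weight t (fld x) * (flow t x - b) \<ge> 0" if "x \<in> {c..1}" for x
      by (rule mult_nonneg_nonneg[OF less_imp_le[OF wt]]) (use fl[OF that] b in simp)
  qed (use c in auto)
qed

lemma ex_right_better:
  assumes t: "t > 0" and \<alpha>: "\<alpha> > 0" and c: "\<bar>c\<bar> < 1" and w: "\<bar>flow t c\<bar> < 1"
    and mono: "\<And>z. \<bar>z\<bar> < 1 \<Longrightarrow> \<bar>flow t z\<bar> < 1 \<Longrightarrow> slope t z \<ge> 0"
    and b: "b > flow t c"
  shows "\<exists>r\<in>{c..1}. \<exists>\<epsilon>>0. \<forall>y\<in>{-1..c}. Psi t b r + \<epsilon> \<le> Psi t b y"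
proof -
  note D = Psi_has_derivative[OF less_imp_le[OF t], of b]
  have wt: "\<alpha> * Psi_weight t q > 0" for q using \<alpha> Psi_weight_pos[of t q] t by simp
  have fl: "flow t y \<le> flow t c" if y: "y \<in> {-1..c}" for y
  proof (rule window_monotone_left[OF flow_has_derivative _ w])
    show "slope t z \<ge> 0" if "z \<in> {y..c}" "\<bar>flow t z\<bar> < 1" for z
    proof -
      have "z \<noteq> - 1" using that flow_endpoints(2)[OF t] by auto
      then show ?thesis using that y c by (intro mono) (auto simp: abs_less_iff less_le)
    qed
  qed (use y in auto)
  show ?thesis
  proof (rule ex_gap_right[OF D])
    show "\<alpha> * Psi_weight t (fld c) * (flow t c - b) < 0"
      by (rule mult_pos_neg[OF wt]) (use b in simp)
    show "\<alpha> * Psi_weight t (fld x) * (flow t x - b) \<le> 0" if "x \<in> {-1..c}" for x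
      by (rule mult_nonneg_nonpos[OF less_imp_le[OF wt]]) (use fl[OF that] b in simp)
  qed (use c in auto)
qed

text \<open>At time \<open>s\<close> the flow is still monotone in the window, so targets on either
  side of \<open>flow s c\<close> have their minimisers on the matching side of \<open>c\<close>,
  with a margin. The margins persist for a short time, during which the flow already decreases at
  \<open>c\<close>.\<close>

lemma not_differentiable_after_first_fold:
  assumes s: "s > 0" and \<alpha>: "\<alpha> > 0" and c: "\<bar>c\<bar> < 1" and w: "\<bar>flow s c\<bar> < 1"
    and mono: "\<And>z. \<bar>z\<bar> < 1 \<Longrightarrow> \<bar>flow s z\<bar> < 1 \<Longrightarrow> slope s z \<ge> 0"
    and dec: "\<And>t. t > s \<Longrightarrow> slope t c < 0"
  shows "\<exists>\<delta>>0. \<forall>t. s < t \<and> t < s + \<delta> \<longrightarrow> \<not> diff_on_open (It \<alpha> \<theta> t)"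
proof -
  define b1 where "b1 = (flow s c - 1) / 2"
  define b2 where "b2 = (flow s c + 1) / 2"
  have b: "- 1 < b1" "b1 < flow s c" "flow s c < b2" "b2 < 1" using w by (auto simp: b1_def b2_def)
  obtain l e1 where l: "l \<in> {-1..c}" "e1 > 0" "\<And>y. y \<in> {c..1} \<Longrightarrow> Psi s b1 l + e1 \<le> Psi s b1 y"
    using ex_left_better[OF s \<alpha> c w mono b(2)] by blast
  obtain r e2 where r: "r \<in> {c..1}" "e2 > 0" "\<And>y. y \<in> {-1..c} \<Longrightarrow> Psi s b2 r + e2 \<le> Psi s b2 y"
    using ex_right_better[OF s \<alpha> c w mono b(3)] by blast
  \<comment> \<open>A bound for the Lipschitz constant of \<open>Psi\<close> in time when
    \<open>|b| \<le> 1\<close>, made positive by the \<open>+ 1\<close>. The choice of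
    \<open>\<delta>\<close> keeps the change of \<open>Psi\<close> below half of either
    margin.\<close>
  define M where "M = 2 * sinh (2 * (\<bar>\<alpha>\<bar> + \<bar>\<theta>\<bar>)) + 1"
  have M: "M > 0" by (simp add: M_def add_nonneg_pos)
  define \<delta> where "\<delta> = min e1 e2 / (2 * M)"
  have \<delta>: "\<delta> > 0" using l r M by (simp add: \<delta>_def)
  have close: "\<bar>Psi t b y - Psi s b y\<bar> < e1 / 2" "\<bar>Psi t b y - Psi s b y\<bar> < e2 / 2"
    if "s < t" "t < s + \<delta>" "\<bar>b\<bar> \<le> 1" "y \<in> {-1..1}" for t b y
  proof -
    have "(1 + \<bar>b\<bar>) * sinh (2 * (\<bar>\<alpha>\<bar> + \<bar>\<theta>\<bar>)) \<le> 2 * sinh (2 * (\<bar>\<alpha>\<bar> + \<bar>\<theta>\<bar>))"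
      using that by (intro mult_right_mono) auto
    then have "(1 + \<bar>b\<bar>) * sinh (2 * (\<bar>\<alpha>\<bar> + \<bar>\<theta>\<bar>)) * \<bar>t - s\<bar> \<le> M * \<bar>t - s\<bar>"
      by (intro mult_right_mono) (auto simp: M_def)
    also have "\<dots> < M * \<delta>" using that M by (intro mult_strict_left_mono) auto
    also have "\<dots> = min e1 e2 / 2" using M by (simp add: \<delta>_def)
    finally show "\<bar>Psi t b y - Psi s b y\<bar> < e1 / 2" "\<bar>Psi t b y - Psi s b y\<bar> < e2 / 2"
      using Psi_time_Lipschitz[of s t y b] s that by simp_all
  qed
  have b': "\<bar>b1\<bar> \<le> 1" "\<bar>b2\<bar> \<le> 1" using b w by auto
  have "\<not> diff_on_open (It \<alpha> \<theta> t)" if t: "s < t" "t < s + \<delta>" for t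
  proof (rule not_differentiable_if_fold_straddled[OF _ \<alpha> c dec b(1) _ b(4) l(1) _ r(1)])
    show "Psi t b1 l < Psi t b1 y" if "y \<in> {c..1}" for y
    proof -
      have "l \<in> {-1..1}" "y \<in> {-1..1}" using l(1) that c by auto
      then show ?thesis using close(1)[OF t b'(1), of l] close(1)[OF t b'(1), of y] l(3)[OF that] by linarith
    qed
    show "Psi t b2 r < Psi t b2 y" if "y \<in> {-1..c}" for y
    proof -
      have "r \<in> {-1..1}" "y \<in> {-1..1}" using r(1) that c by auto
      then show ?thesis using close(2)[OF t b'(2), of r] close(2)[OF t b'(2), of y] r(3)[OF that] by linarith
    qed
  qed (use s t b in auto)
  then show ?thesis using \<delta> by blast
qed

section \<open>The focusing region\<close>

definition mom :: "real \<Rightarrow> real" where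
  "mom y = artanh y - fld y"

lemma deriv_I0_mom: "\<bar>y\<bar> < 1 \<Longrightarrow> deriv (I0 \<alpha> \<theta>) y = mom y"
  using DERIV_imp_deriv[OF deriv_I0] by (simp add: mom_def)

lemma continuous_on_mom: "A \<subseteq> {-1<..<1} \<Longrightarrow> continuous_on A mom"
  unfolding mom_def[abs_def] by (intro continuous_intros) auto

lemma mom_has_derivative:
  assumes "\<bar>y\<bar> < 1" shows "(mom has_real_derivative 1 / (1 - y\<^sup>2) - \<alpha>) (at y)"
  unfolding mom_def[abs_def] using assms
  by (auto intro!: derivative_eq_intros artanh_real_has_field_derivative[THEN DERIV_cong])

lemma ex_mom_neg:
  assumes "- 1 < c"
  shows "\<exists>z. - 1 < z \<and> z < c \<and> mom z < 0"
proof -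
  have "filterlim (\<lambda>x. artanh x - fld x) at_bot (at_right (-1))"
  proof (rule filterlim_artanh_plus_bounded(2))
    show "\<bar>fld x\<bar> \<le> \<bar>\<alpha>\<bar> + \<bar>\<theta>\<bar>" if "\<bar>x\<bar> < 1" for x
      using abs_tilt_affine_le[of 0 x] that by (auto simp: abs_less_iff)
  qed
  then have "eventually (\<lambda>x. mom x \<le> - 1) (at_right (-1))"
    unfolding mom_def filterlim_at_bot by blast
  moreover have "eventually (\<lambda>x. x < c) (at_right (-1))"
    using assms by (auto simp: eventually_at_right_field)
  moreover have "eventually (\<lambda>x::real. - 1 < x) (at_right (-1))"
    by (auto simp: eventually_at_right_field intro!: exI[of _ 0])
  ultimately have "eventually (\<lambda>x. - 1 < x \<and> x < c \<and> mom x < 0) (at_right (-1))"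
    by eventually_elim auto
  then show ?thesis by (rule eventually_happens'[rotated]) simp
qed

lemma ex_mom_pos:
  assumes "c < 1"
  shows "\<exists>z. c < z \<and> z < 1 \<and> mom z > 0"
proof -
  have "filterlim (\<lambda>x. artanh x - fld x) at_top (at_left 1)"
  proof (rule filterlim_artanh_plus_bounded(1))
    show "\<bar>fld x\<bar> \<le> \<bar>\<alpha>\<bar> + \<bar>\<theta>\<bar>" if "\<bar>x\<bar> < 1" for x
      using abs_tilt_affine_le[of 0 x] that by (auto simp: abs_less_iff)
  qed
  then have "eventually (\<lambda>x. mom x \<ge> 1) (at_left 1)"
    unfolding mom_def filterlim_at_top by blast
  moreover have "eventually (\<lambda>x. c < x) (at_left 1)"
    using assms by (auto simp: eventually_at_left_field)
  moreover have "eventually (\<lambda>x::real. x < 1) (at_left 1)"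
    by (auto simp: eventually_at_left_field intro!: exI[of _ 0])
  ultimately have "eventually (\<lambda>x. c < x \<and> x < 1 \<and> mom x > 0) (at_left 1)"
    by eventually_elim auto
  then show ?thesis by (rule eventually_happens'[rotated]) simp
qed

text \<open>Between \<open>-\<rho>\<close> and \<open>\<rho>\<close> the function \<open>mom\<close>
  strictly decreases, although it runs from minus to plus infinity over \<open>(-1,1)\<close>. A
  zero in the inner interval thus forces another one outside: left of \<open>-\<rho>\<close>, or
  right of \<open>\<rho>\<close> if the zero is \<open>-\<rho>\<close> itself.\<close>

lemma mom_nonzero_inner_if_unique_root:
  assumes \<alpha>: "\<alpha> > 1" and uniq: "\<And>x y. \<bar>x\<bar> < 1 \<Longrightarrow> \<bar>y\<bar> < 1 \<Longrightarrow> mom x = 0 \<Longrightarrow> mom y = 0 \<Longrightarrow> x = y"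
    and x: "\<bar>x\<bar> \<le> inner_radius \<alpha>"
  shows "mom x \<noteq> 0"
proof
  assume 0: "mom x = 0"
  define \<rho> where "\<rho> = inner_radius \<alpha>"
  have \<rho>: "0 < \<rho>" "\<rho> < 1" using inner_radius_bounds[OF \<alpha>] by (auto simp: \<rho>_def)
  have x1: "\<bar>x\<bar> < 1" using x \<rho> by (simp add: \<rho>_def)
  have anti: "mom v < mom u" if "- \<rho> \<le> u" "u < v" "v \<le> \<rho>" for u v
  proof (rule DERIV_neg_imp_decreasing_open[OF that(2)])
    fix z assume z: "u < z" "z < v"
    then have "\<bar>z\<bar> < \<rho>" "\<bar>z\<bar> < 1" using that \<rho> by auto
    then have "\<alpha> * (1 - z\<^sup>2) > 1" "1 - z\<^sup>2 > 0" using inner_iff[OF \<alpha>, of z] by (auto simp: \<rho>_def abs_square_less_1)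
    then have "1 / (1 - z\<^sup>2) - \<alpha> < 0" by (simp add: divide_less_eq)
    then show "\<exists>y. (mom has_real_derivative y) (at z) \<and> y < 0" using mom_has_derivative[OF \<open>\<bar>z\<bar> < 1\<close>] by blast
  next
    show "continuous_on {u..v} mom" using that \<rho> by (intro continuous_on_mom) auto
  qed
  show False
  proof (cases "- \<rho> < x")
    case True
    then have "mom (- \<rho>) > 0" using anti[of "- \<rho>" x] x 0 by (simp add: \<rho>_def)
    moreover obtain z where z: "- 1 < z" "z < - \<rho>" "mom z < 0" using ex_mom_neg[of "- \<rho>"] \<rho> by auto
    ultimately obtain w where "z \<le> w" "w \<le> - \<rho>" "mom w = 0"
      using IVT'[of "mom" z 0 "- \<rho>"] continuous_on_mom[of "{z..- \<rho>}"] \<rho> by force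
    then show False using uniq[of w x] 0 z x1 True \<rho> by auto
  next
    case False
    then have "x = - \<rho>" using x by (simp add: \<rho>_def)
    then have "mom \<rho> < 0" using anti[of "- \<rho>" \<rho>] 0 \<rho> by simp
    moreover obtain z where z: "\<rho> < z" "z < 1" "mom z > 0" using ex_mom_pos[of "\<rho>"] \<rho> by auto
    ultimately obtain w where "\<rho> \<le> w" "w \<le> z" "mom w = 0"
      using IVT'[of "mom" \<rho> 0 z] continuous_on_mom[of "{\<rho>..z}"] \<rho> by force
    then show False using uniq[of w x] 0 z x1 \<open>x = - \<rho>\<close> \<rho> by auto
  qed
qed

lemma ex_min_abs_mom:
  assumes \<alpha>: "\<alpha> > 1"
  obtains y where "\<bar>y\<bar> \<le> inner_radius \<alpha>" "\<And>z. \<bar>z\<bar> \<le> inner_radius \<alpha> \<Longrightarrow> \<bar>mom y\<bar> \<le> \<bar>mom z\<bar>"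
proof -
  note \<rho> = inner_radius_bounds[OF \<alpha>]
  have "continuous_on {- inner_radius \<alpha>..inner_radius \<alpha>} (\<lambda>y. \<bar>mom y\<bar>)"
    using \<rho> by (intro continuous_intros continuous_on_mom) auto
  then obtain y where "y \<in> {- inner_radius \<alpha>..inner_radius \<alpha>}"
    "\<forall>z\<in>{- inner_radius \<alpha>..inner_radius \<alpha>}. \<bar>mom y\<bar> \<le> \<bar>mom z\<bar>"
    using continuous_attains_inf[of "{- inner_radius \<alpha>..inner_radius \<alpha>}"] \<rho> by force
  then show ?thesis by (intro that[of y]) (auto simp: abs_le_iff)
qed

text \<open>By \<open>flow_slope_pos_outside\<close> only characteristics from the inner interval
  that are still alive can spoil monotonicity.\<close>

lemma C1partial_if_window_misses_inner:
  assumes t: "t > 0" and \<alpha>: "\<alpha> \<ge> 0"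
    and miss: "\<And>y. \<bar>y\<bar> < 1 \<Longrightarrow> \<alpha> * (1 - y\<^sup>2) > 1 \<Longrightarrow> \<bar>tanh (mom y)\<bar> < exp (- 2 * t) \<Longrightarrow>
      slope t y > 0"
  shows "C1partial (It \<alpha> \<theta> t)"
proof (rule C1partial_if_flow_increasing[OF t \<alpha>])
  fix z assume z: "\<bar>z\<bar> < 1" "\<bar>flow t z\<bar> < 1"
  show "slope t z > 0"
  proof (cases "\<alpha> * (1 - z\<^sup>2) > 1")
    case True
    then show ?thesis using miss[OF z(1)] abs_flow_le_iff(2)[OF z(1), of t] z t by (simp add: mom_def)
  next
    case False
    then show ?thesis using flow_slope_pos_outside[OF t z] by simp
  qed
qed

text \<open>For \<open>\<alpha> \<le> 1\<close> there is no inner interval. For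
  \<open>\<alpha> > 1\<close> the initial momentum is bounded away from 0 on it, so all its
  characteristics have left by a common time.\<close>

theorem eventually_C1partial:
  assumes \<alpha>: "\<alpha> \<ge> 0" and uniq: "\<exists>!x. x \<in> {-1<..<1} \<and> deriv (I0 \<alpha> \<theta>) x = 0"
  shows "\<exists>tstar\<ge>0. \<forall>t\<ge>tstar. C1partial (It \<alpha> \<theta> t)"
proof (cases "\<alpha> > 1")
  case False
  have "C1partial (It \<alpha> \<theta> t)" if "t \<ge> 1" for t
  proof (rule C1partial_if_window_misses_inner)
    fix y :: real assume y: "\<bar>y\<bar> < 1" "\<alpha> * (1 - y\<^sup>2) > 1"
    have "\<alpha> * (1 - y\<^sup>2) \<le> 1 * 1"
      using False \<alpha> y(1) by (intro mult_mono) (auto simp: abs_square_le_1)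
    then show "slope t y > 0" using y(2) by simp
  qed (use that \<alpha> in auto)
  then show ?thesis by (intro exI[of _ 1]) auto
next
  case True
  have u: "x = y" if "\<bar>x\<bar> < 1" "\<bar>y\<bar> < 1" "mom x = 0" "mom y = 0" for x y
  proof -
    have "x \<in> {-1<..<1} \<and> deriv (I0 \<alpha> \<theta>) x = 0" "y \<in> {-1<..<1} \<and> deriv (I0 \<alpha> \<theta>) y = 0"
      using that deriv_I0_mom by auto
    then show ?thesis using uniq by blast
  qed
  obtain y0 where y0: "\<bar>y0\<bar> \<le> inner_radius \<alpha>" "\<And>z. \<bar>z\<bar> \<le> inner_radius \<alpha> \<Longrightarrow> \<bar>mom y0\<bar> \<le> \<bar>mom z\<bar>"
    using ex_min_abs_mom[OF True] by blast
  define m where "m = tanh \<bar>mom y0\<bar>"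
  have "mom y0 \<noteq> 0" by (rule mom_nonzero_inner_if_unique_root[OF True u y0(1)])
  then have m: "m > 0" by (simp add: m_def del: tanh_real_abs)
  \<comment> \<open>\<open>- ln m / 2\<close> is the exit time for the smallest initial momentum in
    the inner interval; the 1 keeps \<open>t\<close> positive.\<close>
  have "C1partial (It \<alpha> \<theta> t)" if t: "t \<ge> max 1 (- ln m / 2)" for t
  proof (rule C1partial_if_window_misses_inner)
    fix y :: real assume y: "\<bar>y\<bar> < 1" "\<alpha> * (1 - y\<^sup>2) > 1" "\<bar>tanh (mom y)\<bar> < exp (- 2 * t)"
    have "- 2 * t \<le> ln m" using t by simp
    then have "exp (- 2 * t) \<le> exp (ln m)" by (rule exp_le_cancel_iff[THEN iffD2])
    then have "exp (- 2 * t) \<le> m" using m by simp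
    moreover have "m \<le> tanh \<bar>mom y\<bar>"
      unfolding m_def tanh_real_le_iff using y inner_iff[OF True] by (intro y0(2)) auto
    ultimately show "slope t y > 0"
      using y(3) by (simp add: tanh_real_abs[symmetric] del: tanh_real_abs)
  qed (use t \<alpha> in auto)
  then show ?thesis by (intro exI[of _ "max 1 (- ln m / 2)"]) auto
qed

lemma continuous_on_stretch: "continuous_on A stretch"
  unfolding stretch_def[abs_def] by (intro continuous_intros)

lemma slope_eq_tanh: "cosh (2 * t) + sinh (2 * t) * k = cosh (2 * t) * (1 + tanh (2 * t) * (k::real))"
  by (simp add: tanh_def distrib_left)

text \<open>\<open>t0\<close> is the first focusing time in the inner interval, attained at
  \<open>c\<close>, and \<open>t2\<close> is the last exit time from it, attained at
  \<open>ym\<close>.\<close>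

theorem strong_field_phases:
  assumes \<alpha>: "\<alpha> > 1"
    and nz: "\<And>y. \<bar>y\<bar> \<le> inner_radius \<alpha> \<Longrightarrow> mom y \<noteq> 0"
    and c: "\<bar>c\<bar> < inner_radius \<alpha>" "\<And>z. \<bar>z\<bar> \<le> inner_radius \<alpha> \<Longrightarrow> stretch c \<le> stretch z"
  shows "\<exists>t0 t1 t2. 0 \<le> t0 \<and> t0 < t1 \<and> t1 \<le> t2 \<and>
          (\<forall>t. 0 \<le> t \<and> t < t0 \<longrightarrow> C1partial (It \<alpha> \<theta> t)) \<and>
          (\<forall>t. t0 < t \<and> t < t2 \<longrightarrow> overhang (Gt \<alpha> \<theta> t)) \<and>
          (\<forall>t. t0 < t \<and> t < t1 \<longrightarrow> \<not> diff_on_open (It \<alpha> \<theta> t)) \<and>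
          (\<forall>t. t > t2 \<longrightarrow> C1partial (It \<alpha> \<theta> t))"
proof -
  define \<rho> where "\<rho> = inner_radius \<alpha>"
  have \<rho>: "0 < \<rho>" "\<rho> < 1" using inner_radius_bounds[OF \<alpha>] by (auto simp: \<rho>_def)
  have c1: "\<bar>c\<bar> < 1" using c \<rho> by (simp add: \<rho>_def)
  define K where "K = - stretch c"
  have "stretch c + cosh (2 * mom c) < 0"
    unfolding mom_def using c(1) inner_iff[OF \<alpha>, of c] by (intro stretch_plus_cosh_sign(2)[OF c1]) simp
  then have K: "K > cosh (2 * mom c)" by (simp add: K_def)
  then have K1: "K > 1" using cosh_real_ge_1[of "2 * mom c"] by linarith
  \<comment> \<open>The solution of \<open>slope t c = 0\<close>, that is of
    \<open>tanh (2 * t) * K = 1\<close>.\<close>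
  define t0 where "t0 = artanh (1 / K) / 2"
  have T0: "tanh (2 * t0) = 1 / K" using K1 by (simp add: t0_def)
  have t0: "t0 > 0"
  proof -
    have "tanh (2 * t0) > 0" using T0 K1 by simp
    then show ?thesis by simp
  qed
  have after: "slope t c < 0" if "t > t0" for t
  proof -
    have "tanh (2 * t) > 1 / K" unfolding T0[symmetric] tanh_real_less_iff using that by simp
    then have "1 + tanh (2 * t) * stretch c < 0" using K1 by (simp add: K_def[symmetric] field_simps) (simp add: K_def)
    then show ?thesis unfolding slope_eq_tanh by (intro mult_pos_neg) auto
  qed
  have before: "slope t y \<ge> 0"
    "t < t0 \<Longrightarrow> slope t y > 0" if t: "0 < t" "t \<le> t0" and y: "\<bar>y\<bar> \<le> \<rho>" for t y
  proof -
    have "tanh (2 * t) * stretch y \<ge> tanh (2 * t) * (- K)"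
      using c(2) y t by (intro mult_left_mono) (auto simp: K_def \<rho>_def)
    moreover have "tanh (2 * t) \<le> 1 / K" unfolding T0[symmetric] tanh_real_le_iff using t by simp
    then have "tanh (2 * t) * K \<le> 1" using K1 by (simp add: field_simps)
    ultimately have "1 + tanh (2 * t) * stretch y \<ge> 0" by simp
    then show "slope t y \<ge> 0" unfolding slope_eq_tanh by simp
    show "slope t y > 0" if "t < t0"
    proof -
      have "tanh (2 * t) < 1 / K" unfolding T0[symmetric] tanh_real_less_iff using that by simp
      then have "tanh (2 * t) * K < 1" using K1 by (simp add: field_simps)
      then have "1 + tanh (2 * t) * stretch y > 0"
        using \<open>tanh (2 * t) * stretch y \<ge> tanh (2 * t) * (- K)\<close> by simp
      then show ?thesis unfolding slope_eq_tanh by simp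
    qed
  qed
  obtain ym where ym: "\<bar>ym\<bar> \<le> \<rho>" "\<And>z. \<bar>z\<bar> \<le> \<rho> \<Longrightarrow> \<bar>mom ym\<bar> \<le> \<bar>mom z\<bar>"
    unfolding \<rho>_def using ex_min_abs_mom[OF \<alpha>] by blast
  define m where "m = tanh \<bar>mom ym\<bar>"
  have m: "m > 0" using nz[of ym] ym(1) by (simp add: m_def \<rho>_def del: tanh_real_abs)
  have mle: "m \<le> \<bar>tanh (mom z)\<bar>" if "\<bar>z\<bar> \<le> \<rho>" for z
    using ym(2)[OF that] unfolding m_def tanh_real_abs[symmetric] tanh_real_le_iff .
  define t2 where "t2 = - ln m / 2"
  have e2: "exp (- 2 * t2) = m" using m by (simp add: t2_def)
  \<comment> \<open>The characteristic from \<open>c\<close> is still inside when it focuses,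
    because \<open>K > cosh (2 * mom c)\<close>.\<close>
  have wc: "\<bar>tanh (mom c)\<bar> < exp (- 2 * t0)"
  proof -
    have "cosh (2 * t0) = K * sinh (2 * t0)" using T0 K1 by (simp add: tanh_def field_simps)
    then show ?thesis unfolding abs_tanh_less_exp_iff using K t0 by (simp add: mult.commute)
  qed
  have t02: "t0 < t2"
  proof -
    have "exp (- 2 * t2) < exp (- 2 * t0)" unfolding e2 using mle[of c] wc c(1) by (simp add: \<rho>_def)
    then show ?thesis by simp
  qed
  have oh: "overhang (Gt \<alpha> \<theta> t)" if t: "t0 < t" "t < t2" for t
  proof -
    have tp: "t > 0" using t t0 by simp
    \<comment> \<open>\<open>U1\<close> collects the starting points already focused,
      \<open>U2\<close> those still inside. They cover the inner interval because focusing precedes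
      exit there; connectedness then gives a point with both properties.\<close>
    define U1 where "U1 = {y. slope t y < 0}"
    define U2 where "U2 = {y\<in>{-1<..<1}. \<bar>tanh (mom y)\<bar> < exp (- 2 * t)}"
    have o1: "open U1" unfolding U1_def by (intro open_Collect_less continuous_intros continuous_on_stretch)
    have o2: "open U2"
    proof -
      have "continuous_on {-1<..<1} (\<lambda>y. \<bar>tanh (mom y)\<bar>)"
        by (intro continuous_intros continuous_on_mom) auto
      from continuous_open_preimage[OF this open_greaterThanLessThan open_lessThan[of "exp (- 2 * t)"]]
      show ?thesis by (simp add: U2_def vimage_def Int_def)
    qed
    have cov: "{- \<rho><..<\<rho>} \<subseteq> U1 \<union> U2"
    proof
      fix y assume y: "y \<in> {- \<rho><..<\<rho>}"
      then have y1: "\<bar>y\<bar> < 1" "\<bar>y\<bar> < \<rho>" using \<rho> by auto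
      show "y \<in> U1 \<union> U2"
      proof (cases "y \<in> U2")
        case False
        then have "\<not> \<bar>tanh (mom y)\<bar> < exp (- 2 * t)" using y1 by (auto simp: U2_def abs_less_iff)
        then have "sinh (2 * t) * cosh (2 * mom y) \<ge> cosh (2 * t)" unfolding abs_tanh_less_exp_iff by simp
        moreover have "stretch y + cosh (2 * mom y) < 0"
          unfolding mom_def using y1(2) inner_iff[OF \<alpha>, of y] by (intro stretch_plus_cosh_sign(2)[OF y1(1)]) (simp add: \<rho>_def)
        then have "sinh (2 * t) * (stretch y + cosh (2 * mom y)) < 0"
          by (rule mult_pos_neg[rotated]) (use tp in simp)
        ultimately have "y \<in> U1" by (simp add: U1_def distrib_left)
        then show ?thesis by simp
      qed simp
    qed
    have n1: "c \<in> U1 \<inter> {- \<rho><..<\<rho>}" using after[OF t(1)] c(1) by (auto simp: U1_def \<rho>_def)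
    have "ym \<in> U2"
    proof -
      have "\<bar>tanh (mom ym)\<bar> = exp (- 2 * t2)" by (simp only: e2 m_def tanh_real_abs)
      also have "\<dots> < exp (- 2 * t)" using t by simp
      finally show ?thesis using ym(1) \<rho> by (auto simp: U2_def)
    qed
    \<comment> \<open>The point \<open>ym\<close> may be an endpoint of the inner interval; as
      \<open>U2\<close> is open it then contains inner points as well.\<close>
    moreover have "ym \<in> closure {- \<rho><..<\<rho>}" using ym(1) \<rho> by (auto simp: closure_greaterThanLessThan)
    ultimately have n2: "U2 \<inter> {- \<rho><..<\<rho>} \<noteq> {}"
      using open_Int_closure_eq_empty[OF o2, of "{- \<rho><..<\<rho>}"] by blast
    have "connected {- \<rho><..<\<rho>}" by simp
    then have "U1 \<inter> U2 \<inter> {- \<rho><..<\<rho>} \<noteq> {}"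
      using connectedD[OF _ o1 o2 _ cov] n1 n2 by blast
    then obtain y where y: "y \<in> U1" "y \<in> U2" by blast
    then have y1: "\<bar>y\<bar> < 1" by (auto simp: U2_def)
    show ?thesis
    proof (rule overhang_if_flow_decreasing[OF tp y1])
      show "\<bar>flow t y\<bar> < 1" using y(2) tp unfolding abs_flow_le_iff(2)[OF y1 less_imp_le[OF tp]] by (simp add: U2_def mom_def)
      show "slope t y < 0" using y(1) by (simp add: U1_def)
    qed
  qed
  have early: "C1partial (It \<alpha> \<theta> t)" if t: "0 \<le> t" "t < t0" for t
  proof (cases "t = 0")
    case True
    then show ?thesis using C1partial_It_0 by simp
  next
    case False
    show ?thesis
    proof (rule C1partial_if_window_misses_inner)
      fix y :: real assume "\<alpha> * (1 - y\<^sup>2) > 1"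
      then have "\<bar>y\<bar> \<le> \<rho>" using inner_iff[OF \<alpha>, of y] by (simp add: \<rho>_def)
      then show "slope t y > 0" using before(2)[of t y] t False by simp
    qed (use t False \<alpha> in auto)
  qed
  have late: "C1partial (It \<alpha> \<theta> t)" if t: "t > t2" for t
  proof (rule C1partial_if_window_misses_inner)
    fix y :: real assume y: "\<alpha> * (1 - y\<^sup>2) > 1" "\<bar>tanh (mom y)\<bar> < exp (- 2 * t)"
    have "m \<le> \<bar>tanh (mom y)\<bar>" using inner_iff[OF \<alpha>, of y] y(1) by (intro mle) (simp add: \<rho>_def)
    moreover have "exp (- 2 * t) < exp (- 2 * t2)" using t by simp
    ultimately show "slope t y > 0" using y(2) e2 by simp
  qed (use t t02 t0 \<alpha> in auto)
  have "\<exists>\<delta>>0. \<forall>t. t0 < t \<and> t < t0 + \<delta> \<longrightarrow> \<not> diff_on_open (It \<alpha> \<theta> t)"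
  proof (rule not_differentiable_after_first_fold[OF t0 _ c1])
    show "\<bar>flow t0 c\<bar> < 1"
      using wc unfolding abs_flow_le_iff(2)[OF c1 less_imp_le[OF t0]] by (simp add: mom_def)
    show "slope t0 z \<ge> 0" if z: "\<bar>z\<bar> < 1" "\<bar>flow t0 z\<bar> < 1" for z
    proof (cases "\<bar>z\<bar> < \<rho>")
      case True
      then show ?thesis using before(1)[OF t0] by simp
    next
      case False
      then have "\<alpha> * (1 - z\<^sup>2) \<le> 1" using inner_iff[OF \<alpha>, of z] by (simp add: \<rho>_def)
      then show ?thesis using flow_slope_pos_outside[OF t0 z] by (simp add: less_imp_le)
    qed
  qed (use \<alpha> after in auto)
  then obtain \<delta> where \<delta>: "\<delta> > 0" "\<And>t. t0 < t \<and> t < t0 + \<delta> \<Longrightarrow> \<not> diff_on_open (It \<alpha> \<theta> t)" by blast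
  \<comment> \<open>\<open>t1\<close> is cut off at \<open>t2\<close>, since the duration
    \<open>\<delta>\<close> obtained from the fold need not end before \<open>t2\<close>.\<close>
  show ?thesis
    by (intro exI[of _ t0] exI[of _ "min t2 (t0 + \<delta>)"] exI[of _ t2] conjI allI impI)
      (use t0 t02 \<delta> oh early late in auto)
qed

end

section \<open>Strong fields\<close>

lemma stretch_minus: "stretch \<alpha> (- \<theta>) (- y) = stretch \<alpha> \<theta> y"
proof -
  have "2 * (\<alpha> * (- y) + - \<theta>) = - (2 * (\<alpha> * y + \<theta>))" by simp
  then show ?thesis unfolding stretch_def by (simp only: cosh_minus sinh_minus; simp)
qed

text \<open>Multiplication by \<open>- 2 * exp (- 2 * \<theta>)\<close> splits
  \<open>stretch\<close> into a profile without \<open>\<theta>\<close> and its mirror image damped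
  by \<open>exp (- 4 * \<theta>)\<close>. The sign turns minima of \<open>stretch\<close> into
  maxima.\<close>

lemma stretch_exp:
  "- (2 * exp (- 2 * \<theta>) * stretch \<alpha> \<theta> y) =
     exp (2 * \<alpha> * y) * (2 * \<alpha> * (1 - y) - 1) + exp (- 4 * \<theta>) * (exp (- 2 * \<alpha> * y) * (2 * \<alpha> * (1 + y) - 1))"
proof -
  define a where "a = exp (2 * \<alpha> * y)"
  define a' where "a' = exp (- 2 * \<alpha> * y)"
  define c where "c = exp (2 * \<theta>)"
  define c' where "c' = exp (- 2 * \<theta>)"
  have cc: "c' * c = 1" unfolding c_def c'_def by (simp flip: exp_add)
  have "exp (2 * (\<alpha> * y + \<theta>)) = a * c" "exp (- (2 * (\<alpha> * y + \<theta>))) = a' * c'"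
    unfolding a_def a'_def c_def c'_def exp_add[symmetric] by (rule arg_cong[of _ _ exp], simp)+
  then have C: "cosh (2 * (\<alpha> * y + \<theta>)) = (a * c + a' * c') / 2" and S: "sinh (2 * (\<alpha> * y + \<theta>)) = (a * c - a' * c') / 2"
    unfolding cosh_field_def sinh_field_def by simp_all
  have e4: "exp (- 4 * \<theta>) = c' * c'" unfolding c'_def exp_add[symmetric] by (rule arg_cong[of _ _ exp]) simp
  have "- (2 * c' * stretch \<alpha> \<theta> y) = (c' * c) * (a * (2 * \<alpha> * (1 - y) - 1)) + c' * c' * (a' * (2 * \<alpha> * (1 + y) - 1))"
    unfolding stretch_def C S by (simp add: field_simps)
  then show ?thesis unfolding cc e4 unfolding a_def[symmetric] a'_def[symmetric] c'_def[symmetric] by simp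
qed

lemma exp_gt_add_one: "x \<noteq> 0 \<Longrightarrow> 1 + x < exp (x::real)"
proof -
  assume x: "x \<noteq> 0"
  show ?thesis
  proof (cases "1 + x / 2 \<ge> 0")
    case True
    have "(1 + x / 2)\<^sup>2 \<le> (exp (x / 2))\<^sup>2" by (rule power_mono[OF exp_ge_add_one_self True])
    also have "(exp (x / 2))\<^sup>2 = exp x" by (simp add: power2_eq_square flip: exp_add)
    also have "(1 + x / 2)\<^sup>2 = 1 + x + (x / 2)\<^sup>2" by (simp add: power2_eq_square algebra_simps)
    moreover have "(x / 2)\<^sup>2 > 0" using x by simp
    ultimately show ?thesis by linarith
  next
    case False
    then have "1 + x < 0" by simp
    then show ?thesis using exp_gt_zero[of x] by linarith
  qed
qed

text \<open>The second factor is \<open>1 + x\<close> with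
  \<open>x = 2 * \<alpha> * (1 - z) - 2\<close>, and \<open>1 + x < exp x\<close> unless
  \<open>x = 0\<close>. The product \<open>exp (2 * \<alpha> * z) * exp x\<close> no longer contains
  \<open>z\<close>.\<close>

lemma stretch_profile_max:
  fixes \<alpha> z :: real
  assumes \<alpha>: "\<alpha> > 1" and z: "z \<noteq> 1 - 1 / \<alpha>"
  shows "exp (2 * \<alpha> * z) * (2 * \<alpha> * (1 - z) - 1) < exp (2 * \<alpha> * (1 - 1 / \<alpha>)) * (2 * \<alpha> * (1 - (1 - 1 / \<alpha>)) - 1)"
proof -
  define x where "x = 2 * \<alpha> * (1 - z) - 2"
  have x: "x \<noteq> 0" using z \<alpha> by (auto simp: x_def field_simps)
  have "exp (2 * \<alpha> * z) * (2 * \<alpha> * (1 - z) - 1) = exp (2 * \<alpha> * z) * (1 + x)" by (simp add: x_def)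
  also have "\<dots> < exp (2 * \<alpha> * z) * exp x" using exp_gt_add_one[OF x] by simp
  also have "\<dots> = exp (2 * \<alpha> - 2)" unfolding exp_add[symmetric] by (rule arg_cong[of _ _ exp]) (simp add: x_def algebra_simps)
  also have "\<dots> = exp (2 * \<alpha> * (1 - 1 / \<alpha>)) * (2 * \<alpha> * (1 - (1 - 1 / \<alpha>)) - 1)" using \<alpha> by (simp add: field_simps)
  finally show ?thesis .
qed

lemma eventually_stretch_less:
  assumes \<alpha>: "\<alpha> > 1" and z: "z \<noteq> 1 - 1 / \<alpha>"
  shows "eventually (\<lambda>\<theta>. stretch \<alpha> \<theta> (1 - 1 / \<alpha>) < stretch \<alpha> \<theta> z) at_top"
proof -
  define E where "E y = exp (2 * \<alpha> * y) * (2 * \<alpha> * (1 - y) - 1)" for y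
  define R where "R y = exp (- 2 * \<alpha> * y) * (2 * \<alpha> * (1 + y) - 1)" for y
  let ?p = "1 - 1 / \<alpha>"
  have "((\<lambda>\<theta>::real. exp (- 4 * \<theta>)) \<longlongrightarrow> 0) at_top" by real_asymp
  then have "((\<lambda>\<theta>. (E ?p + exp (- 4 * \<theta>) * R ?p) - (E z + exp (- 4 * \<theta>) * R z)) \<longlongrightarrow> (E ?p + 0 * R ?p) - (E z + 0 * R z)) at_top"
    by (intro tendsto_intros)
  moreover have "E ?p - E z > 0" using stretch_profile_max[OF assms] by (simp add: E_def)
  ultimately have "eventually (\<lambda>\<theta>. (E ?p + exp (- 4 * \<theta>) * R ?p) - (E z + exp (- 4 * \<theta>) * R z) > 0) at_top"
    by (intro order_tendstoD(1)[of _ "E ?p - E z"]) simp_all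
  then show ?thesis
  proof eventually_elim
    case (elim \<theta>)
    have e: "E y + exp (- 4 * \<theta>) * R y = - (2 * exp (- 2 * \<theta>) * stretch \<alpha> \<theta> y)" for y
      unfolding stretch_exp E_def R_def ..
    have "2 * exp (- 2 * \<theta>) * stretch \<alpha> \<theta> ?p < 2 * exp (- 2 * \<theta>) * stretch \<alpha> \<theta> z"
      using elim unfolding e by linarith
    then show ?case by simp
  qed
qed

text \<open>For a strong field \<open>stretch\<close> is close to a multiple of the profile
  \<open>y \<mapsto> exp (2 * \<alpha> * y) * (1 - 2 * \<alpha> * (1 - y))\<close>, which has its minimum at \<open>1 - 1 / \<alpha>\<close>.\<close>

lemma ex_field_threshold:
  assumes \<alpha>: "\<alpha> > 1"
  obtains \<kappa> where "\<kappa> > 0"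
    "\<And>\<theta> y. \<bar>\<theta>\<bar> > \<kappa> \<Longrightarrow> \<bar>y\<bar> \<le> inner_radius \<alpha> \<Longrightarrow> mom \<alpha> \<theta> y \<noteq> 0"
    "\<And>\<theta>. \<bar>\<theta>\<bar> > \<kappa> \<Longrightarrow> \<exists>c. \<bar>c\<bar> < inner_radius \<alpha> \<and> (\<forall>z. \<bar>z\<bar> \<le> inner_radius \<alpha> \<longrightarrow> stretch \<alpha> \<theta> c \<le> stretch \<alpha> \<theta> z)"
proof -
  define \<rho> where "\<rho> = inner_radius \<alpha>"
  have \<rho>: "0 < \<rho>" "\<rho> < 1" using inner_radius_bounds[OF \<alpha>] by (auto simp: \<rho>_def)
  \<comment> \<open>The minimiser in the limit of strong fields. It equals
    \<open>\<rho> * \<rho>\<close> and hence lies strictly between 0 and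
    \<open>\<rho>\<close>.\<close>
  define p where "p = 1 - 1 / \<alpha>"
  have p: "p = \<rho> * \<rho>" "0 < p" using \<alpha> by (auto simp: p_def \<rho>_def inner_radius_def)
  then have p\<rho>: "p < \<rho>" using \<rho> by simp
  have "eventually (\<lambda>\<theta>. stretch \<alpha> \<theta> p < stretch \<alpha> \<theta> \<rho> \<and> stretch \<alpha> \<theta> p < stretch \<alpha> \<theta> (- \<rho>)) at_top"
    using \<open>0 < p\<close> p\<rho> \<rho> eventually_stretch_less[OF \<alpha>, of \<rho>] eventually_stretch_less[OF \<alpha>, of "- \<rho>"]
    unfolding p_def[symmetric] by (intro eventually_conj) simp_all
  then obtain N where N: "\<And>\<theta>. \<theta> \<ge> N \<Longrightarrow> stretch \<alpha> \<theta> p < stretch \<alpha> \<theta> \<rho> \<and> stretch \<alpha> \<theta> p < stretch \<alpha> \<theta> (- \<rho>)"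
    unfolding eventually_at_top_linorder by blast
  have "compact (mom \<alpha> 0 ` {- \<rho>..\<rho>})" using \<rho> by (intro compact_continuous_image continuous_on_mom) auto
  then have "bounded (mom \<alpha> 0 ` {- \<rho>..\<rho>})" by (rule compact_imp_bounded)
  then obtain M where "\<forall>x\<in>mom \<alpha> 0 ` {- \<rho>..\<rho>}. norm x \<le> M" unfolding bounded_iff ..
  then have M: "\<bar>mom \<alpha> 0 y\<bar> \<le> M" if "y \<in> {- \<rho>..\<rho>}" for y using that by simp
  \<comment> \<open>Beyond \<open>N\<close> the value of \<open>stretch\<close> at \<open>p\<close>
    beats both ends of the inner interval. Beyond \<open>M\<close> the field outweighs the momentum
    at zero field, so \<open>mom\<close> has no inner zero.\<close>
  define \<kappa> where "\<kappa> = max 1 (max N M)"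
  show ?thesis
  proof (rule that[of \<kappa>])
    show "\<kappa> > 0" by (simp add: \<kappa>_def)
    show "mom \<alpha> \<theta> y \<noteq> 0" if "\<bar>\<theta>\<bar> > \<kappa>" "\<bar>y\<bar> \<le> inner_radius \<alpha>" for \<theta> y
    proof -
      have "\<bar>mom \<alpha> 0 y\<bar> \<le> M" using that by (intro M) (auto simp: \<rho>_def abs_le_iff)
      then show ?thesis using that by (auto simp: \<kappa>_def mom_def)
    qed
    show "\<exists>c. \<bar>c\<bar> < inner_radius \<alpha> \<and> (\<forall>z. \<bar>z\<bar> \<le> inner_radius \<alpha> \<longrightarrow> stretch \<alpha> \<theta> c \<le> stretch \<alpha> \<theta> z)"
      if \<theta>: "\<bar>\<theta>\<bar> > \<kappa>" for \<theta>
    proof -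
      \<comment> \<open>A value below both boundary values keeps the minimiser off the boundary.
        Negative fields are reduced to positive ones by reflection.\<close>
      have "\<exists>x\<in>{- \<rho>..\<rho>}. stretch \<alpha> \<theta> x < stretch \<alpha> \<theta> \<rho> \<and> stretch \<alpha> \<theta> x < stretch \<alpha> \<theta> (- \<rho>)"
      proof (cases "\<theta> \<ge> 0")
        case True
        then have "\<theta> \<ge> N" using \<theta> by (simp add: \<kappa>_def)
        then show ?thesis using N[of \<theta>] p(2) p\<rho> \<rho> by (intro bexI[of _ p]) auto
      next
        case False
        then have "- \<theta> \<ge> N" using \<theta> by (simp add: \<kappa>_def)
        then have "stretch \<alpha> \<theta> (- p) < stretch \<alpha> \<theta> (- \<rho>) \<and> stretch \<alpha> \<theta> (- p) < stretch \<alpha> \<theta> \<rho>"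
          using N[of "- \<theta>"] stretch_minus[of \<alpha> \<theta> "- p"] stretch_minus[of \<alpha> \<theta> \<rho>] stretch_minus[of \<alpha> \<theta> "- \<rho>"] by simp
        then show ?thesis using p(2) p\<rho> \<rho> by (intro bexI[of _ "- p"]) auto
      qed
      then obtain x where x: "x \<in> {- \<rho>..\<rho>}" "stretch \<alpha> \<theta> x < stretch \<alpha> \<theta> \<rho>" "stretch \<alpha> \<theta> x < stretch \<alpha> \<theta> (- \<rho>)" by blast
      obtain c where c: "c \<in> {- \<rho>..\<rho>}" "\<forall>z\<in>{- \<rho>..\<rho>}. stretch \<alpha> \<theta> c \<le> stretch \<alpha> \<theta> z"
        using continuous_attains_inf[OF _ _ continuous_on_stretch, of "{- \<rho>..\<rho>}" \<alpha> \<theta>] \<rho> by auto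
      have "c \<noteq> \<rho>" "c \<noteq> - \<rho>" using c(2) x by (auto dest: bspec[OF _ x(1)])
      then have "\<bar>c\<bar> < \<rho>" using c(1) by auto
      then show ?thesis using c(2) by (intro exI[of _ c]) (auto simp: \<rho>_def abs_le_iff)
    qed
  qed
qed

theorem mainTheorem8:
  shows
   "(\<forall>\<alpha> \<theta>::real. \<alpha> \<ge> 0 \<and> (\<exists>!x. x \<in> {-1<..<1} \<and> deriv (I0 \<alpha> \<theta>) x = 0) \<longrightarrow>
       (\<exists>tstar\<ge>0. \<forall>t\<ge>tstar. C1partial (It \<alpha> \<theta> t)))
    \<and>
    (\<forall>\<alpha>::real. \<alpha> > 1 \<longrightarrow> (\<exists>\<kappa>>0. \<forall>\<theta>::real. \<bar>\<theta>\<bar> > \<kappa> \<longrightarrow>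
       (\<exists>t0 t1 t2. 0 \<le> t0 \<and> t0 < t1 \<and> t1 \<le> t2 \<and>
          (\<forall>t. 0 \<le> t \<and> t < t0 \<longrightarrow> C1partial (It \<alpha> \<theta> t)) \<and>
          (\<forall>t. t0 < t \<and> t < t2 \<longrightarrow> overhang (Gt \<alpha> \<theta> t)) \<and>
          (\<forall>t. t0 < t \<and> t < t1 \<longrightarrow> \<not> diff_on_open (It \<alpha> \<theta> t)) \<and>
          (\<forall>t. t > t2 \<longrightarrow> C1partial (It \<alpha> \<theta> t)))))"
proof (intro conjI allI impI)
  fix \<alpha> \<theta> :: real
  assume "\<alpha> \<ge> 0 \<and> (\<exists>!x. x \<in> {-1<..<1} \<and> deriv (I0 \<alpha> \<theta>) x = 0)"
  then show "\<exists>tstar\<ge>0. \<forall>t\<ge>tstar. C1partial (It \<alpha> \<theta> t)"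
    by (intro eventually_C1partial) (elim conjE; assumption)+
next
  fix \<alpha> :: real
  assume \<alpha>: "\<alpha> > 1"
  obtain \<kappa> where \<kappa>: "\<kappa> > 0"
    "\<And>\<theta> y. \<bar>\<theta>\<bar> > \<kappa> \<Longrightarrow> \<bar>y\<bar> \<le> inner_radius \<alpha> \<Longrightarrow> mom \<alpha> \<theta> y \<noteq> 0"
    "\<And>\<theta>. \<bar>\<theta>\<bar> > \<kappa> \<Longrightarrow> \<exists>c. \<bar>c\<bar> < inner_radius \<alpha> \<and> (\<forall>z. \<bar>z\<bar> \<le> inner_radius \<alpha> \<longrightarrow> stretch \<alpha> \<theta> c \<le> stretch \<alpha> \<theta> z)"
    by (rule ex_field_threshold[OF \<alpha>]) (rule that; blast)
  show "\<exists>\<kappa>>0. \<forall>\<theta>::real. \<bar>\<theta>\<bar> > \<kappa> \<longrightarrow>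
       (\<exists>t0 t1 t2. 0 \<le> t0 \<and> t0 < t1 \<and> t1 \<le> t2 \<and>
          (\<forall>t. 0 \<le> t \<and> t < t0 \<longrightarrow> C1partial (It \<alpha> \<theta> t)) \<and>
          (\<forall>t. t0 < t \<and> t < t2 \<longrightarrow> overhang (Gt \<alpha> \<theta> t)) \<and>
          (\<forall>t. t0 < t \<and> t < t1 \<longrightarrow> \<not> diff_on_open (It \<alpha> \<theta> t)) \<and>
          (\<forall>t. t > t2 \<longrightarrow> C1partial (It \<alpha> \<theta> t)))"
    (is "\<exists>\<kappa>>0. \<forall>\<theta>. \<bar>\<theta>\<bar> > \<kappa> \<longrightarrow> ?phases \<theta>")
  proof (rule exI[of _ \<kappa>], intro conjI allI impI \<kappa>(1))
    fix \<theta> :: real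
    assume \<theta>: "\<bar>\<theta>\<bar> > \<kappa>"
    obtain c where c: "\<bar>c\<bar> < inner_radius \<alpha>" "\<forall>z. \<bar>z\<bar> \<le> inner_radius \<alpha> \<longrightarrow> stretch \<alpha> \<theta> c \<le> stretch \<alpha> \<theta> z"
      using \<kappa>(3)[OF \<theta>] by blast
    show "?phases \<theta>"
      using c(2) by (intro strong_field_phases[OF \<alpha> \<kappa>(2)[OF \<theta>] c(1)]) blast+
  qed
qed

end
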